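(* Let $(E,d)$ be a locally compact separable metric space with a Radon measure $\mu$ of full support. Suppose that $\mathcal L$ is the generator of a Markov process on $E$ whose fundamental solution (transition density with respect to $\mu$) $p^0(t,x,y)$ satisfies, for some $d,\alpha>0$ and positive constants $C_1,c_1,C_2,c_2$, $$C_1t^{-d/\alpha}F\big(c_1d(x,y)/t^{1/\alpha}\big)\le p^0(t,x,y)\le C_2t^{-d/\alpha}F\big(c_2d(x,y)/t^{1/\alpha}\big)\qquad\text{for all }t>0,\ x,y\in E,$$ where $F$ is one of the functions specified below. Let $\{S_t;t\ge0\}$ be a $\beta$-stable subordinator with $0<\beta<1$, let $\bar p(r,\cdot)$ be the density of $S_r$, and let $$q(t,x,y)=\int_0^\infty p^0(r,x,y)\,\bar p(r,t)\,dr$$ be the fundamental solution of the time fractional Poisson equation. Define, for $t,r>0$, $$H_{\le1}(t,r)=\begin{cases}t^{\beta-1-\beta d/\alpha},&d<2\alpha,\\ t^{-1-\beta}\log\left(2t^\beta/r^\alpha\right),&d=2\alpha,\\ t^{-1-\beta}/r^{d-2\alpha},&d>2\alpha,\end{cases}\qquad H^{(j)}_{\ge1}(t,r)=\frac{t^{2\beta-1}}{r^{d+\alpha}}.$$ (i) Suppose $F(r)=(1+r)^{-d-\alpha}$ with $\alpha>0$. Then $$q(t,x,y)\simeq\begin{cases}H_{\le1}(t,d(x,y))&\text{if }d(x,y)\le t^{\beta/\alpha},\\ H^{(j)}_{\ge1}(t,d(x,y))&\text{if }d(x,y)\ge t^{\beta/\alpha}.\end{cases}$$ (ii) Suppose $F(r)=\exp(-r^{\alpha/(\alpha-1)})$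 with $\alpha\ge2$. Then $$q(t,x,y)\simeq H_{\le1}(t,d(x,y))\quad\text{if }d(x,y)\le t^{\beta/\alpha},$$ and there are positive constants $C_3,c_3,C_4,c_4$ such that if $d(x,y)\ge t^{\beta/\alpha}$, $$C_3\,t^{\beta-1-\beta d/\alpha}\exp\Big(-c_3\big(d(x,y)^\alpha/t^\beta\big)^{1/(\alpha-\beta)}\Big)\le q(t,x,y)\le C_4\,t^{\beta-1-\beta d/\alpha}\exp\Big(-c_4\big(d(x,y)^\alpha/t^\beta\big)^{1/(\alpha-\beta)}\Big).$$
   Context: The letter $d$ denotes a positive real number (dimension), while $d(x,y)$ denotes the metric. A $\beta$-stable subordinator is a driftless subordinator with $\mathbb E[e^{-\lambda S_t}]=e^{-ct\lambda^\beta}$ for some constant $c>0$. The relation $h\simeq k$ means that there are constants $c',c''>0$, independent of the arguments $t>0$ and $x,y\in E$ in the specified range, with $c'k\le h\le c''k$. When $d(x,y)=0$ and $d\ge2\alpha$, $H_{\le1}$ is interpreted as $+\infty$. *)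

theory Defs
  imports "HOL-Probability.Probability"
begin

section \<open>The state space\<close>

definition radon_measure :: "'a::metric_space measure \<Rightarrow> bool" where
  "radon_measure \<mu> \<longleftrightarrow>
     sets \<mu> = sets borel \<and>
     (\<forall>K. compact K \<longrightarrow> emeasure \<mu> K < \<infinity>) \<and>
     (\<forall>A\<in>sets borel. emeasure \<mu> A = (INF U\<in>{U. open U \<and> A \<subseteq> U}. emeasure \<mu> U)) \<and>
     (\<forall>U. open U \<longrightarrow> emeasure \<mu> U = (SUP K\<in>{K. compact K \<and> K \<subseteq> U}. emeasure \<mu> K))"

definition full_support :: "'a::metric_space measure \<Rightarrow> bool" where
  "full_support \<mu> \<longleftrightarrow> (\<forall>U. open U \<and> U \<noteq> {} \<longrightarrow> 0 < emeasure \<mu> U)"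


section \<open>Markov processes, transition densities, generators\<close>

text \<open>
  A Markov process on \<open>E\<close> may have a finite lifetime: it takes values in \<open>E\<close> together with a
  cemetery point, the value \<open>None\<close>.  The Borel sigma-algebra of this enlarged space is generated
  by the Borel sets of \<open>E\<close>.
\<close>

definition borel_cemetery :: "'a::metric_space option measure" where
  "borel_cemetery = sigma UNIV ((\<lambda>A. Some ` A) ` sets borel)"

definition kill :: "('a \<Rightarrow> 'b::zero) \<Rightarrow> 'a option \<Rightarrow> 'b" where
  "kill f z = (case z of Some y \<Rightarrow> f y | None \<Rightarrow> 0)"

text \<open>
  \<open>P x\<close> is the law started from \<open>x\<close>, all laws living on the measurable space \<open>\<Omega>\<close>, and \<open>\<F>\<close> is the
  filtration.  The Markov property says \<open>P\<^sub>x(X\<^sub>s\<^sub>+\<^sub>t \<in> A | \<F>\<^sub>s) = P\<^bsub>X\<^sub>s\<^esub>(X\<^sub>t \<in> A)\<close> almost surely; as the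
  right-hand side is \<open>0\<close> at the cemetery, taking \<open>A = E\<close> shows that the cemetery is absorbing.
\<close>

definition markov_process ::
  "'w measure \<Rightarrow> (real \<Rightarrow> 'w measure) \<Rightarrow> ('a::metric_space \<Rightarrow> 'w measure) \<Rightarrow>
   (real \<Rightarrow> 'w \<Rightarrow> 'a option) \<Rightarrow> bool" where
  "markov_process \<Omega> \<F> P X \<longleftrightarrow>
     (\<forall>x. prob_space (P x) \<and> sets (P x) = sets \<Omega>) \<and>
     (\<forall>t\<ge>0. subalgebra \<Omega> (\<F> t)) \<and>
     (\<forall>s t. 0 \<le> s \<and> s \<le> t \<longrightarrow> sets (\<F> s) \<subseteq> sets (\<F> t)) \<and>
     (\<forall>t\<ge>0. X t \<in> measurable (\<F> t) borel_cemetery) \<and>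
     (\<forall>x. AE \<omega> in P x. X 0 \<omega> = Some x) \<and>
     (\<forall>t\<ge>0. \<forall>A\<in>sets borel.
        (\<lambda>x. emeasure (P x) {\<omega> \<in> space \<Omega>. X t \<omega> \<in> Some ` A}) \<in> borel_measurable borel) \<and>
     (\<forall>x. \<forall>s\<ge>0. \<forall>t\<ge>0. \<forall>A\<in>sets borel. AE \<omega> in P x.
        nn_cond_exp (P x) (\<F> s) (\<lambda>\<omega>'. indicator (Some ` A) (X (s + t) \<omega>')) \<omega> =
        kill (\<lambda>y. emeasure (P y) {\<omega>' \<in> space \<Omega>. X t \<omega>' \<in> Some ` A}) (X s \<omega>))"

definition transition_density ::
  "'a::metric_space measure \<Rightarrow> 'w measure \<Rightarrow> ('a \<Rightarrow> 'w measure) \<Rightarrow> (real \<Rightarrow> 'w \<Rightarrow> 'a option) \<Rightarrow>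
   (real \<Rightarrow> 'a \<Rightarrow> 'a \<Rightarrow> real) \<Rightarrow> bool" where
  "transition_density \<mu> \<Omega> P X p \<longleftrightarrow>
     (\<lambda>(t, x, y). p t x y) \<in>
        borel_measurable (restrict_space borel {0<..} \<Otimes>\<^sub>M borel \<Otimes>\<^sub>M borel) \<and>
     (\<forall>t>0. \<forall>x y. 0 \<le> p t x y) \<and>
     (\<forall>t>0. \<forall>x. \<forall>A\<in>sets borel.
        emeasure (P x) {\<omega> \<in> space \<Omega>. X t \<omega> \<in> Some ` A} =
        (\<integral>\<^sup>+ y\<in>A. ennreal (p t x y) \<partial>\<mu>))"

definition transition_semigroup ::
  "('a::metric_space \<Rightarrow> 'w measure) \<Rightarrow> (real \<Rightarrow> 'w \<Rightarrow> 'a option) \<Rightarrow> real \<Rightarrow> ('a \<Rightarrow> real) \<Rightarrow> 'a \<Rightarrow> real" where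
  "transition_semigroup P X t f x = (\<integral>\<omega>. kill f (X t \<omega>) \<partial>P x)"

definition bounded_borel :: "('a::metric_space \<Rightarrow> real) set" where
  "bounded_borel = {f \<in> borel_measurable borel. bounded (range f)}"

text \<open>
  The graph of the infinitesimal generator, in Dynkin's sense: the strong derivative at time \<open>0\<close>
  of the transition semigroup on the Banach space of bounded Borel functions.
\<close>

definition generator ::
  "('a::metric_space \<Rightarrow> 'w measure) \<Rightarrow> (real \<Rightarrow> 'w \<Rightarrow> 'a option) \<Rightarrow> (('a \<Rightarrow> real) \<times> ('a \<Rightarrow> real)) set" where
  "generator P X = {(f, g). f \<in> bounded_borel \<and> g \<in> bounded_borel \<and>
     uniform_limit UNIV (\<lambda>t x. (transition_semigroup P X t f x - f x) / t) g (at_right 0)}"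


section \<open>Stable subordinators\<close>

definition subordinator :: "'v measure \<Rightarrow> (real \<Rightarrow> 'v \<Rightarrow> real) \<Rightarrow> bool" where
  "subordinator M S \<longleftrightarrow>
     prob_space M \<and>
     (\<forall>t\<ge>0. S t \<in> borel_measurable M) \<and>
     (AE \<omega> in M. S 0 \<omega> = 0) \<and>
     (\<forall>n (\<tau> :: nat \<Rightarrow> real). 0 \<le> \<tau> 0 \<and> mono \<tau> \<longrightarrow>
        prob_space.indep_vars M (\<lambda>_. borel) (\<lambda>i \<omega>. S (\<tau> (Suc i)) \<omega> - S (\<tau> i) \<omega>) {..<n}) \<and>
     (\<forall>s t. 0 \<le> s \<and> s \<le> t \<longrightarrow>
        distr M borel (\<lambda>\<omega>. S t \<omega> - S s \<omega>) = distr M borel (S (t - s))) \<and>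
     (AE \<omega> in M. mono_on {0..} (\<lambda>t. S t \<omega>) \<and>
        (\<forall>t\<ge>0. ((\<lambda>u. S u \<omega>) \<longlongrightarrow> S t \<omega>) (at_right t)))"

text \<open>The L\'evy--Khintchine exponent has no linear term; \<open>\<nu>\<close> is the L\'evy measure.\<close>

definition driftless :: "'v measure \<Rightarrow> (real \<Rightarrow> 'v \<Rightarrow> real) \<Rightarrow> bool" where
  "driftless M S \<longleftrightarrow>
     (\<exists>\<nu> :: real measure. sets \<nu> = sets borel \<and> emeasure \<nu> {..0} = 0 \<and>
        (\<integral>\<^sup>+ s. ennreal (min 1 s) \<partial>\<nu>) < \<infinity> \<and>
        (\<forall>t\<ge>0. \<forall>l>0. (\<integral>\<omega>. exp (- l * S t \<omega>) \<partial>M) = exp (- t * (\<integral>s. 1 - exp (- l * s) \<partial>\<nu>))))"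

definition stable_subordinator :: "real \<Rightarrow> 'v measure \<Rightarrow> (real \<Rightarrow> 'v \<Rightarrow> real) \<Rightarrow> bool" where
  "stable_subordinator \<beta> M S \<longleftrightarrow>
     subordinator M S \<and> driftless M S \<and>
     (\<exists>c>0. \<forall>t\<ge>0. \<forall>l>0. (\<integral>\<omega>. exp (- l * S t \<omega>) \<partial>M) = exp (- c * t * l powr \<beta>))"

text \<open>
  A density is only determined almost everywhere, whereas the function \<open>q\<close> below uses its values
  at each fixed \<open>t > 0\<close>; hence \emph{the} density of \<open>S r\<close> is the version continuous on the
  positive half-line.
\<close>

definition continuous_density ::
  "'v measure \<Rightarrow> (real \<Rightarrow> 'v \<Rightarrow> real) \<Rightarrow> (real \<Rightarrow> real \<Rightarrow> real) \<Rightarrow> bool" where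
  "continuous_density M S pbar \<longleftrightarrow>
     (\<forall>r>0. distributed M lborel (S r) (\<lambda>t. ennreal (pbar r t)) \<and>
        (\<forall>t. 0 \<le> pbar r t) \<and> continuous_on {0<..} (pbar r))"


section \<open>The fundamental solution and the estimating functions\<close>

text \<open>The integral is taken in \<open>[0,\<infinity>]\<close>, as \<open>q(t,x,x) = \<infinity>\<close> when \<open>d \<ge> 2\<alpha>\<close>.\<close>

definition poisson_fundamental ::
  "(real \<Rightarrow> 'a \<Rightarrow> 'a \<Rightarrow> real) \<Rightarrow> (real \<Rightarrow> real \<Rightarrow> real) \<Rightarrow> real \<Rightarrow> 'a \<Rightarrow> 'a \<Rightarrow> ennreal" where
  "poisson_fundamental p0 pbar t x y =
     (\<integral>\<^sup>+ r\<in>{0<..}. ennreal (p0 r x y * pbar r t) \<partial>lborel)"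

definition H_le1 :: "real \<Rightarrow> real \<Rightarrow> real \<Rightarrow> real \<Rightarrow> real \<Rightarrow> ennreal" where
  "H_le1 d \<alpha> \<beta> t r =
     (if d < 2 * \<alpha> then ennreal (t powr (\<beta> - 1 - \<beta> * d / \<alpha>))
      else if r = 0 then \<infinity>
      else if d = 2 * \<alpha> then ennreal (t powr (- 1 - \<beta>) * ln (2 * t powr \<beta> / r powr \<alpha>))
      else ennreal (t powr (- 1 - \<beta>) / r powr (d - 2 * \<alpha>)))"

definition H_ge1_j :: "real \<Rightarrow> real \<Rightarrow> real \<Rightarrow> real \<Rightarrow> real \<Rightarrow> ennreal" where
  "H_ge1_j d \<alpha> \<beta> t r = ennreal (t powr (2 * \<beta> - 1) / r powr (d + \<alpha>))"

definition comparable_on :: "'i set \<Rightarrow> ('i \<Rightarrow> ennreal) \<Rightarrow> ('i \<Rightarrow> ennreal) \<Rightarrow> bool" where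
  "comparable_on Z h k \<longleftrightarrow>
     (\<exists>c' c'' :: real. c' > 0 \<and> c'' > 0 \<and>
        (\<forall>z\<in>Z. ennreal c' * k z \<le> h z \<and> h z \<le> ennreal c'' * k z))"

end

theory Submission
  imports Defs "HOL-Real_Asymp.Real_Asymp"
begin

text \<open>
  Only the Laplace transform of \<open>Z = S\<^sub>1\<close> is needed, no pointwise bound on its density.  As
  \<open>S\<^sub>r\<close> has the law of \<open>r\<^bsup>1/\<beta>\<^esup> Z\<close>, substituting \<open>s = t r\<^bsup>-1/\<beta>\<^esup>\<close> turns \<open>q\<close> into an expectation:
  with \<open>W = Z\<^bsup>-\<beta>\<^esup>\<close>, \<open>\<gamma> = d/\<alpha>\<close> and \<open>v = d(x,y)\<^sup>\<alpha>/t\<^sup>\<beta>\<close>, \<open>q(t,x,y)\<close> is comparable to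
  \<open>t\<^bsup>\<beta>-1-\<beta>\<gamma>\<^esup> E[W\<^bsup>1-\<gamma>\<^esup> F(c (v/W)\<^bsup>1/\<alpha>\<^esup>)]\<close>.  The expectation is governed by three facts on \<open>W\<close>:
  \<open>P(W \<le> u) \<le> C u\<close>; \<open>P(u \<le> W \<le> K u) \<ge> e u\<close> for \<open>u \<le> 1\<close>; and, with \<open>p = 1/(1-\<beta>)\<close>,
  \<open>E exp(a W\<^sup>p) < \<infinity>\<close> together with \<open>P(u \<le> W \<le> K u) \<ge> e exp(-A u\<^sup>p)\<close> for \<open>u \<ge> 1\<close>.
\<close>

section \<open>Laplace transforms and the scaling of stable densities\<close>

text \<open>For \<open>v \<le> 1\<close> the factor \<open>F\<close> is of order 1 on
  \<open>W \<ge> v\<close> and cuts the expectation off below. Near 0 the distribution function of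
  \<open>W\<close> is of order \<open>u\<close>, as if \<open>W\<close> had a density bounded above
  and below there, so what remains has the order of the integral of
  \<open>u powr (1 - \<gamma>)\<close> over \<open>{v..2}\<close>. That integral converges at 0
  exactly for \<open>\<gamma> < 2\<close>: this is the threshold \<open>d = 2 * \<alpha>\<close>,
  with the logarithm in the critical case. As no such density is at hand, averages in
  \<open>u\<close> and Fubini replace it. Lower bounds need the mass of windows and not of
  half-lines, since \<open>W powr (1 - \<gamma>)\<close> is controlled from below for every \<gamma>
  only where \<open>W\<close> is bounded on both sides. For \<open>v \<ge> 1\<close> a polynomial
  \<open>F\<close> turns \<open>W powr (1 - \<gamma>)\<close> into \<open>W ^ 2\<close> times a
  power of \<open>v\<close>. An exponential \<open>F\<close> competes with the tail of
  \<open>W\<close>; the two exponents agree at a single size of \<open>W\<close>, which produces the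
  exponent \<open>1 / (\<alpha> - \<beta>)\<close>.\<close>

text \<open>All absolute moments are at most 1, so the Taylor remainder of the characteristic
  function is at most \<open>2 * \<bar>t\<bar> ^ n / fact n\<close>. The function is therefore the
  sum of its moment series, and Levy's uniqueness theorem applies.\<close>

lemma moments_unique_unit_interval:
  fixes M N :: "real measure"
  assumes "real_distribution M" "real_distribution N"
    and M01: "AE x in M. x \<in> {0..1}" and N01: "AE x in N. x \<in> {0..1}"
    and moments: "\<And>n. n > 0 \<Longrightarrow> (\<integral>x. x ^ n \<partial>M) = (\<integral>x. x ^ n \<partial>N)"
  shows "M = N"
proof (rule Levy_uniqueness[OF assms(1,2)], rule ext)
  fix t
  interpret M: real_distribution M by fact
  interpret N: real_distribution N by fact
  \<comment> \<open>Built from the moments of \<open>M\<close>, but by \<open>moments'\<close> also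
    the moment series of \<open>N\<close>: one sequence converges to both characteristic
    functions.\<close>
  define s where "s = (\<lambda>n. \<Sum>k\<le>n. ((\<i> * complex_of_real t)^k / fact k) * (\<integral>x. x ^ k \<partial>M))"
  have moments': "(\<integral>x. x ^ k \<partial>M) = (\<integral>x. x ^ k \<partial>N)" for k
    using moments[of k]
    by (cases "k = 0") (simp_all add: M.prob_space[unfolded M.space_eq_univ] N.prob_space[unfolded N.space_eq_univ])
  have approx: "s \<longlonglongrightarrow> char L t"
    if "real_distribution L" and L01: "AE x in L. x \<in> {0..1}"
      and s: "s = (\<lambda>n. \<Sum>k\<le>n. ((\<i> * complex_of_real t)^k / fact k) * (\<integral>x. x ^ k \<partial>L))" for L
  proof -
    interpret L: real_distribution L by fact
    have int: "integrable L (\<lambda>x. x ^ k)" for k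
      using L01 by (intro L.integrable_const_bound[where B = 1]) (auto simp: power_le_one)
    have bound: "(\<integral>x. \<bar>x\<bar> ^ n \<partial>L) \<le> 1" for n
    proof -
      have "(\<integral>x. \<bar>x\<bar> ^ n \<partial>L) \<le> (\<integral>x. 1 \<partial>L)"
      proof (rule integral_mono_AE)
        show "integrable L (\<lambda>x. \<bar>x\<bar> ^ n)"
          using integrable_abs[OF int[of n]] by (simp add: power_abs)
        show "AE x in L. \<bar>x\<bar> ^ n \<le> 1"
          using L01 by (rule eventually_mono) (auto intro: power_le_one)
      qed simp
      then show ?thesis by (simp add: L.prob_space[unfolded L.space_eq_univ])
    qed
    have "cmod (char L t - s n) \<le> 2 * (\<bar>t\<bar> ^ n / fact n)" for n
    proof -
      have "cmod (char L t - s n) \<le> (2 * \<bar>t\<bar> ^ n / fact n) * (\<integral>x. \<bar>x\<bar> ^ n \<partial>L)"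
        unfolding s using L.char_approx1[of n t] int by simp
      also have "\<dots> \<le> (2 * \<bar>t\<bar> ^ n / fact n) * 1"
        by (intro mult_left_mono bound) auto
      finally show ?thesis by simp
    qed
    moreover have "(\<lambda>n. 2 * (\<bar>t\<bar> ^ n / fact n)) \<longlonglongrightarrow> 0"
      using tendsto_mult_right_zero[OF summable_LIMSEQ_zero[OF summable_exp[of "\<bar>t\<bar>"]], of 2]
      by (simp add: field_simps)
    ultimately show ?thesis
      by (intro LIM_zero_cancel[of s] Lim_null_comparison[of "\<lambda>n. s n - char L t" "\<lambda>n. 2 * (\<bar>t\<bar> ^ n / fact n)"])
        (simp_all add: norm_minus_commute)
  qed
  show "char M t = char N t"
    by (rule LIMSEQ_unique[OF approx approx])
       (use assms moments' in \<open>auto simp: s_def\<close>)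
qed

text \<open>The map \<open>x \<mapsto> exp (- x)\<close> carries both laws to the unit interval and
  turns the Laplace transform at \<open>l = n\<close> into the \<open>n\<close>-th moment;
  \<open>- ln\<close> undoes the map.\<close>

lemma laplace_transform_unique:
  fixes M N :: "real measure"
  assumes M: "real_distribution M" and N: "real_distribution N"
    and M0: "AE x in M. 0 \<le> x" and N0: "AE x in N. 0 \<le> x"
    and laplace: "\<And>l. l > 0 \<Longrightarrow> (\<integral>x. exp (- l * x) \<partial>M) = (\<integral>x. exp (- l * x) \<partial>N)"
  shows "M = N"
proof -
  interpret M: real_distribution M by fact
  interpret N: real_distribution N by fact
  let ?e = "\<lambda>x::real. exp (- x)"
  have [measurable]: "?e \<in> borel_measurable M" "?e \<in> borel_measurable N" by simp_all
  have "distr M borel ?e = distr N borel ?e"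
  proof (rule moments_unique_unit_interval)
    show "real_distribution (distr M borel ?e)" by (rule M.real_distribution_distr) simp
    show "real_distribution (distr N borel ?e)" by (rule N.real_distribution_distr) simp
    show "AE x in distr M borel ?e. x \<in> {0..1}" using M0 by (simp add: AE_distr_iff)
    show "AE x in distr N borel ?e. x \<in> {0..1}" using N0 by (simp add: AE_distr_iff)
    show "(\<integral>x. x ^ n \<partial>distr M borel ?e) = (\<integral>x. x ^ n \<partial>distr N borel ?e)" if "n > 0" for n :: nat
      using laplace[of "real n"] that
      by (simp add: integral_distr exp_of_nat_mult[symmetric])
  qed
  then have "distr (distr M borel ?e) borel (\<lambda>y. - ln y) = distr (distr N borel ?e) borel (\<lambda>y. - ln y)"
    by simp
  then show ?thesis
    by (simp add: distr_distr comp_def distr_id2)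
qed

text \<open>The set where the functions differ is open and null, hence empty. This makes an almost
  everywhere identity of densities usable at one fixed \<open>t\<close>.\<close>

lemma continuous_AE_eq_on_pos:
  fixes f g :: "real \<Rightarrow> real"
  assumes f: "continuous_on {0<..} f" and g: "continuous_on {0<..} g"
    and AE: "AE x in lborel. x > 0 \<longrightarrow> f x = g x" and t: "t > 0"
  shows "f t = g t"
proof (rule ccontr)
  assume ne: "f t \<noteq> g t"
  let ?U = "{x \<in> {0<..}. f x - g x \<in> - {0}}"
  have "open ({0<..} \<inter> (\<lambda>x. f x - g x) -` (- {0}))"
    by (intro continuous_open_preimage continuous_on_diff f g open_Compl) simp_all
  moreover have "{0<..} \<inter> (\<lambda>x. f x - g x) -` (- {0}) = ?U" by blast
  ultimately have U: "open ?U" by metis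
  have "AE x in lborel. x \<notin> ?U" using AE by (rule eventually_mono) simp
  then have "?U \<in> null_sets lborel"
    using borel_open[OF U] by (intro AE_iff_null_sets[THEN iffD2]) simp_all
  then have "?U \<in> null_sets lebesgue" by (rule null_sets_completionI)
  then have "negligible ?U" by (simp only: negligible_iff_null_sets)
  moreover have "?U \<noteq> {}" using ne t by auto
  ultimately show False using open_not_negligible[OF U] by metis
qed

text \<open>The map \<open>s \<mapsto> s powr - b\<close> reverses the order, so it is composed with a reflection; the
  intervals \<open>{1/(n+2)..n+2}\<close> exhaust the half-line.\<close>

lemma nn_integral_substitution_powr:
  fixes f :: "real \<Rightarrow> ennreal"
  assumes [measurable]: "f \<in> borel_measurable borel" and b: "b > 0" and k: "k > 0"
  shows "(\<integral>\<^sup>+ r\<in>{0<..}. f r \<partial>lborel) =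
    (\<integral>\<^sup>+ s\<in>{0<..}. f (k * s powr - b) * ennreal (k * b * s powr (- b - 1)) \<partial>lborel)"
proof -
  \<comment> \<open>With \<open>n + 2\<close> the interval is nondegenerate already for
    \<open>n = 0\<close>, as the substitution rule asks for a strict inequality between the
    endpoints.\<close>
  define A where "A = (\<lambda>n::nat. {1 / (real n + 2)..real n + 2})"
  define B where "B = (\<lambda>n::nat. {k * (real n + 2) powr - b..k * (1 / (real n + 2)) powr - b})"
  have powr_anti: "x powr - b \<le> y powr - b \<longleftrightarrow> y \<le> x" if "x > 0" "y > 0" for x y :: real
  proof
    assume "x powr - b \<le> y powr - b"
    then show "y \<le> x" using that b powr_less_mono2_neg[of "- b" x y] by (cases "x < y") auto
  next
    assume "y \<le> x"
    then show "x powr - b \<le> y powr - b" using that b by (intro powr_mono2') auto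
  qed
  have eq: "(\<integral>\<^sup>+ r. f r * indicator (B n) r \<partial>lborel) =
     (\<integral>\<^sup>+ s. f (k * s powr - b) * ennreal (k * b * s powr (- b - 1)) * indicator (A n) s \<partial>lborel)" for n
  proof -
    let ?u = "real n + 2"
    have u: "1 / ?u < ?u"
    proof -
      have "1 < ?u * ?u" by (rule less_1_mult) auto
      then show ?thesis by (simp add: field_simps)
    qed
    let ?g = "\<lambda>x. k * (- x) powr - b"
    have "(\<integral>\<^sup>+ r. f r * indicator {?g (- ?u)..?g (- (1 / ?u))} r \<partial>lborel) =
      (\<integral>\<^sup>+ x. f (?g x) * ennreal (k * b * (- x) powr (- b - 1)) * indicator {- ?u..- (1 / ?u)} x \<partial>lborel)"
    proof (rule nn_integral_substitution_aux[where g = ?g])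
      have neg: "x < 0" if "x \<in> {- ?u..- (1 / ?u)}" for x
      proof -
        have "x \<le> - (1 / ?u)" using that by simp
        also have "\<dots> < 0" by simp
        finally show ?thesis .
      qed
      show "((\<lambda>x. k * (- x) powr - b) has_real_derivative k * b * (- x) powr (- b - 1)) (at x)"
        if "x \<in> {- ?u..- (1 / ?u)}" for x
        using DERIV_cmult[OF DERIV_fun_powr[OF DERIV_minus[OF DERIV_ident], of x "- b"], of k] neg[OF that]
        by (simp add: ac_simps)
      show "continuous_on {- ?u..- (1 / ?u)} (\<lambda>x. k * b * (- x) powr (- b - 1))"
        by (intro continuous_intros ballI) (auto dest: neg)
      show "k * b * (- x) powr (- b - 1) \<ge> 0" for x using k b by simp
      show "- ?u < - (1 / ?u)" using u by simp
    qed simp_all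
    also have "\<dots> = (\<integral>\<^sup>+ x. f (k * (- (0 + (-1) * x)) powr - b) * ennreal (k * b * (- (0 + (-1) * x)) powr (- b - 1))
         * indicator {- ?u..- (1 / ?u)} (0 + (-1) * x) \<partial>lborel)"
      by (subst nn_integral_real_affine[where c = "-1" and t = 0]) (simp_all)
    also have "\<dots> = (\<integral>\<^sup>+ s. f (k * s powr - b) * ennreal (k * b * s powr (- b - 1)) * indicator (A n) s \<partial>lborel)"
      by (intro nn_integral_cong) (auto simp: A_def split: split_indicator)
    finally show ?thesis by (simp add: B_def add.commute)
  qed
  have inv_le: "1 / (real n + 3) \<le> 1 / (real n + 2)" for n
    by (intro divide_left_mono) auto
  have A_mono: "incseq A"
    unfolding A_def by (intro incseq_SucI) (use inv_le in \<open>simp add: add.commute add.left_commute\<close>)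
  have B_mono: "incseq B"
  proof (intro incseq_SucI)
    fix n
    have "k * (real n + 3) powr - b \<le> k * (real n + 2) powr - b"
      using k by (intro mult_left_mono) (simp_all add: powr_anti)
    moreover have "k * (1 / (real n + 2)) powr - b \<le> k * (1 / (real n + 3)) powr - b"
      using k inv_le[of n] by (intro mult_left_mono powr_anti[THEN iffD2]) simp_all
    ultimately show "B n \<subseteq> B (Suc n)"
      unfolding B_def by (simp add: add.commute add.left_commute)
  qed
  have A_un: "(\<Union>n. A n) = {0<..}"
  proof (intro equalityI subsetI)
    fix x assume "x \<in> (\<Union>n. A n)"
    then obtain n where "1 / (real n + 2) \<le> x" by (auto simp: A_def)
    moreover have "0 < 1 / (real n + 2)" by simp
    ultimately have "0 < x" by (rule less_le_trans[rotated])
    then show "x \<in> {0<..}" by simp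
  next
    fix x :: real assume "x \<in> {0<..}"
    then have x: "x > 0" by simp
    obtain n where n: "max x (1 / x) < real n" using reals_Archimedean2 by blast
    then have "x \<le> real n + 2" by simp
    moreover have "1 / (real n + 2) \<le> 1 / (1 / x)"
      using n x by (intro divide_left_mono) simp_all
    ultimately have "x \<in> A n" by (simp add: A_def)
    then show "x \<in> (\<Union>n. A n)" by blast
  qed
  have B_un: "(\<Union>n. B n) = {0<..}"
  proof (intro equalityI subsetI)
    fix x assume "x \<in> (\<Union>n. B n)"
    then obtain n where "k * (real n + 2) powr - b \<le> x" by (auto simp: B_def)
    moreover have "0 < k * (real n + 2) powr - b" using k by simp
    ultimately show "x \<in> {0<..}" by simp
  next
    fix x :: real assume "x \<in> {0<..}"
    then have x: "x > 0" by simp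
    define y where "y = (x / k) powr (- 1 / b)"
    have y: "y > 0" using x k by (simp add: y_def)
    have "y powr - b = x / k" using x k b by (simp add: y_def powr_powr)
    then have xy: "x = k * y powr - b" using k by simp
    have "y \<in> (\<Union>n. A n)" unfolding A_un using y by simp
    then obtain n where "y \<in> A n" by blast
    then have n: "1 / (real n + 2) \<le> y" "y \<le> real n + 2" by (auto simp: A_def)
    have "k * (real n + 2) powr - b \<le> x" "x \<le> k * (1 / (real n + 2)) powr - b"
      unfolding xy using y k n by (auto intro!: mult_left_mono simp: powr_anti)
    then have "x \<in> B n" by (simp add: B_def)
    then show "x \<in> (\<Union>n. B n)" by blast
  qed
  have lim: "(\<integral>\<^sup>+ x. h x * indicator {0<..} x \<partial>lborel) = (SUP n. \<integral>\<^sup>+ x. h x * indicator (C n) x \<partial>lborel)"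
    if C: "incseq C" "(\<Union>n. C n) = {0<..}" "\<And>n. C n \<in> sets borel"
      and [measurable]: "h \<in> borel_measurable borel" for C and h :: "real \<Rightarrow> ennreal"
  proof -
    have "(SUP n. emeasure (density lborel h) (C n)) = emeasure (density lborel h) (\<Union>n. C n)"
      using C by (intro SUP_emeasure_incseq) auto
    then show ?thesis unfolding C(2) using C(3) by (simp add: emeasure_density)
  qed
  have "(\<integral>\<^sup>+ r\<in>{0<..}. f r \<partial>lborel) = (SUP n. \<integral>\<^sup>+ r. f r * indicator (B n) r \<partial>lborel)"
    by (rule lim[OF B_mono B_un _ assms(1)]) (simp add: B_def)
  also have "\<dots> = (SUP n. \<integral>\<^sup>+ s. f (k * s powr - b) * ennreal (k * b * s powr (- b - 1)) * indicator (A n) s \<partial>lborel)"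
    by (rule SUP_cong[OF refl eq])
  also have "\<dots> = (\<integral>\<^sup>+ s\<in>{0<..}. f (k * s powr - b) * ennreal (k * b * s powr (- b - 1)) \<partial>lborel)"
  proof (rule lim[OF A_mono A_un, symmetric])
    show "A n \<in> sets borel" for n by (simp add: A_def)
    show "(\<lambda>s. f (k * s powr - b) * ennreal (k * b * s powr (- b - 1))) \<in> borel_measurable borel"
      by measurable
  qed
  finally show ?thesis .
qed

section \<open>Self-similarity of the stable law\<close>

text \<open>A law with a density has no atom at 0, and monotone paths started at 0 are
  nonnegative.\<close>

lemma stable_subordinator_pos_AE:
  assumes S: "stable_subordinator \<beta> M S" and p: "continuous_density M S pbar" and r: "r > 0"
  shows "AE \<omega> in M. S r \<omega> > 0"
proof -
  have sub: "subordinator M S" using S by (simp add: stable_subordinator_def)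
  have D: "distributed M lborel (S r) (\<lambda>t. ennreal (pbar r t))"
    using p r by (simp add: continuous_density_def)
  have "AE x in distr M lborel (S r). x \<noteq> 0"
    unfolding distributed_distr_eq_density[OF D]
    using D AE_lborel_singleton[of 0] by (subst AE_density) (auto simp: distributed_def)
  then have "AE \<omega> in M. S r \<omega> \<noteq> 0"
    using D by (intro AE_distrD[of "S r" M lborel]) (auto simp: distributed_def)
  moreover have "AE \<omega> in M. S 0 \<omega> = 0" "AE \<omega> in M. mono_on {0..} (\<lambda>t. S t \<omega>)"
    using sub by (auto simp: subordinator_def)
  ultimately show ?thesis
  proof eventually_elim
    case (elim \<omega>)
    have "S 0 \<omega> \<le> S r \<omega>" using mono_onD[OF elim(3), of 0 r] r by simp
    with elim show ?case by simp
  qed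
qed

text \<open>By the Laplace transforms \<open>S r\<close> has the law of
  \<open>r powr (1 / \<beta>) * S 1\<close>. This identifies the densities only almost everywhere;
  continuity on the positive half-line extends it to each \<open>t\<close>.\<close>

lemma stable_density_scaling:
  assumes \<beta>: "0 < \<beta>" and S: "stable_subordinator \<beta> M S" and p: "continuous_density M S pbar"
    and r: "r > 0" and t: "t > 0"
  shows "pbar r t = r powr (- 1 / \<beta>) * pbar 1 (t * r powr (- 1 / \<beta>))"
proof -
  have sub: "subordinator M S" using S by (simp add: stable_subordinator_def)
  interpret prob_space M using sub by (simp add: subordinator_def)
  have [measurable]: "S r \<in> borel_measurable M" "S 1 \<in> borel_measurable M"
    using sub r by (simp_all add: subordinator_def)
  obtain c where c: "c > 0"
    "\<And>t l. t \<ge> 0 \<Longrightarrow> l > 0 \<Longrightarrow> (\<integral>\<omega>. exp (- l * S t \<omega>) \<partial>M) = exp (- c * t * l powr \<beta>)"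
    using S by (auto simp: stable_subordinator_def)
  define a where "a = r powr (1 / \<beta>)"
  have a: "a > 0" "a powr \<beta> = r" "r powr (- 1 / \<beta>) = 1 / a"
    using r \<beta> by (simp_all add: a_def powr_powr powr_minus_divide)
  have D: "distributed M lborel (S r) (\<lambda>t. ennreal (pbar r t))"
    "distributed M lborel (S 1) (\<lambda>t. ennreal (pbar 1 t))"
    and nn: "\<And>t. 0 \<le> pbar 1 t" "\<And>t. 0 \<le> pbar r t"
    and cont: "continuous_on {0<..} (pbar r)" "continuous_on {0<..} (pbar 1)"
    using p r by (auto simp: continuous_density_def)
  have eq: "distr M borel (S r) = distr M borel (\<lambda>\<omega>. a * S 1 \<omega>)"
  proof (rule laplace_transform_unique)
    show "real_distribution (distr M borel (S r))" "real_distribution (distr M borel (\<lambda>\<omega>. a * S 1 \<omega>))"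
      by (rule real_distribution_distr; measurable)+
    show "AE x in distr M borel (S r). 0 \<le> x"
      using stable_subordinator_pos_AE[OF S p r] by (subst AE_distr_iff) (auto elim: eventually_mono)
    show "AE x in distr M borel (\<lambda>\<omega>. a * S 1 \<omega>). 0 \<le> x"
      using stable_subordinator_pos_AE[OF S p zero_less_one] a(1)
      by (subst AE_distr_iff) (auto elim: eventually_mono)
    fix l :: real assume l: "l > 0"
    have "(\<integral>x. exp (- l * x) \<partial>distr M borel (S r)) = exp (- c * r * l powr \<beta>)"
      using c(2)[of r l] r l by (subst integral_distr) simp_all
    also have "\<dots> = exp (- c * 1 * (l * a) powr \<beta>)"
      using l a by (simp add: powr_mult)
    also have "\<dots> = (\<integral>x. exp (- l * x) \<partial>distr M borel (\<lambda>\<omega>. a * S 1 \<omega>))"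
      using c(2)[of 1 "l * a"] l a(1) by (subst integral_distr) (simp_all add: mult.assoc)
    finally show "(\<integral>x. exp (- l * x) \<partial>distr M borel (S r)) =
      (\<integral>x. exp (- l * x) \<partial>distr M borel (\<lambda>\<omega>. a * S 1 \<omega>))" .
  qed
  have "distributed M lborel (\<lambda>\<omega>. 0 + a * S 1 \<omega>) (\<lambda>x. ennreal (pbar 1 ((x - 0) / a)) / ennreal \<bar>a\<bar>)"
    using a(1) by (intro distributed_affine D) simp
  then have "distributed M lborel (S r) (\<lambda>x. ennreal (pbar 1 (x / a)) / ennreal a)"
    using eq a(1) by (simp add: distributed_def cong: distr_cong)
  from distributed_unique[OF D(1) this]
  have "AE x in lborel. ennreal (pbar r x) = ennreal (pbar 1 (x / a)) / ennreal a" .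
  then have AE: "AE x in lborel. x > 0 \<longrightarrow> pbar r x = pbar 1 (x / a) / a"
    using nn a(1) by (auto elim!: eventually_mono simp: divide_ennreal)
  have "pbar r t = pbar 1 (t / a) / a"
  proof (rule continuous_AE_eq_on_pos[OF cont(1) _ AE t])
    show "continuous_on {0<..} (\<lambda>x. pbar 1 (x / a) / a)"
      using a(1) by (intro continuous_intros continuous_on_compose2[OF cont(2)]) auto
  qed
  then show ?thesis by (simp add: a(3)[simplified])
qed

lemma nn_integral_stable_density:
  fixes f :: "real \<Rightarrow> real"
  assumes \<beta>: "0 < \<beta>" and S: "stable_subordinator \<beta> M S" and p: "continuous_density M S pbar"
    and t: "t > 0" and f[measurable]: "f \<in> borel_measurable borel" and f0: "\<And>r. 0 \<le> f r"
  shows "(\<integral>\<^sup>+ r\<in>{0<..}. ennreal (f r * pbar r t) \<partial>lborel) =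
    (\<integral>\<^sup>+ \<omega>. ennreal (\<beta> * t powr (\<beta> - 1) * (S 1 \<omega> powr - \<beta> * f (t powr \<beta> * S 1 \<omega> powr - \<beta>))) \<partial>M)"
proof -
  have D: "distributed M lborel (S 1) (\<lambda>t. ennreal (pbar 1 t))"
    and nn: "\<And>t. 0 \<le> pbar 1 t"
    using p by (auto simp: continuous_density_def)
  have g[measurable]: "(\<lambda>t. ennreal (pbar 1 t)) \<in> borel_measurable borel"
    using D by (simp add: distributed_def)
  let ?h = "\<lambda>r. ennreal (f r * r powr (- 1 / \<beta>)) * ennreal (pbar 1 (t * r powr (- 1 / \<beta>)))"
  let ?w = "\<lambda>s. ennreal (\<beta> * t powr (\<beta> - 1) * (s powr - \<beta> * f (t powr \<beta> * s powr - \<beta>)))"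
  have "(\<integral>\<^sup>+ r\<in>{0<..}. ennreal (f r * pbar r t) \<partial>lborel) = (\<integral>\<^sup>+ r\<in>{0<..}. ?h r \<partial>lborel)"
  proof (intro nn_integral_cong)
    fix r
    show "ennreal (f r * pbar r t) * indicator {0<..} r = ?h r * indicator {0<..} r"
      using stable_density_scaling[OF \<beta> S p, of r t] t f0 nn
      by (cases "r > 0") (simp_all add: ennreal_mult'' mult.assoc)
  qed
  also have "\<dots> = (\<integral>\<^sup>+ s\<in>{0<..}. ?h (t powr \<beta> * s powr - \<beta>) *
       ennreal (t powr \<beta> * \<beta> * s powr (- \<beta> - 1)) \<partial>lborel)"
    using t \<beta> by (intro nn_integral_substitution_powr) simp_all
  also have "\<dots> = (\<integral>\<^sup>+ s. ennreal (pbar 1 s) * (?w s * indicator {0<..} s) \<partial>lborel)"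
  proof (intro nn_integral_cong)
    fix s :: real
    show "?h (t powr \<beta> * s powr - \<beta>) * ennreal (t powr \<beta> * \<beta> * s powr (- \<beta> - 1)) * indicator {0<..} s
      = ennreal (pbar 1 s) * (?w s * indicator {0<..} s)"
    proof (cases "s > 0")
      case True
      let ?r = "t powr \<beta> * s powr - \<beta>"
      have r: "?r powr (- 1 / \<beta>) = s / t"
        using t True \<beta> by (simp add: powr_mult powr_powr powr_minus powr_divide divide_simps)
      \<comment> \<open>The factor \<open>s / t\<close> is \<open>?r powr (- 1 / \<beta>)\<close>,
        from the scaling of the density; the second factor is the Jacobian. Together they leave
        \<open>s powr - \<beta>\<close>.\<close>
      have e: "(f ?r * (s / t)) * (t powr \<beta> * \<beta> * s powr (- \<beta> - 1)) = \<beta> * t powr (\<beta> - 1) * (s powr - \<beta> * f ?r)"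
        using t True by (simp add: powr_diff divide_simps)
      have "ennreal (f ?r * (s / t)) * ennreal (t powr \<beta> * \<beta> * s powr (- \<beta> - 1)) = ?w s"
        unfolding e[symmetric] using t True \<beta> f0[of ?r] by (intro ennreal_mult[symmetric]) simp_all
      then show ?thesis using True t unfolding r by (simp add: ac_simps)
    qed simp
  qed
  also have "\<dots> = (\<integral>\<^sup>+ \<omega>. ?w (S 1 \<omega>) * indicator {0<..} (S 1 \<omega>) \<partial>M)"
    by (rule distributed_nn_integral[OF D]) simp
  also have "\<dots> = (\<integral>\<^sup>+ \<omega>. ?w (S 1 \<omega>) \<partial>M)"
    using stable_subordinator_pos_AE[OF S p zero_less_one]
    by (intro nn_integral_cong_AE) (auto elim!: eventually_mono)
  finally show ?thesis .
qed

section \<open>The law of a negative power of a stable variable\<close>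

lemma powr_minus_le_iff:
  fixes x u b :: real
  assumes "x > 0" "u > 0" "b > 0"
  shows "x powr - b \<le> u \<longleftrightarrow> u powr (- 1 / b) \<le> x"
proof -
  have "x powr - b \<le> u \<longleftrightarrow> ln (x powr - b) \<le> ln u"
    using assms by (subst ln_le_cancel_iff) simp_all
  also have "\<dots> \<longleftrightarrow> - ln u \<le> ln x * b"
    using assms by (auto simp: ln_powr mult.commute)
  also have "\<dots> \<longleftrightarrow> - ln u / b \<le> ln x"
    using assms by (simp only: pos_divide_le_eq)
  also have "\<dots> \<longleftrightarrow> ln (u powr (- 1 / b)) \<le> ln x"
    using assms by (simp add: ln_powr)
  also have "\<dots> \<longleftrightarrow> u powr (- 1 / b) \<le> x"
    using assms by (subst ln_le_cancel_iff) simp_all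
  finally show ?thesis .
qed

lemma exp_minus_le:
  fixes x :: real
  assumes "x \<ge> 0"
  shows "exp (- x) \<le> 1 / (1 + x)"
  using exp_ge_add_one_self[of x] assms by (simp add: exp_minus field_simps)

lemma one_minus_exp_ge:
  fixes x :: real
  assumes "x \<ge> 0"
  shows "1 - exp (- x) \<ge> x / (1 + x)"
proof -
  have "x / (1 + x) = 1 - 1 / (1 + x)" using assms by (simp add: field_simps)
  then show ?thesis using exp_minus_le[OF assms] by linarith
qed

lemma summable_exp_minus_powr:
  fixes k b :: real
  assumes "k > 0" "b > 0"
  shows "summable (\<lambda>n. exp (- k * real (Suc n) powr b))"
proof (rule summable_comparison_test_bigo)
  show "summable (\<lambda>n. norm (1 / real (Suc n) ^ 2))"
    using inverse_power_summable[of 2, where 'a = real] by (subst summable_Suc_iff) (simp add: field_simps)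
  show "(\<lambda>n. exp (- k * real (Suc n) powr b)) \<in> O(\<lambda>n. 1 / real (Suc n) ^ 2)"
    using assms by real_asymp
qed

locale stable_variable = prob_space M for M :: "'v measure" +
  fixes Z :: "'v \<Rightarrow> real" and \<beta> c :: real
  assumes Z_measurable [measurable]: "Z \<in> borel_measurable M"
    and Z_pos: "AE \<omega> in M. Z \<omega> > 0"
    and \<beta>_pos: "0 < \<beta>" and \<beta>_less_1: "\<beta> < 1" and c_pos: "c > 0"
    and laplace: "\<And>l. l > 0 \<Longrightarrow> expectation (\<lambda>\<omega>. exp (- l * Z \<omega>)) = exp (- c * l powr \<beta>)"
begin

definition W :: "'v \<Rightarrow> real" where "W \<omega> = Z \<omega> powr - \<beta>"

text \<open>Optimising \<open>exp (l * s - c * l powr \<beta>)\<close> over \<open>l\<close> bounds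
  the probability of \<open>Z \<le> s\<close> by an exponential whose exponent has order
  \<open>s powr (- \<beta> / (1 - \<beta>))\<close>; with \<open>u = s powr - \<beta>\<close> this
  is \<open>u powr p\<close>.\<close>

definition p :: real where "p = 1 / (1 - \<beta>)"

lemma W_measurable [measurable]: "W \<in> borel_measurable M"
  unfolding W_def by measurable

lemma W_pos: "AE \<omega> in M. W \<omega> > 0"
  using Z_pos by (rule eventually_mono) (simp add: W_def)

lemma p_pos: "p > 0"
  using \<beta>_less_1 by (simp add: p_def)

lemma integrable_exp_Z: "l \<ge> 0 \<Longrightarrow> integrable M (\<lambda>\<omega>. exp (- l * Z \<omega>))"
  using Z_pos by (intro integrable_const_bound[where B = 1]) (auto elim: eventually_mono)

text \<open>Here and in \<open>expectation_le_prob\<close> an indicator is compared with a variable;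
  in the applications this is a combination of terms \<open>exp (- l * Z)\<close>, whose
  expectations the Laplace transform gives exactly.\<close>

lemma prob_le_expectation:
  assumes [measurable]: "{\<omega> \<in> space M. Q \<omega>} \<in> events" and f: "integrable M f"
    and le: "AE \<omega> in M. (if Q \<omega> then 1 else 0) \<le> f \<omega>"
  shows "prob {\<omega> \<in> space M. Q \<omega>} \<le> expectation f"
proof -
  have "prob {\<omega> \<in> space M. Q \<omega>} = expectation (indicator {\<omega> \<in> space M. Q \<omega>})" by simp
  also have "\<dots> \<le> expectation f"
    using le by (intro integral_mono_AE f) (auto simp: indicator_def less_top[symmetric])
  finally show ?thesis .
qed

lemma expectation_le_prob:
  assumes [measurable]: "{\<omega> \<in> space M. Q \<omega>} \<in> events" and f: "integrable M f"
    and le: "AE \<omega> in M. f \<omega> \<le> (if Q \<omega> then 1 else 0)"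
  shows "expectation f \<le> prob {\<omega> \<in> space M. Q \<omega>}"
proof -
  have "expectation f \<le> expectation (indicator {\<omega> \<in> space M. Q \<omega>})"
    using le by (intro integral_mono_AE f) (auto simp: indicator_def less_top[symmetric])
  also have "\<dots> = prob {\<omega> \<in> space M. Q \<omega>}" by simp
  finally show ?thesis .
qed

section \<open>The distribution function of \<open>W\<close> near 0\<close>

text \<open>With \<open>l = u powr (1 / \<beta>)\<close> the event says
  \<open>l * Z \<ge> 1\<close>, where \<open>1 - exp (- l * Z)\<close> is at least
  \<open>1 - exp (- 1)\<close>; its expectation is \<open>1 - exp (- c * u)\<close>, at most
  \<open>c * u\<close>.\<close>

lemma prob_W_le_upper: "\<exists>C>0. \<forall>u>0. prob {\<omega> \<in> space M. W \<omega> \<le> u} \<le> C * u"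
proof (intro exI conjI allI impI)
  have e: "1 - exp (- 1) > (0::real)" by simp
  then show "c / (1 - exp (- 1)) > 0" using c_pos by simp
  fix u :: real assume u: "u > 0"
  define l where "l = u powr (1 / \<beta>)"
  have l: "l > 0" "l powr \<beta> = u" "u powr (- 1 / \<beta>) = 1 / l"
    using u \<beta>_pos by (simp_all add: l_def powr_powr powr_minus_divide)
  have int: "integrable M (\<lambda>\<omega>. (1 - exp (- l * Z \<omega>)) / (1 - exp (- 1)))"
    using integrable_exp_Z[of l] l(1) by simp
  have "prob {\<omega> \<in> space M. W \<omega> \<le> u} \<le> expectation (\<lambda>\<omega>. (1 - exp (- l * Z \<omega>)) / (1 - exp (- 1)))"
  proof (rule prob_le_expectation[OF _ int])
    show "AE \<omega> in M. (if W \<omega> \<le> u then 1 else 0) \<le> (1 - exp (- l * Z \<omega>)) / (1 - exp (- 1))"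
      using Z_pos
    proof eventually_elim
      case (elim \<omega>)
      have "l * Z \<omega> \<ge> 1" if "W \<omega> \<le> u"
      proof -
        have "1 / l \<le> Z \<omega>" using that powr_minus_le_iff[OF elim u \<beta>_pos] l(3) by (simp add: W_def)
        then show ?thesis using l(1) by (simp add: divide_le_eq mult.commute)
      qed
      moreover have "l * Z \<omega> > 0" using elim l(1) by simp
      ultimately show ?case using e by (simp add: field_simps)
    qed
  qed measurable
  also have "\<dots> = (1 - exp (- c * u)) / (1 - exp (- 1))"
    using integrable_exp_Z[of l] laplace[of l] l by (simp add: prob_space)
  also have "\<dots> \<le> c * u / (1 - exp (- 1))"
    using exp_ge_add_one_self[of "- (c * u)"] e by (intro divide_right_mono) simp_all
  finally show "prob {\<omega> \<in> space M. W \<omega> \<le> u} \<le> c / (1 - exp (- 1)) * u" by simp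
qed

text \<open>The combination \<open>(1 - exp (- y)) - \<theta> (1 - exp (- 2 y))\<close> is negative near \<open>0\<close> if \<open>2 \<theta> > 1\<close>,
  yet its expectation at \<open>y = l Z\<close> is of order \<open>l powr \<beta>\<close> if \<open>\<theta> 2 powr \<beta> < 1\<close>.\<close>

lemma prob_W_le_lower:
  "\<exists>e>0. \<exists>s>0. \<forall>u. 0 < u \<and> u \<le> s \<longrightarrow> e * u \<le> prob {\<omega> \<in> space M. W \<omega> \<le> u}"
proof -
  \<comment> \<open>The geometric mean of \<open>1 / 2\<close> and \<open>2 powr - \<beta>\<close>:
    it lies strictly between them, so that \<open>2 * \<theta> > 1\<close> and
    \<open>d < 1\<close>.\<close>
  define \<theta> :: real where "\<theta> = 2 powr (- (1 + \<beta>) / 2)"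
  define d where "d = \<theta> * 2 powr \<beta>"
  \<comment> \<open>The threshold up to which the combination is at most 0: for
    \<open>y > 0\<close>, \<open>y \<le> z\<close> means
    \<open>1 + 2 * y \<le> 2 * \<theta>\<close>, that is
    \<open>y \<le> \<theta> * (2 * y / (1 + 2 * y))\<close>.\<close>
  define z where "z = (2 * \<theta> - 1) / 2"
  have "2 * \<theta> = 2 powr (1 + - (1 + \<beta>) / 2)" unfolding \<theta>_def powr_add by simp
  moreover have "\<dots> > 2 powr 0" using \<beta>_less_1 by (subst powr_less_cancel_iff) (simp_all add: field_simps)
  ultimately have z: "z > 0" by (simp add: z_def)
  have d: "0 < d" "d < 1"
  proof -
    have "d = 2 powr ((\<beta> - 1) / 2)" by (simp add: d_def \<theta>_def powr_add[symmetric] field_simps)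
    moreover have "\<dots> < 2 powr 0" using \<beta>_less_1 by (subst powr_less_cancel_iff) simp_all
    ultimately show "0 < d" "d < 1" by simp_all
  qed
  have \<theta>: "\<theta> > 0" by (simp add: \<theta>_def)
  let ?k = "c * z powr \<beta>"
  have k: "?k > 0" using c_pos z by simp
  show ?thesis
  proof (intro exI conjI allI impI)
    show "?k * (1 - d) / 2 > 0" using k d by simp
    \<comment> \<open>With \<open>y = ?k * u\<close>, this is the range in which
      \<open>1 / (1 + y)\<close> is still at least \<open>(1 + d) / 2\<close>; the gain
      \<open>(1 + d) / 2\<close> then exceeds the loss \<open>d\<close> by
      \<open>(1 - d) / 2\<close>.\<close>
    show "(1 - d) / (1 + d) / ?k > 0" using k d by simp
    fix u assume u: "0 < u \<and> u \<le> (1 - d) / (1 + d) / ?k"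
    then have ku: "?k * u \<le> (1 - d) / (1 + d)"
      using pos_le_divide_eq[OF k, of u "(1 - d) / (1 + d)"] by (metis mult.commute)
    \<comment> \<open>At this scale the event \<open>W > u\<close> forces
      \<open>l * Z \<le> z\<close>.\<close>
    define l where "l = z * u powr (1 / \<beta>)"
    have l: "l > 0" "l powr \<beta> = z powr \<beta> * u" "u powr (- 1 / \<beta>) = z / l"
      using u z \<beta>_pos by (simp_all add: l_def powr_powr powr_mult powr_minus_divide)
    let ?h = "\<lambda>\<omega>. (1 - exp (- l * Z \<omega>)) - \<theta> * (1 - exp (- (2 * l) * Z \<omega>))"
    have int: "integrable M ?h"
      using integrable_exp_Z[of l] integrable_exp_Z[of "2 * l"] l(1) by simp
    let ?y = "c * (z powr \<beta> * u)"
    have y: "?y = ?k * u" "?y > 0" using mult_pos_pos[OF k conjunct1[OF u]] by (simp_all add: mult.assoc)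
    have "(1 + d) / 2 \<le> 1 / (1 + ?y)"
    proof -
      have "1 + ?y \<le> 2 / (1 + d)" using ku d y(1) by (simp add: field_simps)
      then have "1 / (2 / (1 + d)) \<le> 1 / (1 + ?y)" using y(2) d by (intro divide_left_mono) simp_all
      then show ?thesis by simp
    qed
    then have "?y * ((1 + d) / 2) \<le> ?y * (1 / (1 + ?y))" using y(2) by (intro mult_left_mono) simp_all
    also have "\<dots> \<le> 1 - exp (- ?y)" using one_minus_exp_ge[of ?y] y(2) by simp
    finally have 1: "?y * ((1 + d) / 2) \<le> 1 - exp (- ?y)" .
    have "\<theta> * (1 - exp (- (2 powr \<beta> * ?y))) \<le> \<theta> * (2 powr \<beta> * ?y)"
      using exp_ge_add_one_self[of "- (2 powr \<beta> * ?y)"] \<theta> by (intro mult_left_mono) simp_all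
    then have 2: "\<theta> * (1 - exp (- (2 powr \<beta> * ?y))) \<le> d * ?y" by (simp add: d_def mult.assoc)
    have "?k * (1 - d) / 2 * u = ?y * ((1 + d) / 2) - d * ?y" by (simp add: field_simps)
    also have "\<dots> \<le> (1 - exp (- ?y)) - \<theta> * (1 - exp (- (2 powr \<beta> * ?y)))" using 1 2 by simp
    also have "\<dots> = expectation ?h"
      using integrable_exp_Z[of l] integrable_exp_Z[of "2 * l"] laplace[of l] laplace[of "2 * l"] l(1,2)
      by (simp add: prob_space powr_mult ac_simps)
    also have "\<dots> \<le> prob {\<omega> \<in> space M. W \<omega> \<le> u}"
    proof (rule expectation_le_prob[OF _ int])
      show "AE \<omega> in M. ?h \<omega> \<le> (if W \<omega> \<le> u then 1 else 0)"
        using Z_pos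
      proof eventually_elim
        case (elim \<omega>)
        let ?x = "l * Z \<omega>"
        have x: "?x > 0" using elim l(1) by simp
        show ?case
        proof (cases "W \<omega> \<le> u")
          case True
          have "exp (- (2 * l) * Z \<omega>) \<le> 1" using x by simp
          then have "\<theta> * (1 - exp (- (2 * l) * Z \<omega>)) \<ge> 0" using \<theta> by simp
          moreover have "exp (- l * Z \<omega>) > 0" by simp
          ultimately have "?h \<omega> \<le> 1" by linarith
          then show ?thesis using True by simp
        next
          case False
          then have "Z \<omega> \<le> z / l"
            using powr_minus_le_iff[OF elim conjunct1[OF u] \<beta>_pos] l(3) by (simp add: W_def)
          then have "?x \<le> z" using l(1) by (simp add: le_divide_eq mult.commute)
          then have "1 + 2 * ?x \<le> 2 * \<theta>" by (simp add: z_def)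
          then have "?x * (1 + 2 * ?x) \<le> ?x * (2 * \<theta>)" using x by (intro mult_left_mono) simp_all
          then have "?x \<le> \<theta> * (2 * ?x / (1 + 2 * ?x))" using x by (simp add: field_simps)
          also have "\<dots> \<le> \<theta> * (1 - exp (- (2 * ?x)))"
            using one_minus_exp_ge[of "2 * ?x"] x \<theta> by (intro mult_left_mono) simp_all
          finally have "?x \<le> \<theta> * (1 - exp (- (2 * ?x)))" .
          moreover have "1 - exp (- ?x) \<le> ?x" using exp_ge_add_one_self[of "- ?x"] by simp
          ultimately show ?thesis using False by (simp add: mult.assoc)
        qed
      qed
    qed measurable
    finally show "?k * (1 - d) / 2 * u \<le> prob {\<omega> \<in> space M. W \<omega> \<le> u}" .
  qed
qed

section \<open>The tail of \<open>W\<close> at infinity\<close>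

text \<open>The event is \<open>Z \<le> s\<close> with \<open>s = u powr (- 1 / \<beta>)\<close>,
  and its indicator dominates \<open>exp (- l * Z) - exp (- (l * s))\<close>. The choice of
  \<open>l\<close> makes \<open>l * s\<close> twice \<open>c * l powr \<beta>\<close>, so the
  expectation is \<open>exp (- y) - exp (- 2 * y)\<close> with
  \<open>y = A * u powr p\<close>.\<close>

lemma prob_W_ge_lower:
  "\<exists>e>0. \<exists>A>0. \<forall>u\<ge>1. e * exp (- A * u powr p) \<le> prob {\<omega> \<in> space M. u \<le> W \<omega>}"
proof -
  define A where "A = c * (2 * c) powr (p * \<beta>)"
  have A: "A > 0" using c_pos by (simp add: A_def)
  show ?thesis
  proof (intro exI conjI allI impI)
    show "1 - exp (- A) > 0" "A > 0" using A by simp_all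
    fix u :: real assume u: "u \<ge> 1"
    define s where "s = u powr (- 1 / \<beta>)"
    have s: "s > 0" using u by (simp add: s_def)
    define l where "l = (2 * c / s) powr p"
    have l: "l > 0" using s c_pos by (simp add: l_def)
    have y: "c * l powr \<beta> = A * u powr p"
    proof -
      have "l powr \<beta> = (2 * c) powr (p * \<beta>) * (1 / s) powr (p * \<beta>)"
        using s c_pos by (simp add: l_def powr_powr powr_divide)
      also have "1 / s = u powr (1 / \<beta>)" by (simp add: s_def powr_minus_divide)
      also have "\<dots> powr (p * \<beta>) = u powr p" using \<beta>_pos by (simp add: powr_powr)
      finally show ?thesis by (simp add: A_def)
    qed
    have ls: "l * s = 2 * (c * l powr \<beta>)"
    proof -
      have "l powr (1 - \<beta>) = 2 * c / s"
        using s c_pos \<beta>_less_1 by (simp add: l_def powr_powr p_def)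
      then have "l powr \<beta> * l powr (1 - \<beta>) = l powr \<beta> * (2 * c / s)" by simp
      then have "l = l powr \<beta> * (2 * c / s)" using l by (simp add: powr_add[symmetric])
      then show ?thesis using s by (simp add: field_simps)
    qed
    let ?y = "A * u powr p"
    have "u powr p \<ge> 1" using u p_pos by (simp add: ge_one_powr_ge_zero)
    then have yA: "?y \<ge> A" using A by simp
    have "(1 - exp (- A)) * exp (- A * u powr p) \<le> (1 - exp (- ?y)) * exp (- ?y)"
      using yA by (intro mult_mono) (use A in simp_all)
    also have "\<dots> = expectation (\<lambda>\<omega>. exp (- l * Z \<omega>) - exp (- (l * s)))"
      using integrable_exp_Z[of l] laplace[OF l] l y ls
      by (simp add: prob_space algebra_simps exp_add[symmetric])
    also have "\<dots> \<le> prob {\<omega> \<in> space M. u \<le> W \<omega>}"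
    proof (rule expectation_le_prob)
      show "AE \<omega> in M. exp (- l * Z \<omega>) - exp (- (l * s)) \<le> (if u \<le> W \<omega> then 1 else 0)"
        using Z_pos
      proof eventually_elim
        case (elim \<omega>)
        show ?case
        proof (cases "u \<le> W \<omega>")
          case True
          have "exp (- l * Z \<omega>) \<le> 1" "exp (- (l * s)) > 0" using elim l by simp_all
          then have "exp (- l * Z \<omega>) - exp (- (l * s)) \<le> 1" by linarith
          then show ?thesis using True by simp
        next
          case False
          then have "W \<omega> \<le> u" by simp
          then have "s \<le> Z \<omega>"
            using elim u \<beta>_pos powr_minus_le_iff[of "Z \<omega>" u \<beta>] by (simp add: W_def s_def)
          then show ?thesis using False l by simp
        qed
      qed
    qed (use integrable_exp_Z[of l] l in simp_all)
    finally show "(1 - exp (- A)) * exp (- A * u powr p) \<le> prob {\<omega> \<in> space M. u \<le> W \<omega>}" .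
  qed
qed

text \<open>With \<open>\<theta> = \<beta> / (1 - \<beta>)\<close>, already one term of \<open>\<Sum>n. exp (\<epsilon> n powr \<beta> - n z)\<close>, the one with
  \<open>n \<approx> \<delta> z powr (- 1 - \<theta>)\<close>, is as large as \<open>exp (\<delta> z powr - \<theta>)\<close>; the expectation of the sum at
  \<open>z = Z\<close> is finite for \<open>\<epsilon> < c\<close>.\<close>

lemma exponential_moment_W: "\<exists>a>0. (\<integral>\<^sup>+ \<omega>. ennreal (exp (a * W \<omega> powr p)) \<partial>M) < \<infinity>"
proof -
  \<comment> \<open>Half of \<open>c\<close> is spent on making the series large, half is left for
    its convergence: the expectation of term \<open>n\<close> is
    \<open>exp (- \<epsilon> * real (Suc n) powr \<beta>)\<close>.\<close>
  define \<epsilon> where "\<epsilon> = c / 2"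
  define a where "a = (c / 4) powr p"
  have \<epsilon>: "\<epsilon> > 0" and a: "a > 0" using c_pos by (simp_all add: \<epsilon>_def a_def)
  \<comment> \<open>The equation that determines \<open>a\<close>: at
    \<open>x = a * Z powr - p\<close> the gain \<open>\<epsilon> * x powr \<beta>\<close> is twice
    the loss \<open>x * Z\<close>, which leaves exactly \<open>a * W powr p\<close> in the
    exponent.\<close>
  have a2: "\<epsilon> * a powr \<beta> = 2 * a"
  proof -
    have "a powr (1 - \<beta>) = c / 4" using c_pos \<beta>_less_1 by (simp add: a_def powr_powr p_def)
    then have "a powr \<beta> * a powr (1 - \<beta>) = a powr \<beta> * (c / 4)" by simp
    then have "a = a powr \<beta> * (c / 4)" using a by (simp add: powr_add[symmetric])
    then have "4 * a = c * a powr \<beta>" by (simp add: mult.commute)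
    then show ?thesis by (simp add: \<epsilon>_def)
  qed
  let ?t = "\<lambda>n \<omega>. exp (\<epsilon> * real (Suc n) powr \<beta> - real (Suc n) * Z \<omega>)"
  have pw: "ennreal (exp (a * W \<omega> powr p)) \<le> ennreal (exp a) + ennreal (exp 1) * (\<Sum>n. ennreal (?t n \<omega>))"
    if Z: "Z \<omega> > 0" for \<omega>
  proof (cases "Z \<omega> \<le> 1")
    case False
    then have "W \<omega> \<le> 1" using powr_mono2'[of "- \<beta>" 1 "Z \<omega>"] \<beta>_pos by (simp add: W_def)
    then have "W \<omega> powr p \<le> 1" using p_pos by (intro powr_le1) (simp_all add: W_def)
    then have "exp (a * W \<omega> powr p) \<le> exp a" using a by simp
    then show ?thesis by (intro add_increasing2) (auto intro: ennreal_leI)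
  next
    case True
    define x where "x = a * Z \<omega> powr - p"
    have x: "x > 0" using a Z by (simp add: x_def)
    \<comment> \<open>\<open>Suc n\<close> is \<open>x\<close> rounded up. Since
      \<open>Z \<le> 1\<close> here, the rounding costs at most 1 in the exponent, hence the factor
      \<open>exp 1\<close>; the summand \<open>exp a\<close> serves \<open>Z > 1\<close>.\<close>
    define n where "n = nat \<lceil>x\<rceil> - 1"
    have n: "x \<le> real (Suc n)" "real (Suc n) \<le> x + 1"
      using x unfolding n_def by linarith+
    have Wp: "W \<omega> powr p = Z \<omega> powr (- p * \<beta>)" by (simp add: W_def powr_powr mult.commute)
    have xb: "\<epsilon> * x powr \<beta> = 2 * a * W \<omega> powr p"
      using a2 a Z by (simp add: x_def powr_mult powr_powr Wp)
    have xz: "x * Z \<omega> = a * W \<omega> powr p"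
    proof -
      have "1 - p = - p * \<beta>" using \<beta>_less_1 by (simp add: p_def field_simps)
      then have "Z \<omega> powr (- p) * Z \<omega> = Z \<omega> powr (- p * \<beta>)"
        using Z powr_add[of "Z \<omega>" "- p" 1] by simp
      then show ?thesis by (simp add: x_def Wp)
    qed
    have "a * W \<omega> powr p - 1 \<le> \<epsilon> * x powr \<beta> - (x + 1) * Z \<omega>"
      using xb xz True by (simp add: algebra_simps)
    also have "\<dots> \<le> \<epsilon> * real (Suc n) powr \<beta> - real (Suc n) * Z \<omega>"
      using n x Z \<epsilon> \<beta>_pos by (intro diff_mono mult_left_mono mult_right_mono powr_mono2) simp_all
    finally have "exp (a * W \<omega> powr p - 1) \<le> ?t n \<omega>" by simp
    then have "exp (a * W \<omega> powr p) \<le> exp 1 * ?t n \<omega>" by (simp add: exp_diff field_simps)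
    then have "ennreal (exp (a * W \<omega> powr p)) \<le> ennreal (exp 1) * ennreal (?t n \<omega>)"
      by (simp add: ennreal_mult[symmetric] ennreal_leI)
    also have "\<dots> \<le> ennreal (exp 1) * (\<Sum>n. ennreal (?t n \<omega>))"
    proof (rule mult_left_mono)
      have "(\<Sum>k\<in>{n}. ennreal (?t k \<omega>)) \<le> (\<Sum>n. ennreal (?t n \<omega>))"
        by (intro sum_le_suminf summableI) simp_all
      then show "ennreal (?t n \<omega>) \<le> (\<Sum>n. ennreal (?t n \<omega>))" by (simp del: of_nat_Suc)
    qed simp
    finally show ?thesis by (rule order_trans) simp
  qed
  have term_eq: "(\<integral>\<^sup>+ \<omega>. ennreal (?t n \<omega>) \<partial>M) = ennreal (exp (- \<epsilon> * real (Suc n) powr \<beta>))" for n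
  proof -
    have "(\<integral>\<^sup>+ \<omega>. ennreal (?t n \<omega>) \<partial>M) =
        (\<integral>\<^sup>+ \<omega>. ennreal (exp (\<epsilon> * real (Suc n) powr \<beta>) * exp (- real (Suc n) * Z \<omega>)) \<partial>M)"
      by (simp add: exp_add[symmetric] del: of_nat_Suc)
    also have "\<dots> = ennreal (expectation (\<lambda>\<omega>. exp (\<epsilon> * real (Suc n) powr \<beta>) * exp (- real (Suc n) * Z \<omega>)))"
      using integrable_exp_Z[of "real (Suc n)"] by (intro nn_integral_eq_integral) (simp_all del: of_nat_Suc)
    also have "\<dots> = ennreal (exp (- \<epsilon> * real (Suc n) powr \<beta>))"
    proof -
      have "exp (\<epsilon> * real (Suc n) powr \<beta>) * exp (- c * real (Suc n) powr \<beta>) = exp (- \<epsilon> * real (Suc n) powr \<beta>)"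
        unfolding exp_add[symmetric] by (simp add: \<epsilon>_def)
      moreover have "expectation (\<lambda>\<omega>. exp (- real (Suc n) * Z \<omega>)) = exp (- c * real (Suc n) powr \<beta>)"
        by (rule laplace) simp
      ultimately show ?thesis by (simp only: integral_mult_right_zero)
    qed
    finally show ?thesis .
  qed
  have "(\<integral>\<^sup>+ \<omega>. ennreal (exp (a * W \<omega> powr p)) \<partial>M) \<le>
      (\<integral>\<^sup>+ \<omega>. ennreal (exp a) + ennreal (exp 1) * (\<Sum>n. ennreal (?t n \<omega>)) \<partial>M)"
    using Z_pos by (intro nn_integral_mono_AE, elim eventually_mono) (rule pw)
  also have "\<dots> = ennreal (exp a) + ennreal (exp 1) * (\<Sum>n. \<integral>\<^sup>+ \<omega>. ennreal (?t n \<omega>) \<partial>M)"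
    by (simp add: nn_integral_add nn_integral_cmult nn_integral_suminf emeasure_space_1)
  also have "\<dots> = ennreal (exp a) + ennreal (exp 1) * ennreal (\<Sum>n. exp (- \<epsilon> * real (Suc n) powr \<beta>))"
    unfolding term_eq using summable_exp_minus_powr[OF \<epsilon> \<beta>_pos] by (subst suminf_ennreal2) simp_all
  also have "\<dots> < \<infinity>" by (simp add: ennreal_mult_less_top)
  finally show ?thesis using a by blast
qed

lemma prob_Markov_W:
  assumes "a > 0" and fin: "(\<integral>\<^sup>+ \<omega>. ennreal (exp (a * W \<omega> powr p)) \<partial>M) = ennreal B" and "B \<ge> 0" and u: "u \<ge> 0"
  shows "prob {\<omega> \<in> space M. u \<le> W \<omega>} \<le> B * exp (- a * u powr p)"
proof -
  have "ennreal (prob {\<omega> \<in> space M. u \<le> W \<omega>}) = (\<integral>\<^sup>+ \<omega>. indicator {\<omega> \<in> space M. u \<le> W \<omega>} \<omega> \<partial>M)"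
    by (simp add: emeasure_eq_measure)
  also have "\<dots> \<le> (\<integral>\<^sup>+ \<omega>. ennreal (exp (- a * u powr p)) * ennreal (exp (a * W \<omega> powr p)) \<partial>M)"
  proof (intro nn_integral_mono)
    fix \<omega>
    have "1 \<le> exp (- a * u powr p) * exp (a * W \<omega> powr p)" if "u \<le> W \<omega>"
      using powr_mono2[OF _ u that, of p] p_pos \<open>a > 0\<close> by (simp add: exp_add[symmetric])
    then show "indicator {\<omega> \<in> space M. u \<le> W \<omega>} \<omega> \<le> ennreal (exp (- a * u powr p)) * ennreal (exp (a * W \<omega> powr p))"
      by (auto simp: indicator_def ennreal_mult[symmetric] intro: ennreal_leI[of 1, simplified])
  qed
  also have "\<dots> = ennreal (B * exp (- a * u powr p))"
    using \<open>B \<ge> 0\<close> by (simp add: nn_integral_cmult fin ennreal_mult'' mult.commute)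
  finally show ?thesis using \<open>B \<ge> 0\<close> by simp
qed

section \<open>Mass of \<open>W\<close> in windows of fixed ratio\<close>

text \<open>The window has at least the mass of \<open>u \<le> W\<close> minus that of
  \<open>K * u \<le> W\<close>. Enlarging \<open>K\<close> raises the rate in the exponential Markov
  bound for the latter until it is at most half of the lower bound for the former.\<close>

lemma prob_window_large:
  "\<exists>K>1. \<exists>e>0. \<exists>A>0. \<forall>u\<ge>1. e * exp (- A * u powr p) \<le> prob {\<omega> \<in> space M. u \<le> W \<omega> \<and> W \<omega> \<le> K * u}"
proof -
  obtain a where a: "a > 0" and fin: "(\<integral>\<^sup>+ \<omega>. ennreal (exp (a * W \<omega> powr p)) \<partial>M) < \<infinity>"
    using exponential_moment_W by blast
  obtain B where B0: "B \<ge> 0" and B: "(\<integral>\<^sup>+ \<omega>. ennreal (exp (a * W \<omega> powr p)) \<partial>M) = ennreal B"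
    using fin by (cases "\<integral>\<^sup>+ \<omega>. ennreal (exp (a * W \<omega> powr p)) \<partial>M") auto
  obtain e A where e: "e > 0" and A: "A > 0"
    and ge: "\<And>u. u \<ge> 1 \<Longrightarrow> e * exp (- A * u powr p) \<le> prob {\<omega> \<in> space M. u \<le> W \<omega>}"
    using prob_W_ge_lower by blast
  \<comment> \<open>Chosen so that \<open>a * k - A\<close> is at least \<open>2 * B / e\<close>;
    then \<open>B * exp (- (2 * B / e))\<close> is at most \<open>e / 2\<close>.\<close>
  define k where "k = (A + 2 * B / e) / a + 1"
  define K where "K = k powr (1 / p)"
  have k: "k > 1" using A B0 e a by (simp add: k_def add_pos_nonneg)
  have K: "K > 1" "K powr p = k"
  proof -
    show "K powr p = k" using k p_pos by (simp add: K_def powr_powr)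
    have "1 powr (1 / p) < k powr (1 / p)" using k p_pos by (intro powr_less_mono2) simp_all
    then show "K > 1" by (simp add: K_def)
  qed
  have "e / 2 * exp (- A * u powr p) \<le> prob {\<omega> \<in> space M. u \<le> W \<omega> \<and> W \<omega> \<le> K * u}" if u: "u \<ge> 1" for u
  proof -
    have up: "u powr p \<ge> 1" using u p_pos by (simp add: ge_one_powr_ge_zero)
    have ak: "a * k - A \<ge> 2 * B / e" using a by (simp add: k_def field_simps)
    have nn: "2 * B / e \<ge> 0" using B0 e by simp
    have "2 * B / e * 1 \<le> (a * k - A) * u powr p"
      using up ak nn by (intro mult_mono) linarith+
    then have "B * exp (- ((a * k - A) * u powr p)) \<le> B * exp (- (2 * B / e))"
      using B0 by (intro mult_left_mono) simp_all
    also have "\<dots> \<le> B * (1 / (1 + 2 * B / e))"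
      using exp_minus_le[OF nn] B0 by (rule mult_left_mono)
    also have "\<dots> \<le> e / 2" using B0 e by (simp add: field_simps)
    finally have "B * exp (- ((a * k - A) * u powr p)) * exp (- A * u powr p) \<le> e / 2 * exp (- A * u powr p)"
      by (intro mult_right_mono) simp_all
    then have "B * exp (- a * (K * u) powr p) \<le> e / 2 * exp (- A * u powr p)"
      using K u k by (simp add: powr_mult mult.assoc exp_add[symmetric] algebra_simps)
    moreover have "prob {\<omega> \<in> space M. K * u \<le> W \<omega>} \<le> B * exp (- a * (K * u) powr p)"
      using K u by (intro prob_Markov_W[OF a B B0]) simp
    moreover have "prob {\<omega> \<in> space M. u \<le> W \<omega>} \<le>
        prob ({\<omega> \<in> space M. u \<le> W \<omega> \<and> W \<omega> \<le> K * u} \<union> {\<omega> \<in> space M. K * u \<le> W \<omega>})"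
      by (intro finite_measure_mono) auto
    moreover have "\<dots> \<le> prob {\<omega> \<in> space M. u \<le> W \<omega> \<and> W \<omega> \<le> K * u} + prob {\<omega> \<in> space M. K * u \<le> W \<omega>}"
      by (intro measure_Un_le) measurable
    ultimately show ?thesis using ge[OF u] by linarith
  qed
  then show ?thesis using K(1) e A by (intro exI[of _ K] conjI exI[of _ "e / 2"] exI[of _ A]) auto
qed

text \<open>For small \<open>u\<close> the lower bound at \<open>k * u\<close> is twice the upper
  bound at \<open>u\<close>, so the difference keeps \<open>C * u\<close>. For the remaining
  \<open>u \<le> 1\<close> the window contains \<open>{1..L}\<close>, whose mass is bounded below by
  a constant.\<close>

lemma prob_window_small:
  "\<exists>K>1. \<exists>e>0. \<forall>u. 0 < u \<and> u \<le> 1 \<longrightarrow> e * u \<le> prob {\<omega> \<in> space M. u \<le> W \<omega> \<and> W \<omega> \<le> K * u}"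
proof -
  obtain C where C: "C > 0" and upper: "\<And>u. u > 0 \<Longrightarrow> prob {\<omega> \<in> space M. W \<omega> \<le> u} \<le> C * u"
    using prob_W_le_upper by blast
  obtain e s where e: "e > 0" and s: "s > 0"
    and lower: "\<And>u. 0 < u \<Longrightarrow> u \<le> s \<Longrightarrow> e * u \<le> prob {\<omega> \<in> space M. W \<omega> \<le> u}"
    using prob_W_le_lower by blast
  obtain L g A where L: "L > 1" and g: "g > 0"
    and large: "\<And>u. u \<ge> 1 \<Longrightarrow> g * exp (- A * u powr p) \<le> prob {\<omega> \<in> space M. u \<le> W \<omega> \<and> W \<omega> \<le> L * u}"
    using prob_window_large by blast
  define k where "k = 2 * C / e"
  define v where "v = min 1 (s / k)"
  have k: "k > 0" using C e by (simp add: k_def)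
  have v: "0 < v" "v \<le> 1" "v \<le> s / k" using s k by (simp_all add: v_def)
  \<comment> \<open>The two requirements: room for \<open>k * u\<close> when
    \<open>u \<le> v\<close>, and \<open>K * u \<ge> L\<close> when \<open>u > v\<close>.\<close>
  define K where "K = max k (L / v)"
  have "L / 1 \<le> L / v" using L v by (intro divide_left_mono) simp_all
  then have K: "K > 1" "k \<le> K" "L / v \<le> K" using L by (simp_all add: K_def)
  define h where "h = min C (g * exp (- A))"
  have "h * u \<le> prob {\<omega> \<in> space M. u \<le> W \<omega> \<and> W \<omega> \<le> K * u}" if u: "0 < u" "u \<le> 1" for u
  proof (cases "u \<le> v")
    case True
    have ku: "k * u \<le> K * u" using K(2) u by (intro mult_right_mono) simp_all
    have "k * u \<le> s" using True v(3) k by (simp add: le_divide_eq mult.commute) (meson mult_left_mono less_imp_le order_trans)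
    then have "e * (k * u) \<le> prob {\<omega> \<in> space M. W \<omega> \<le> k * u}" using k u by (intro lower) simp_all
    moreover have "e * (k * u) = 2 * C * u" using e by (simp add: k_def)
    moreover have "prob {\<omega> \<in> space M. W \<omega> \<le> k * u} \<le>
        prob ({\<omega> \<in> space M. W \<omega> \<le> u} \<union> {\<omega> \<in> space M. u \<le> W \<omega> \<and> W \<omega> \<le> K * u})"
      using order_trans[OF _ ku] by (intro finite_measure_mono) auto
    moreover have "\<dots> \<le> prob {\<omega> \<in> space M. W \<omega> \<le> u} + prob {\<omega> \<in> space M. u \<le> W \<omega> \<and> W \<omega> \<le> K * u}"
      by (intro measure_Un_le) measurable
    moreover have "h * u \<le> C * u" using u by (intro mult_right_mono) (simp_all add: h_def)
    ultimately show ?thesis using upper[OF u(1)] by linarith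
  next
    case False
    have "L = L / v * v" using v by simp
    also have "\<dots> \<le> K * u" using False K v L by (intro mult_mono) simp_all
    finally have "L \<le> K * u" .
    have "h * u \<le> g * exp (- A) * 1"
      using u g C by (intro mult_mono) (simp_all add: h_def)
    also have "\<dots> \<le> prob {\<omega> \<in> space M. 1 \<le> W \<omega> \<and> W \<omega> \<le> L}" using large[of 1] by simp
    also have "\<dots> \<le> prob {\<omega> \<in> space M. u \<le> W \<omega> \<and> W \<omega> \<le> K * u}"
      using u \<open>L \<le> K * u\<close> by (intro finite_measure_mono) auto
    finally show ?thesis .
  qed
  moreover have "h > 0" using C g by (simp add: h_def)
  ultimately show ?thesis using K(1) by (intro exI[of _ K] conjI exI[of _ h]) auto
qed

end

section \<open>Bounds for the rescaled kernel\<close>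

text \<open>This is \<open>H_le1\<close> without its scaling power of the time, in the variable
  \<open>v\<close>. On \<open>0 < v \<le> 1\<close> it has the order of the integral of
  \<open>u powr (1 - \<gamma>)\<close> over \<open>{v..2}\<close>, the source of the three
  cases.\<close>

definition near_profile :: "real \<Rightarrow> real \<Rightarrow> ennreal" where
  "near_profile \<gamma> v =
     (if \<gamma> < 2 then 1 else if v = 0 then \<infinity>
      else if \<gamma> = 2 then ennreal (ln (2 / v)) else ennreal (v powr (2 - \<gamma>)))"

text \<open>Absorbs two terms of the upper bound into the profile: the power coming from
  \<open>W \<le> v\<close> and the constant coming from \<open>W > 1\<close>. The number
  \<open>ln 2\<close> is the least value of \<open>ln (2 / v)\<close>.\<close>

lemma near_profile_ge:
  assumes "0 < v" "v \<le> 1" "\<gamma> \<ge> 2"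
  shows "ennreal (ln 2 * v powr (2 - \<gamma>)) \<le> near_profile \<gamma> v" "ennreal (ln 2) \<le> near_profile \<gamma> v"
proof -
  have "ln 2 \<le> ln (2 / v)" using assms by (subst ln_le_cancel_iff) (simp_all add: field_simps)
  moreover have "ln 2 \<le> (1 :: real)" using ln_2_less_1 by simp
  moreover have "1 \<le> v powr (2 - \<gamma>)" using assms powr_mono2'[of "2 - \<gamma>" v 1] by simp
  moreover have "ln 2 * v powr (2 - \<gamma>) \<le> 1 * v powr (2 - \<gamma>)"
    using ln_2_less_1 by (intro mult_right_mono) simp_all
  ultimately show "ennreal (ln 2 * v powr (2 - \<gamma>)) \<le> near_profile \<gamma> v" "ennreal (ln 2) \<le> near_profile \<gamma> v"
    using assms by (auto simp: near_profile_def intro!: ennreal_leI)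
qed

text \<open>The upper limit 2 leaves room for averages over \<open>{w..2 * w}\<close> with
  \<open>w \<le> 1\<close>. For \<open>\<gamma> \<ge> 2\<close> and \<open>v = 0\<close> the
  right-hand side is infinite.\<close>

lemma nn_integral_powr_le_near_profile:
  shows "\<exists>C>0. \<forall>v. 0 \<le> v \<and> v \<le> 1 \<longrightarrow>
    (\<integral>\<^sup>+ u\<in>{v..2}. ennreal (u powr (1 - \<gamma>)) \<partial>lborel) \<le> ennreal C * near_profile \<gamma> v"
proof (cases "\<gamma> < 2")
  case True
  have "((\<lambda>u. u powr (1 - \<gamma>)) has_integral (2 powr (1 - \<gamma> + 1) / (1 - \<gamma> + 1))) {0..2}"
    using True by (intro has_integral_powr_from_0) simp_all
  from nn_integral_has_integral_lebesgue[OF _ this]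
  have I: "(\<integral>\<^sup>+ u\<in>{0..2}. ennreal (u powr (1 - \<gamma>)) \<partial>lborel) = ennreal (2 powr (2 - \<gamma>) / (2 - \<gamma>))"
    by (simp add: nn_integral_set_ennreal mult.commute)
  show ?thesis
  proof (intro exI conjI allI impI)
    show "2 powr (2 - \<gamma>) / (2 - \<gamma>) > 0" using True by simp
    fix v :: real assume v: "0 \<le> v \<and> v \<le> 1"
    have "(\<integral>\<^sup>+ u\<in>{v..2}. ennreal (u powr (1 - \<gamma>)) \<partial>lborel) \<le> (\<integral>\<^sup>+ u\<in>{0..2}. ennreal (u powr (1 - \<gamma>)) \<partial>lborel)"
      using v by (intro nn_integral_mono) (auto simp: indicator_def)
    then show "(\<integral>\<^sup>+ u\<in>{v..2}. ennreal (u powr (1 - \<gamma>)) \<partial>lborel) \<le>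
        ennreal (2 powr (2 - \<gamma>) / (2 - \<gamma>)) * near_profile \<gamma> v"
      using True unfolding I by (simp add: near_profile_def)
  qed
next
  case False
  define C where "C = (if \<gamma> = 2 then 1 else 1 / (\<gamma> - 2))"
  have C: "C > 0" using False by (simp add: C_def)
  have "(\<integral>\<^sup>+ u\<in>{v..2}. ennreal (u powr (1 - \<gamma>)) \<partial>lborel) \<le> ennreal C * near_profile \<gamma> v"
    if v: "0 \<le> v" "v \<le> 1" for v
  proof (cases "v = 0")
    case True
    then show ?thesis using False C by (simp add: near_profile_def ennreal_mult_top)
  next
    case v0: False
    show ?thesis
    proof (cases "\<gamma> = 2")
      case True
      have "(\<integral>\<^sup>+ u\<in>{v..2}. ennreal (u powr (1 - \<gamma>)) \<partial>lborel) = ennreal (ln 2 - ln v)"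
        using v v0 True
        by (intro nn_integral_FTC_Icc) (auto intro!: derivative_eq_intros simp: powr_minus field_simps)
      also have "ln 2 - ln v = ln (2 / v)" using v v0 by (simp add: ln_div)
      finally show ?thesis using True v0 by (simp add: near_profile_def C_def)
    next
      case g: False
      let ?F = "\<lambda>u. u powr (2 - \<gamma>) / (2 - \<gamma>)"
      have "(\<integral>\<^sup>+ u\<in>{v..2}. ennreal (u powr (1 - \<gamma>)) \<partial>lborel) = ennreal (?F 2 - ?F v)"
      proof (rule nn_integral_FTC_Icc[where F = ?F])
        fix u assume u: "u \<in> {v..2}"
        then have "u > 0" using v v0 by auto
        then have "DERIV (\<lambda>u. u powr (2 - \<gamma>)) u :> (2 - \<gamma>) * u powr (2 - \<gamma> - 1) * 1"
          using DERIV_fun_powr[OF DERIV_ident, of u "2 - \<gamma>"] by simp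
        from DERIV_cdivide[OF this, of "2 - \<gamma>"] show "(?F has_real_derivative u powr (1 - \<gamma>)) (at u)"
          using g by simp
      qed (use v in auto)
      also have "\<dots> \<le> ennreal (C * v powr (2 - \<gamma>))"
      proof (rule ennreal_leI)
        have "?F 2 \<le> 0" using g False by (simp add: divide_nonneg_neg divide_nonneg_nonpos)
        moreover have "- ?F v = C * v powr (2 - \<gamma>)" using g by (simp add: C_def divide_simps) (simp add: algebra_simps)
        ultimately show "?F 2 - ?F v \<le> C * v powr (2 - \<gamma>)" by linarith
      qed
      finally show ?thesis using g False v0 C
        by (simp add: near_profile_def ennreal_mult[symmetric] ennreal_leI)
    qed
  qed
  then show ?thesis using C by blast
qed

context stable_variable
begin

text \<open>\<open>\<Phi> z\<close> stands for \<open>F (c * z powr (1 / \<alpha>))\<close>, so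
  distance and time enter only through \<open>v\<close>. The value may be infinite at
  \<open>v = 0\<close>.\<close>

definition J :: "real \<Rightarrow> (real \<Rightarrow> real) \<Rightarrow> real \<Rightarrow> ennreal" where
  "J \<gamma> \<Phi> v = (\<integral>\<^sup>+ \<omega>. ennreal (W \<omega> powr (1 - \<gamma>) * \<Phi> (v / W \<omega>)) \<partial>M)"

section \<open>The second moment of \<open>W\<close> and the upper bound for
  \<open>v \<le> 1\<close>\<close>

text \<open>As \<open>p \<ge> 1\<close>, for \<open>w > 1\<close> the quadratic Taylor term of
  \<open>exp (a * w)\<close> suffices, with constant \<open>2 / a ^ 2\<close>; the added 1 serves
  \<open>w \<le> 1\<close>.\<close>

lemma square_le_exponential:
  assumes "a > 0"
  shows "\<exists>C>0. \<forall>w\<ge>0. w ^ 2 \<le> C * exp (a * w powr p)"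
proof (intro exI conjI allI impI)
  show "1 + 2 / a ^ 2 > 0" using assms by (simp add: add_pos_pos)
  fix w :: real assume w: "w \<ge> 0"
  show "w ^ 2 \<le> (1 + 2 / a ^ 2) * exp (a * w powr p)"
  proof (cases "w \<le> 1")
    case True
    have "w ^ 2 \<le> 1 * 1" using w True by (simp add: power_le_one)
    also have "\<dots> \<le> (1 + 2 / a ^ 2) * exp (a * w powr p)" using assms by (intro mult_mono) simp_all
    finally show ?thesis .
  next
    case False
    have "p \<ge> 1" using \<beta>_pos \<beta>_less_1 by (simp add: p_def field_simps)
    then have "w powr 1 \<le> w powr p" using False by (intro powr_mono) simp_all
    then have "exp (a * w) \<le> exp (a * w powr p)" using assms w by simp
    moreover have "(a * w) ^ 2 / 2 \<le> exp (a * w)"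
      using exp_lower_Taylor_quadratic[of "a * w"] assms w mult_nonneg_nonneg[of a w] by linarith
    ultimately have "(a * w) ^ 2 / 2 \<le> exp (a * w powr p)" by linarith
    then have "w ^ 2 \<le> 2 / a ^ 2 * exp (a * w powr p)" using assms by (simp add: power_mult_distrib field_simps)
    also have "\<dots> \<le> (1 + 2 / a ^ 2) * exp (a * w powr p)" by (intro mult_right_mono) simp_all
    finally show ?thesis .
  qed
qed

text \<open>\<open>W ^ 2\<close> dominates \<open>W powr (1 - \<gamma>)\<close> on
  \<open>W > 1\<close>, and it is the power of \<open>W\<close> left in the integrand when
  \<open>\<Phi>\<close> decays with exponent \<open>- \<gamma> - 1\<close>.\<close>

lemma W_square_finite: "(\<integral>\<^sup>+ \<omega>. ennreal (W \<omega> ^ 2) \<partial>M) < \<infinity>"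
proof -
  obtain a where a: "a > 0" and fin: "(\<integral>\<^sup>+ \<omega>. ennreal (exp (a * W \<omega> powr p)) \<partial>M) < \<infinity>"
    using exponential_moment_W by blast
  obtain C where C: "C > 0" "\<And>w. w \<ge> 0 \<Longrightarrow> w ^ 2 \<le> C * exp (a * w powr p)"
    using square_le_exponential[OF a] by blast
  have "(\<integral>\<^sup>+ \<omega>. ennreal (W \<omega> ^ 2) \<partial>M) \<le> (\<integral>\<^sup>+ \<omega>. ennreal C * ennreal (exp (a * W \<omega> powr p)) \<partial>M)"
    using C by (intro nn_integral_mono) (simp add: ennreal_mult[symmetric] ennreal_leI W_def)
  also have "\<dots> < \<infinity>" using fin by (simp add: nn_integral_cmult ennreal_mult_less_top)
  finally show ?thesis .
qed

text \<open>The averages \<open>\<integral>\<^bsub>w\<^esub>\<^bsup>2w\<^esup> u powr - \<gamma> du\<close> are comparable to \<open>w powr (1 - \<gamma>)\<close>; Fubini then trades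
  the law of \<open>W\<close> for its distribution function.\<close>

lemma W_powr_middle:
  assumes \<gamma>: "\<gamma> > 0"
  shows "\<exists>C>0. \<forall>v\<ge>0. (\<integral>\<^sup>+ \<omega>. ennreal (W \<omega> powr (1 - \<gamma>)) * indicator {v<..1} (W \<omega>) \<partial>M)
    \<le> ennreal C * (\<integral>\<^sup>+ u\<in>{v..2}. ennreal (u powr (1 - \<gamma>)) \<partial>lborel)"
proof -
  obtain C where C: "C > 0" and upper: "\<And>u. u > 0 \<Longrightarrow> prob {\<omega> \<in> space M. W \<omega> \<le> u} \<le> C * u"
    using prob_W_le_upper by blast
  interpret P: pair_sigma_finite M lborel ..
  show ?thesis
  proof (intro exI conjI allI impI)
    show "2 powr \<gamma> * C > 0" using C by simp
    fix v :: real assume v: "v \<ge> 0"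
    \<comment> \<open>Relaxing \<open>W \<le> u \<le> 2 * W\<close> to \<open>W \<le> u\<close> only
      enlarges the integral and leaves an event of probability at most \<open>C * u\<close>.\<close>
    let ?g = "\<lambda>\<omega> u. ennreal (u powr - \<gamma>) * indicator {v..2} u * indicator {\<omega> \<in> space M. W \<omega> \<le> u} \<omega>"
    have "(\<integral>\<^sup>+ \<omega>. ennreal (W \<omega> powr (1 - \<gamma>)) * indicator {v<..1} (W \<omega>) \<partial>M) \<le>
      (\<integral>\<^sup>+ \<omega>. ennreal (2 powr \<gamma>) * (\<integral>\<^sup>+ u. ?g \<omega> u \<partial>lborel) \<partial>M)"
    proof (rule nn_integral_mono)
      fix \<omega> assume \<omega>: "\<omega> \<in> space M"
      show "ennreal (W \<omega> powr (1 - \<gamma>)) * indicator {v<..1} (W \<omega>) \<le> ennreal (2 powr \<gamma>) * (\<integral>\<^sup>+ u. ?g \<omega> u \<partial>lborel)"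
      proof (cases "v < W \<omega> \<and> W \<omega> \<le> 1")
        case True
        let ?w = "W \<omega>"
        have w: "?w > 0" using True v by simp
        have "2 powr \<gamma> * ((2 * ?w) powr - \<gamma> * ?w) = ?w powr (1 - \<gamma>)"
          using w by (simp add: powr_mult powr_minus powr_diff field_simps)
        then have eq: "ennreal (?w powr (1 - \<gamma>)) = ennreal (2 powr \<gamma>) * (ennreal ((2 * ?w) powr - \<gamma>) * ennreal ?w)"
          using w by (simp add: ennreal_mult[symmetric])
        have "ennreal ((2 * ?w) powr - \<gamma>) * ennreal ?w =
            (\<integral>\<^sup>+ u. ennreal ((2 * ?w) powr - \<gamma>) * indicator {?w..2 * ?w} u \<partial>lborel)"
          using w by (subst nn_integral_cmult_indicator) simp_all
        also have "\<dots> \<le> (\<integral>\<^sup>+ u. ?g \<omega> u \<partial>lborel)"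
        proof (rule nn_integral_mono)
          fix u
          show "ennreal ((2 * ?w) powr - \<gamma>) * indicator {?w..2 * ?w} u \<le> ?g \<omega> u"
          proof (cases "u \<in> {?w..2 * ?w}")
            case u: True
            have "(2 * ?w) powr - \<gamma> \<le> u powr - \<gamma>" using u w \<gamma> by (intro powr_mono2') simp_all
            then show ?thesis using u True \<omega> by (simp add: ennreal_leI)
          qed simp
        qed
        finally show ?thesis unfolding eq using True by (simp add: mult_left_mono)
      qed simp
    qed
    also have "\<dots> = ennreal (2 powr \<gamma>) * (\<integral>\<^sup>+ \<omega>. \<integral>\<^sup>+ u. ?g \<omega> u \<partial>lborel \<partial>M)"
      by (rule nn_integral_cmult) measurable
    finally have 1: "(\<integral>\<^sup>+ \<omega>. ennreal (W \<omega> powr (1 - \<gamma>)) * indicator {v<..1} (W \<omega>) \<partial>M) \<le>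
      ennreal (2 powr \<gamma>) * (\<integral>\<^sup>+ \<omega>. \<integral>\<^sup>+ u. ?g \<omega> u \<partial>lborel \<partial>M)" .
    have "(\<integral>\<^sup>+ \<omega>. \<integral>\<^sup>+ u. ?g \<omega> u \<partial>lborel \<partial>M) = (\<integral>\<^sup>+ u. \<integral>\<^sup>+ \<omega>. ?g \<omega> u \<partial>M \<partial>lborel)"
      by (rule P.Fubini'[symmetric]) measurable
    also have "\<dots> \<le> (\<integral>\<^sup>+ u. ennreal C * (ennreal (u powr (1 - \<gamma>)) * indicator {v..2} u) \<partial>lborel)"
    proof (rule nn_integral_mono)
      fix u
      have "(\<integral>\<^sup>+ \<omega>. ?g \<omega> u \<partial>M) = ennreal (u powr - \<gamma>) * indicator {v..2} u * ennreal (prob {\<omega> \<in> space M. W \<omega> \<le> u})"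
        by (subst nn_integral_cmult_indicator) (simp_all add: emeasure_eq_measure)
      also have "\<dots> \<le> ennreal C * (ennreal (u powr (1 - \<gamma>)) * indicator {v..2} u)"
      proof (cases "u \<in> {v..2} \<and> u > 0")
        case True
        have "u powr - \<gamma> * prob {\<omega> \<in> space M. W \<omega> \<le> u} \<le> u powr - \<gamma> * (C * u)"
          using upper True by (intro mult_left_mono) simp_all
        also have "\<dots> = C * u powr (1 - \<gamma>)" using True by (simp add: powr_diff powr_minus field_simps)
        finally show ?thesis using True C by (simp add: ennreal_mult[symmetric] ennreal_leI)
      next
        case False
        \<comment> \<open>The point \<open>u = 0\<close> can occur when \<open>v = 0\<close>; there
          \<open>0 powr x = 0\<close> makes both sides vanish.\<close>
        then have "u \<notin> {v..2} \<or> u = 0" using v by auto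
        then show ?thesis by auto
      qed
      finally show "(\<integral>\<^sup>+ \<omega>. ?g \<omega> u \<partial>M) \<le> ennreal C * (ennreal (u powr (1 - \<gamma>)) * indicator {v..2} u)" .
    qed
    also have "\<dots> = ennreal C * (\<integral>\<^sup>+ u\<in>{v..2}. ennreal (u powr (1 - \<gamma>)) \<partial>lborel)"
      by (rule nn_integral_cmult) measurable
    finally show "(\<integral>\<^sup>+ \<omega>. ennreal (W \<omega> powr (1 - \<gamma>)) * indicator {v<..1} (W \<omega>) \<partial>M)
      \<le> ennreal (2 powr \<gamma> * C) * (\<integral>\<^sup>+ u\<in>{v..2}. ennreal (u powr (1 - \<gamma>)) \<partial>lborel)"
      using C by (intro order_trans[OF 1]) (simp add: ennreal_mult mult.assoc mult_left_mono)
  qed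
qed

text \<open>Three ranges of \<open>W\<close>. On \<open>W \<le> v\<close> the decay of
  \<open>\<Phi>\<close> bounds the integrand by a multiple of \<open>v powr (1 - \<gamma>)\<close>,
  and the range has probability at most of order \<open>v\<close>. On \<open>v < W \<le> 1\<close>
  and on \<open>W > 1\<close> boundedness of \<open>\<Phi>\<close> leaves the averages and the
  second moment. For \<open>\<gamma> < 2\<close> the middle range is started at 0 and the first
  disappears.\<close>

lemma J_near_upper:
  assumes \<gamma>: "\<gamma> > 0" and K: "K > 0"
    and bd: "\<And>z. z \<ge> 0 \<Longrightarrow> \<Phi> z \<le> K" "\<And>z. z > 0 \<Longrightarrow> \<Phi> z \<le> K * z powr (- \<gamma> - 1)"
  shows "\<exists>C>0. \<forall>v. 0 \<le> v \<and> v \<le> 1 \<longrightarrow> J \<gamma> \<Phi> v \<le> ennreal C * near_profile \<gamma> v"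
proof -
  obtain C1 where C1: "C1 > 0" and mid: "\<And>v. v \<ge> 0 \<Longrightarrow>
    (\<integral>\<^sup>+ \<omega>. ennreal (W \<omega> powr (1 - \<gamma>)) * indicator {v<..1} (W \<omega>) \<partial>M)
    \<le> ennreal C1 * (\<integral>\<^sup>+ u\<in>{v..2}. ennreal (u powr (1 - \<gamma>)) \<partial>lborel)"
    using W_powr_middle[OF \<gamma>] by blast
  obtain C2 where C2: "C2 > 0" and np: "\<And>v. 0 \<le> v \<Longrightarrow> v \<le> 1 \<Longrightarrow>
    (\<integral>\<^sup>+ u\<in>{v..2}. ennreal (u powr (1 - \<gamma>)) \<partial>lborel) \<le> ennreal C2 * near_profile \<gamma> v"
    using nn_integral_powr_le_near_profile by blast
  obtain C3 where C3: "C3 > 0" and upper: "\<And>u. u > 0 \<Longrightarrow> prob {\<omega> \<in> space M. W \<omega> \<le> u} \<le> C3 * u"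
    using prob_W_le_upper by blast
  obtain m where m: "m \<ge> 0" "(\<integral>\<^sup>+ \<omega>. ennreal (W \<omega> ^ 2) \<partial>M) = ennreal m"
    using W_square_finite by (cases "\<integral>\<^sup>+ \<omega>. ennreal (W \<omega> ^ 2) \<partial>M") auto
  define C where "C = K * (C3 / ln 2 + C1 * C2 + m / ln 2 + m)"
  have CC: "C3 / ln 2 \<ge> 0" "C1 * C2 > 0" "m / ln 2 \<ge> 0" using C1 C2 C3 m by simp_all
  then have "C > 0" unfolding C_def using K m by (intro mult_pos_pos) linarith+
  have large: "w powr (1 - \<gamma>) \<le> w ^ 2" if "w > 1" for w
    using powr_mono[of "1 - \<gamma>" 2 w] \<gamma> that by (simp add: powr_numeral)
  have "J \<gamma> \<Phi> v \<le> ennreal C * near_profile \<gamma> v" if v: "0 \<le> v" "v \<le> 1" for v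
  proof -
    let ?mid = "\<lambda>\<omega>. ennreal (W \<omega> powr (1 - \<gamma>)) * indicator {v<..1} (W \<omega>)"
    have midv: "(\<integral>\<^sup>+ \<omega>. ?mid \<omega> \<partial>M) \<le> ennreal (C1 * C2) * near_profile \<gamma> v"
      using order_trans[OF mid[OF v(1)] mult_left_mono[OF np[OF v]]] C1 C2
      by (simp add: ennreal_mult mult.assoc)
    consider "\<gamma> < 2" | "\<gamma> \<ge> 2" "v = 0" | "\<gamma> \<ge> 2" "v > 0" using v by linarith
    then show ?thesis
    proof cases
      case 1
      let ?mid0 = "\<lambda>\<omega>. ennreal (W \<omega> powr (1 - \<gamma>)) * indicator {0<..1} (W \<omega>)"
      have mid0: "(\<integral>\<^sup>+ \<omega>. ?mid0 \<omega> \<partial>M) \<le> ennreal (C1 * C2)"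
        using order_trans[OF mid[of 0] mult_left_mono[OF np[of 0]]] C1 C2 1
        by (simp add: ennreal_mult near_profile_def)
      have "J \<gamma> \<Phi> v \<le> (\<integral>\<^sup>+ \<omega>. ennreal K * (?mid0 \<omega> + ennreal (W \<omega> ^ 2)) \<partial>M)"
        unfolding J_def
      proof (rule nn_integral_mono_AE, use W_pos in eventually_elim)
        case (elim \<omega>)
        have "W \<omega> powr (1 - \<gamma>) * \<Phi> (v / W \<omega>) \<le> W \<omega> powr (1 - \<gamma>) * K"
          using elim v by (intro mult_left_mono bd) simp_all
        then have le: "ennreal (W \<omega> powr (1 - \<gamma>) * \<Phi> (v / W \<omega>)) \<le> ennreal K * ennreal (W \<omega> powr (1 - \<gamma>))"
          using K by (simp add: ennreal_mult[symmetric] ennreal_leI mult.commute)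
        have "ennreal (W \<omega> powr (1 - \<gamma>)) \<le> ?mid0 \<omega> + ennreal (W \<omega> ^ 2)"
        proof (cases "W \<omega> \<le> 1")
          case False
          then show ?thesis using large[of "W \<omega>"] by (simp add: ennreal_leI)
        qed (use elim in simp)
        with le show ?case by (meson mult_left_mono order_trans zero_le)
      qed
      also have "\<dots> = ennreal K * ((\<integral>\<^sup>+ \<omega>. ?mid0 \<omega> \<partial>M) + ennreal m)"
        by (simp add: nn_integral_cmult nn_integral_add m)
      also have "\<dots> \<le> ennreal K * (ennreal (C1 * C2) + ennreal m)"
        by (intro mult_left_mono add_mono mid0) simp_all
      also have "\<dots> = ennreal (K * (C1 * C2 + m))"
        using K m CC by (simp add: ennreal_mult)
      also have "\<dots> \<le> ennreal C"
        unfolding C_def using K m CC by (intro ennreal_leI mult_left_mono) simp_all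
      finally show ?thesis using 1 by (simp add: near_profile_def)
    next
      case 2
      then show ?thesis using \<open>C > 0\<close> by (simp add: near_profile_def ennreal_mult_top)
    next
      case 3
      let ?low = "\<lambda>\<omega>. ennreal (v powr (1 - \<gamma>)) * indicator {\<omega> \<in> space M. W \<omega> \<le> v} \<omega>"
      have "J \<gamma> \<Phi> v \<le> (\<integral>\<^sup>+ \<omega>. ennreal K * (?low \<omega> + ?mid \<omega> + ennreal (W \<omega> ^ 2)) \<partial>M)"
        unfolding J_def
      proof (rule nn_integral_mono_AE, use W_pos AE_space in eventually_elim)
        case (elim \<omega>)
        let ?w = "W \<omega>"
        have "?w powr (1 - \<gamma>) * \<Phi> (v / ?w) \<le> ?w powr (1 - \<gamma>) * K"
          using elim v by (intro mult_left_mono bd) simp_all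
        then have le: "ennreal (?w powr (1 - \<gamma>) * \<Phi> (v / ?w)) \<le> ennreal K * ennreal (?w powr (1 - \<gamma>))"
          using K by (simp add: ennreal_mult[symmetric] ennreal_leI mult.commute)
        consider "?w \<le> v" | "v < ?w" "?w \<le> 1" | "1 < ?w" by linarith
        then show ?case
        proof cases
          case 1
          have "?w powr (1 - \<gamma>) * \<Phi> (v / ?w) \<le> ?w powr (1 - \<gamma>) * (K * (v / ?w) powr (- \<gamma> - 1))"
            using elim 3 by (intro mult_left_mono bd) simp_all
          also have "\<dots> = K * (?w powr (1 - \<gamma> - (- \<gamma> - 1)) * v powr (- \<gamma> - 1))"
            unfolding powr_diff[of ?w "1 - \<gamma>"] using elim 3 by (simp add: powr_divide)
          also have "\<dots> = K * (?w powr 2 * v powr (- \<gamma> - 1))" by simp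
          also have "\<dots> \<le> K * (v powr 2 * v powr (- \<gamma> - 1))"
            using elim 1 K by (intro mult_left_mono mult_right_mono powr_mono2) simp_all
          also have "\<dots> = K * v powr (1 - \<gamma>)" by (simp add: powr_add[symmetric])
          finally have "ennreal (?w powr (1 - \<gamma>) * \<Phi> (v / ?w)) \<le> ennreal K * ?low \<omega>"
            using 1 elim K by (simp add: ennreal_mult[symmetric] ennreal_leI)
          also have "\<dots> \<le> ennreal K * (?low \<omega> + ?mid \<omega> + ennreal (?w ^ 2))"
            by (intro mult_left_mono) (simp_all add: add.assoc)
          finally show ?thesis .
        next
          case 2
          then have "ennreal (?w powr (1 - \<gamma>)) = ?mid \<omega>" by simp
          also have "\<dots> \<le> ?low \<omega> + ?mid \<omega> + ennreal (?w ^ 2)" by (simp add: add.commute add.left_commute)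
          finally show ?thesis using le by (meson mult_left_mono order_trans zero_le)
        next
          case 3
          then have "ennreal (?w powr (1 - \<gamma>)) \<le> ennreal (?w ^ 2)" using large by (simp add: ennreal_leI)
          also have "\<dots> \<le> ?low \<omega> + ?mid \<omega> + ennreal (?w ^ 2)" by simp
          finally show ?thesis using le by (meson mult_left_mono order_trans zero_le)
        qed
      qed
      also have "\<dots> = ennreal K * (ennreal (v powr (1 - \<gamma>)) * ennreal (prob {\<omega> \<in> space M. W \<omega> \<le> v}) +
          (\<integral>\<^sup>+ \<omega>. ?mid \<omega> \<partial>M) + ennreal m)"
        by (simp add: nn_integral_cmult nn_integral_add m emeasure_eq_measure)
      also have "\<dots> \<le> ennreal K * (ennreal (C3 / ln 2) * near_profile \<gamma> v + ennreal (C1 * C2) * near_profile \<gamma> v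
          + ennreal (m / ln 2) * near_profile \<gamma> v)"
      proof (intro mult_left_mono add_mono midv)
        have "v powr (1 - \<gamma>) * prob {\<omega> \<in> space M. W \<omega> \<le> v} \<le> v powr (1 - \<gamma>) * (C3 * v)"
          using upper 3 by (intro mult_left_mono) simp_all
        also have "\<dots> = C3 / ln 2 * (ln 2 * v powr (2 - \<gamma>))"
          using 3 powr_add[of v 1 "1 - \<gamma>"] by simp
        finally have "ennreal (v powr (1 - \<gamma>)) * ennreal (prob {\<omega> \<in> space M. W \<omega> \<le> v}) \<le>
            ennreal (C3 / ln 2) * ennreal (ln 2 * v powr (2 - \<gamma>))"
          using C3 by (simp add: ennreal_mult[symmetric] ennreal_leI)
        also have "\<dots> \<le> ennreal (C3 / ln 2) * near_profile \<gamma> v"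
          using near_profile_ge(1)[of v \<gamma>] 3 v by (intro mult_left_mono) simp_all
        finally show "ennreal (v powr (1 - \<gamma>)) * ennreal (prob {\<omega> \<in> space M. W \<omega> \<le> v}) \<le>
            ennreal (C3 / ln 2) * near_profile \<gamma> v" .
        have "ennreal m = ennreal (m / ln 2) * ennreal (ln 2)"
          using m by (simp add: ennreal_mult[symmetric])
        also have "\<dots> \<le> ennreal (m / ln 2) * near_profile \<gamma> v"
          using near_profile_ge(2)[of v \<gamma>] 3 v by (intro mult_left_mono) simp_all
        finally show "ennreal m \<le> ennreal (m / ln 2) * near_profile \<gamma> v" .
      qed simp
      also have "\<dots> = ennreal (K * (C3 / ln 2 + C1 * C2 + m / ln 2)) * near_profile \<gamma> v"
        using K CC by (simp add: ennreal_mult distrib_right[symmetric] ennreal_plus[symmetric] mult.assoc del: ennreal_plus)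
      also have "\<dots> \<le> ennreal C * near_profile \<gamma> v"
        unfolding C_def using K m by (intro mult_right_mono ennreal_leI mult_left_mono) simp_all
      finally show ?thesis .
    qed
  qed
  with \<open>C > 0\<close> show ?thesis by blast
qed

section \<open>Lower bounds for \<open>v \<le> 1\<close>\<close>

text \<open>On \<open>W \<ge> u\<close> the argument \<open>v / W\<close> is at most
  \<open>v / u\<close>. All lower bounds for \<open>J\<close> come from this, with some
  \<open>u \<ge> v\<close> when \<open>v \<le> 1\<close>, and with \<open>u = 1\<close> or
  \<open>u = w0\<close> when \<open>v \<ge> 1\<close>.\<close>

lemma J_ge_tail:
  assumes k: "k \<ge> 0" and bd: "\<And>z. 0 \<le> z \<Longrightarrow> z \<le> v / u \<Longrightarrow> k \<le> \<Phi> z" and v: "0 \<le> v" and u: "0 < u"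
  shows "ennreal k * (\<integral>\<^sup>+ \<omega>. ennreal (W \<omega> powr (1 - \<gamma>)) * indicator {u..} (W \<omega>) \<partial>M) \<le> J \<gamma> \<Phi> v"
proof -
  have "ennreal k * (\<integral>\<^sup>+ \<omega>. ennreal (W \<omega> powr (1 - \<gamma>)) * indicator {u..} (W \<omega>) \<partial>M) =
     (\<integral>\<^sup>+ \<omega>. ennreal k * (ennreal (W \<omega> powr (1 - \<gamma>)) * indicator {u..} (W \<omega>)) \<partial>M)"
    by (rule nn_integral_cmult[symmetric]) measurable
  also have "\<dots> \<le> J \<gamma> \<Phi> v"
    unfolding J_def
  proof (rule nn_integral_mono)
    fix \<omega>
    show "ennreal k * (ennreal (W \<omega> powr (1 - \<gamma>)) * indicator {u..} (W \<omega>)) \<le>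
      ennreal (W \<omega> powr (1 - \<gamma>) * \<Phi> (v / W \<omega>))"
    proof (cases "u \<le> W \<omega>")
      case True
      have "v / W \<omega> \<le> v / u" using True u v by (intro divide_left_mono) simp_all
      then have "k \<le> \<Phi> (v / W \<omega>)" using True u v by (intro bd) simp_all
      then have "W \<omega> powr (1 - \<gamma>) * k \<le> W \<omega> powr (1 - \<gamma>) * \<Phi> (v / W \<omega>)"
        by (intro mult_left_mono) simp_all
      then show ?thesis using True k by (simp add: ennreal_mult[symmetric] ennreal_leI mult.commute)
    qed simp
  qed
  finally show ?thesis .
qed

text \<open>Factoring \<open>W powr (1 - \<gamma>)\<close> as \<open>W powr - \<gamma> * W\<close>
  and estimating the factors at opposite ends of the window treats both signs of
  \<open>1 - \<gamma>\<close> at once.\<close>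

lemma W_powr_window:
  assumes u: "0 < u" and K: "K > 1" and \<gamma>: "\<gamma> > 0"
  shows "ennreal (K powr - \<gamma> * u powr (1 - \<gamma>) * prob {\<omega> \<in> space M. u \<le> W \<omega> \<and> W \<omega> \<le> K * u})
    \<le> (\<integral>\<^sup>+ \<omega>. ennreal (W \<omega> powr (1 - \<gamma>)) * indicator {u..} (W \<omega>) \<partial>M)"
proof -
  let ?k = "K powr - \<gamma> * u powr (1 - \<gamma>)" and ?S = "{\<omega> \<in> space M. u \<le> W \<omega> \<and> W \<omega> \<le> K * u}"
  have "ennreal (?k * prob ?S) = (\<integral>\<^sup>+ \<omega>. ennreal ?k * indicator ?S \<omega> \<partial>M)"
    by (subst nn_integral_cmult_indicator) (simp_all add: emeasure_eq_measure ennreal_mult)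
  also have "\<dots> \<le> (\<integral>\<^sup>+ \<omega>. ennreal (W \<omega> powr (1 - \<gamma>)) * indicator {u..} (W \<omega>) \<partial>M)"
  proof (rule nn_integral_mono)
    fix \<omega>
    show "ennreal ?k * indicator ?S \<omega> \<le> ennreal (W \<omega> powr (1 - \<gamma>)) * indicator {u..} (W \<omega>)"
    proof (cases "\<omega> \<in> ?S")
      case True
      then have w: "u \<le> W \<omega>" "W \<omega> \<le> K * u" "W \<omega> > 0" using u by auto
      have "?k = (K * u) powr - \<gamma> * u"
        using K u by (simp add: powr_mult powr_diff powr_minus field_simps)
      also have "\<dots> \<le> W \<omega> powr - \<gamma> * W \<omega>"
        using w u \<gamma> by (intro mult_mono powr_mono2') simp_all
      also have "\<dots> = W \<omega> powr (1 - \<gamma>)"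
        using w by (simp add: powr_diff powr_minus field_simps)
      finally show ?thesis using True by (simp add: ennreal_leI)
    qed simp
  qed
  finally show ?thesis .
qed

text \<open>In the critical case all scales between \<open>v\<close> and 1 contribute alike, and a
  single window gives only a constant. The windows are therefore integrated against
  \<open>u powr - 2\<close>: their masses produce the integral of \<open>1 / u\<close>, while for a
  fixed outcome the \<open>u\<close> with \<open>u \<le> W \<le> K * u\<close> lie in
  \<open>{W / K..W}\<close> and contribute at most \<open>K ^ 2 / W\<close>.\<close>

lemma inverse_W_log_lower:
  "\<exists>c>0. \<forall>v. 0 < v \<and> v \<le> 1 \<longrightarrow>
    ennreal (c * ln (1 / v)) \<le> (\<integral>\<^sup>+ \<omega>. ennreal (W \<omega> powr - 1) * indicator {v..} (W \<omega>) \<partial>M)"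
proof -
  obtain K e where K: "K > 1" and e: "e > 0" and window:
    "\<And>u. 0 < u \<Longrightarrow> u \<le> 1 \<Longrightarrow> e * u \<le> prob {\<omega> \<in> space M. u \<le> W \<omega> \<and> W \<omega> \<le> K * u}"
    using prob_window_small by blast
  interpret P: pair_sigma_finite M lborel ..
  show ?thesis
  proof (intro exI conjI allI impI)
    show "e / K ^ 2 > 0" using e K by simp
    fix v :: real assume v: "0 < v \<and> v \<le> 1"
    let ?g = "\<lambda>\<omega> u. ennreal (u powr - 2) * indicator {v..1} u * indicator {\<omega> \<in> space M. u \<le> W \<omega> \<and> W \<omega> \<le> K * u} \<omega>"
    have "(\<integral>\<^sup>+ u. ennreal (1 / u) * indicator {v..1} u \<partial>lborel) = ennreal (ln 1 - ln v)"
      using v by (intro nn_integral_FTC_Icc) (auto intro!: derivative_eq_intros)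
    then have "ennreal (e * ln (1 / v)) = ennreal e * (\<integral>\<^sup>+ u. ennreal (1 / u) * indicator {v..1} u \<partial>lborel)"
      using v e by (subst ennreal_mult') (simp_all add: ln_div)
    also have "\<dots> = (\<integral>\<^sup>+ u. ennreal e * (ennreal (1 / u) * indicator {v..1} u) \<partial>lborel)"
      by (rule nn_integral_cmult[symmetric]) measurable
    also have "\<dots> \<le> (\<integral>\<^sup>+ u. \<integral>\<^sup>+ \<omega>. ?g \<omega> u \<partial>M \<partial>lborel)"
    proof (rule nn_integral_mono)
      fix u
      have "ennreal e * (ennreal (1 / u) * indicator {v..1} u) \<le>
        ennreal (u powr - 2) * indicator {v..1} u * ennreal (prob {\<omega> \<in> space M. u \<le> W \<omega> \<and> W \<omega> \<le> K * u})"
      proof (cases "u \<in> {v..1}")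
        case True
        have "e * (1 / u) = u powr - 2 * (e * u)"
          using True v by (simp add: powr_minus powr_numeral power2_eq_square field_simps)
        also have "\<dots> \<le> u powr - 2 * prob {\<omega> \<in> space M. u \<le> W \<omega> \<and> W \<omega> \<le> K * u}"
          using True v by (intro mult_left_mono window) simp_all
        finally show ?thesis using True e v by (simp add: ennreal_mult[symmetric] ennreal_leI)
      qed simp
      also have "\<dots> = (\<integral>\<^sup>+ \<omega>. ?g \<omega> u \<partial>M)"
        by (subst nn_integral_cmult_indicator) (simp_all add: emeasure_eq_measure)
      finally show "ennreal e * (ennreal (1 / u) * indicator {v..1} u) \<le> (\<integral>\<^sup>+ \<omega>. ?g \<omega> u \<partial>M)" .
    qed
    also have "\<dots> = (\<integral>\<^sup>+ \<omega>. \<integral>\<^sup>+ u. ?g \<omega> u \<partial>lborel \<partial>M)"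
      by (rule P.Fubini') measurable
    also have "\<dots> \<le> (\<integral>\<^sup>+ \<omega>. ennreal (K ^ 2) * (ennreal (W \<omega> powr - 1) * indicator {v..} (W \<omega>)) \<partial>M)"
    proof (rule nn_integral_mono)
      fix \<omega> assume \<omega>: "\<omega> \<in> space M"
      let ?w = "W \<omega>"
      show "(\<integral>\<^sup>+ u. ?g \<omega> u \<partial>lborel) \<le> ennreal (K ^ 2) * (ennreal (?w powr - 1) * indicator {v..} ?w)"
      proof (cases "v \<le> ?w")
        case False
        then have "(\<integral>\<^sup>+ u. ?g \<omega> u \<partial>lborel) = integral\<^sup>N (lborel :: real measure) (\<lambda>_. 0)"
          by (intro nn_integral_cong) (auto simp: indicator_def)
        then show ?thesis by simp
      next
        case True
        then have w: "?w > 0" using v by simp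
        have "(\<integral>\<^sup>+ u. ?g \<omega> u \<partial>lborel) \<le> (\<integral>\<^sup>+ u. ennreal ((?w / K) powr - 2) * indicator {0..?w} u \<partial>lborel)"
        proof (rule nn_integral_mono)
          fix u
          show "?g \<omega> u \<le> ennreal ((?w / K) powr - 2) * indicator {0..?w} u"
          proof (cases "v \<le> u \<and> u \<le> ?w \<and> ?w \<le> K * u")
            case True
            then have "?w / K \<le> u" using K by (simp add: divide_le_eq mult.commute)
            then have "u powr - 2 \<le> (?w / K) powr - 2" using w K by (intro powr_mono2') simp_all
            then show ?thesis using True v by (auto simp: indicator_def intro: ennreal_leI)
          qed (auto simp: indicator_def)
        qed
        also have "\<dots> = ennreal ((?w / K) powr - 2) * ennreal ?w"
          using w by (subst nn_integral_cmult_indicator) simp_all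
        also have "\<dots> = ennreal (K ^ 2 * ?w powr - 1)"
          using w K by (simp add: ennreal_mult[symmetric] powr_minus powr_numeral power2_eq_square field_simps)
        also have "\<dots> = ennreal (K ^ 2) * (ennreal (?w powr - 1) * indicator {v..} ?w)"
          by (subst ennreal_mult) (use True in simp_all)
        finally show ?thesis .
      qed
    qed
    also have "\<dots> = ennreal (K ^ 2) * (\<integral>\<^sup>+ \<omega>. ennreal (W \<omega> powr - 1) * indicator {v..} (W \<omega>) \<partial>M)"
      by (rule nn_integral_cmult) measurable
    finally have le: "ennreal (e * ln (1 / v)) \<le> ennreal (K ^ 2) * (\<integral>\<^sup>+ \<omega>. ennreal (W \<omega> powr - 1) * indicator {v..} (W \<omega>) \<partial>M)" .
    have "ennreal (e / K ^ 2 * ln (1 / v)) = ennreal (1 / K ^ 2) * ennreal (e * ln (1 / v))"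
      using K by (simp add: ennreal_mult'[symmetric])
    also have "\<dots> \<le> ennreal (1 / K ^ 2) * (ennreal (K ^ 2) * (\<integral>\<^sup>+ \<omega>. ennreal (W \<omega> powr - 1) * indicator {v..} (W \<omega>) \<partial>M))"
      by (intro mult_left_mono le) simp
    also have "\<dots> = (\<integral>\<^sup>+ \<omega>. ennreal (W \<omega> powr - 1) * indicator {v..} (W \<omega>) \<partial>M)"
      using K by (simp add: mult.assoc[symmetric] ennreal_mult[symmetric])
    finally show "ennreal (e / K ^ 2 * ln (1 / v)) \<le> (\<integral>\<^sup>+ \<omega>. ennreal (W \<omega> powr - 1) * indicator {v..} (W \<omega>) \<partial>M)" .
  qed
qed

text \<open>The window carrying the order is the one at 1 for \<open>\<gamma> < 2\<close> and the
  one at \<open>v\<close> for \<open>\<gamma> > 2\<close>; for \<open>\<gamma> = 2\<close> the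
  logarithmic bound is combined with the window at 1.\<close>

lemma W_powr_tail_lower:
  assumes \<gamma>: "\<gamma> > 0"
  shows "\<exists>c>0. \<forall>v. 0 < v \<and> v \<le> 1 \<longrightarrow> ennreal c * near_profile \<gamma> v \<le>
    (\<integral>\<^sup>+ \<omega>. ennreal (W \<omega> powr (1 - \<gamma>)) * indicator {v..} (W \<omega>) \<partial>M)"
proof -
  let ?I = "\<lambda>v. (\<integral>\<^sup>+ \<omega>. ennreal (W \<omega> powr (1 - \<gamma>)) * indicator {v..} (W \<omega>) \<partial>M)"
  obtain K e where K: "K > 1" and e: "e > 0" and window:
    "\<And>u. 0 < u \<Longrightarrow> u \<le> 1 \<Longrightarrow> e * u \<le> prob {\<omega> \<in> space M. u \<le> W \<omega> \<and> W \<omega> \<le> K * u}"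
    using prob_window_small by blast
  obtain b where b: "b > 0" and log: "\<And>v. 0 < v \<Longrightarrow> v \<le> 1 \<Longrightarrow>
    ennreal (b * ln (1 / v)) \<le> (\<integral>\<^sup>+ \<omega>. ennreal (W \<omega> powr - 1) * indicator {v..} (W \<omega>) \<partial>M)"
    using inverse_W_log_lower by blast
  define k where "k = K powr - \<gamma> * e"
  have k: "k > 0" using K e by (simp add: k_def)
  have I: "ennreal (k * v powr (2 - \<gamma>)) \<le> ?I v" if v: "0 < v" "v \<le> 1" for v
  proof -
    have "k * v powr (2 - \<gamma>) = K powr - \<gamma> * v powr (1 - \<gamma>) * (e * v)"
      using v powr_add[of v 1 "1 - \<gamma>"] by (simp add: k_def)
    also have "\<dots> \<le> K powr - \<gamma> * v powr (1 - \<gamma>) * prob {\<omega> \<in> space M. v \<le> W \<omega> \<and> W \<omega> \<le> K * v}"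
      using v by (intro mult_left_mono window) simp_all
    finally show ?thesis using W_powr_window[OF v(1) K \<gamma>] by (meson ennreal_leI order_trans)
  qed
  have anti: "?I 1 \<le> ?I v" if "v \<le> 1" for v
    using that by (intro nn_integral_mono mult_left_mono) (auto simp: indicator_def)
  \<comment> \<open>Halved because for \<open>\<gamma> = 2\<close> the sum
    \<open>1 + ln (1 / v)\<close> is at most twice its larger term, and each term has its own lower
    bound for the integral.\<close>
  define c where "c = min k (min k b / 2)"
  have c: "c > 0" "c \<le> k" "2 * c \<le> k" "2 * c \<le> b" using k b by (auto simp: c_def)
  have "ennreal c * near_profile \<gamma> v \<le> ?I v" if v: "0 < v" "v \<le> 1" for v
  proof -
    consider "\<gamma> < 2" | "\<gamma> = 2" | "\<gamma> > 2" by linarith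
    then show ?thesis
    proof cases
      case 1
      have "ennreal c \<le> ennreal (k * 1 powr (2 - \<gamma>))" using c by (simp add: ennreal_leI)
      also have "\<dots> \<le> ?I v" using order_trans[OF I[of 1] anti[OF v(2)]] by simp
      finally show ?thesis using 1 by (simp add: near_profile_def)
    next
      case 3
      have "ennreal (c * v powr (2 - \<gamma>)) \<le> ennreal (k * v powr (2 - \<gamma>))"
        using c by (intro ennreal_leI mult_right_mono) simp_all
      then have "ennreal (c * v powr (2 - \<gamma>)) \<le> ?I v" using I[OF v] by (rule order_trans)
      then show ?thesis using 3 v c by (simp add: near_profile_def ennreal_mult)
    next
      case 2
      have lv: "ln (1 / v) \<ge> 0" using v by simp
      have k1: "ennreal (2 * c) \<le> ?I v"
      proof -
        have "ennreal (2 * c) \<le> ennreal (k * 1 powr (2 - \<gamma>))" using c by (simp add: ennreal_leI)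
        also have "\<dots> \<le> ?I v" using order_trans[OF I[of 1] anti[OF v(2)]] by simp
        finally show ?thesis .
      qed
      have k2: "ennreal (2 * c * ln (1 / v)) \<le> ?I v"
      proof -
        have "ennreal (2 * c * ln (1 / v)) \<le> ennreal (b * ln (1 / v))"
          using c lv by (intro ennreal_leI mult_right_mono)
        also have "\<dots> \<le> ?I v" using log[OF v] 2 by simp
        finally show ?thesis .
      qed
      have "c * ln (2 / v) \<le> max (2 * c) (2 * c * ln (1 / v))"
      proof -
        have "ln (2 / v) = ln 2 + ln (1 / v)" using v by (simp add: ln_div)
        also have "\<dots> \<le> 1 + ln (1 / v)" using ln_2_less_1 by simp
        also have "\<dots> \<le> max 2 (2 * ln (1 / v))" by simp
        finally have "c * ln (2 / v) \<le> c * max 2 (2 * ln (1 / v))" using c by (intro mult_left_mono) simp_all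
        then show ?thesis using c by (simp add: max_mult_distrib_left mult.assoc mult.left_commute)
      qed
      then have "ennreal (c * ln (2 / v)) \<le> ennreal (max (2 * c) (2 * c * ln (1 / v)))" by (rule ennreal_leI)
      also have "\<dots> \<le> ?I v" using k1 k2 by (simp add: max_def)
      finally show ?thesis using 2 v c by (simp add: near_profile_def ennreal_mult')
    qed
  qed
  then show ?thesis using c by blast
qed

text \<open>Serves to show that \<open>J\<close> is infinite at \<open>v = 0\<close>. The witnesses
  invert the profile; \<open>R + 1\<close> in place of \<open>R\<close> keeps the second one
  positive and at most 1 even for \<open>R = 0\<close>.\<close>

lemma near_profile_unbounded:
  assumes "\<gamma> \<ge> 2" "R \<ge> 0"
  shows "\<exists>v. 0 < v \<and> v \<le> 1 \<and> ennreal R \<le> near_profile \<gamma> v"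
proof (cases "\<gamma> = 2")
  case True
  have "R \<le> ln (2 / exp (- R))"
    by (simp add: ln_div)
  then show ?thesis using True assms
    by (intro exI[of _ "exp (- R)"]) (simp add: near_profile_def ennreal_leI)
next
  case False
  let ?v = "(R + 1) powr (1 / (2 - \<gamma>))"
  have "?v \<le> 1" using False assms powr_mono2'[of "1 / (2 - \<gamma>)" 1 "R + 1"] by (simp add: divide_nonneg_neg)
  moreover have "?v powr (2 - \<gamma>) = R + 1" using False assms by (simp add: powr_powr)
  ultimately show ?thesis using False assms
    by (intro exI[of _ ?v]) (simp add: near_profile_def ennreal_leI)
qed

lemma J_near_lower:
  assumes \<gamma>: "\<gamma> > 0" and k: "k > 0" and bd: "\<And>z. 0 \<le> z \<Longrightarrow> z \<le> 1 \<Longrightarrow> k \<le> \<Phi> z"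
  shows "\<exists>c>0. \<forall>v. 0 \<le> v \<and> v \<le> 1 \<longrightarrow> ennreal c * near_profile \<gamma> v \<le> J \<gamma> \<Phi> v"
proof -
  obtain c where c: "c > 0" and tail: "\<And>v. 0 < v \<Longrightarrow> v \<le> 1 \<Longrightarrow> ennreal c * near_profile \<gamma> v \<le>
    (\<integral>\<^sup>+ \<omega>. ennreal (W \<omega> powr (1 - \<gamma>)) * indicator {v..} (W \<omega>) \<partial>M)"
    using W_powr_tail_lower[OF \<gamma>] by blast
  \<comment> \<open>Stated for every level \<open>u \<ge> v\<close> and not just
    \<open>u = v\<close>, so that at \<open>v = 0\<close> all levels \<open>0 < u \<le> 1\<close>
    are available.\<close>
  have le: "ennreal (k * c) * near_profile \<gamma> u \<le> J \<gamma> \<Phi> v" if "0 \<le> v" "v \<le> u" "0 < u" "u \<le> 1" for u v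
  proof -
    have "ennreal (k * c) * near_profile \<gamma> u = ennreal k * (ennreal c * near_profile \<gamma> u)"
      using k c by (simp add: ennreal_mult mult.assoc)
    also have "\<dots> \<le> ennreal k * (\<integral>\<^sup>+ \<omega>. ennreal (W \<omega> powr (1 - \<gamma>)) * indicator {u..} (W \<omega>) \<partial>M)"
      using that by (intro mult_left_mono tail) simp_all
    also have "\<dots> \<le> J \<gamma> \<Phi> v"
    proof (rule J_ge_tail)
      fix z assume z: "0 \<le> z" "z \<le> v / u"
      have "v / u \<le> 1" using that by (simp add: divide_le_eq)
      with z show "k \<le> \<Phi> z" by (intro bd) simp_all
    qed (use that k in simp_all)
    finally show ?thesis .
  qed
  have "ennreal (k * c) * near_profile \<gamma> v \<le> J \<gamma> \<Phi> v" if v: "0 \<le> v" "v \<le> 1" for v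
  proof (cases "v = 0")
    case False
    then show ?thesis using v by (intro le) simp_all
  next
    case v0: True
    show ?thesis
    proof (cases "\<gamma> < 2")
      case True
      then show ?thesis using le[of 0 1] v0 by (simp add: near_profile_def)
    next
      case False
      \<comment> \<open>A finite value would bound the profile on \<open>0 < u \<le> 1\<close>,
        where it is unbounded.\<close>
      have "J \<gamma> \<Phi> 0 = \<infinity>"
      proof (rule ccontr)
        assume "J \<gamma> \<Phi> 0 \<noteq> \<infinity>"
        then obtain j where j: "j \<ge> 0" "J \<gamma> \<Phi> 0 = ennreal j" by (cases "J \<gamma> \<Phi> 0") auto
        obtain u where u: "0 < u" "u \<le> 1" "ennreal ((j + 1) / (k * c)) \<le> near_profile \<gamma> u"
          using near_profile_unbounded[of \<gamma> "(j + 1) / (k * c)"] False j k c by auto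
        have "ennreal (j + 1) = ennreal (k * c) * ennreal ((j + 1) / (k * c))"
          using k c j by (simp add: ennreal_mult[symmetric])
        also have "\<dots> \<le> ennreal (k * c) * near_profile \<gamma> u" by (intro mult_left_mono u) simp
        also have "\<dots> \<le> ennreal j" using le[of 0 u] u j by simp
        finally show False using j by (simp add: ennreal_le_iff del: ennreal_plus)
      qed
      then show ?thesis using v0 by simp
    qed
  qed
  moreover have "k * c > 0" using k c by simp
  ultimately show ?thesis by blast
qed

section \<open>Bounds for \<open>v \<ge> 1\<close> with a polynomial profile\<close>

text \<open>\<open>W powr (1 - \<gamma>) * (v / W) powr (- \<gamma> - 1)\<close> equals
  \<open>v powr (- \<gamma> - 1) * W ^ 2\<close>, and the second moment is finite.\<close>

lemma J_far_upper_polynomial: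
  assumes K: "K > 0" and bd: "\<And>z. z > 0 \<Longrightarrow> \<Phi> z \<le> K * z powr (- \<gamma> - 1)"
  shows "\<exists>C>0. \<forall>v\<ge>1. J \<gamma> \<Phi> v \<le> ennreal (C * v powr (- \<gamma> - 1))"
proof -
  obtain m where m: "m \<ge> 0" "(\<integral>\<^sup>+ \<omega>. ennreal (W \<omega> ^ 2) \<partial>M) = ennreal m"
    using W_square_finite by (cases "\<integral>\<^sup>+ \<omega>. ennreal (W \<omega> ^ 2) \<partial>M") auto
  show ?thesis
  proof (intro exI conjI allI impI)
    show "K * (m + 1) > 0" using K m by simp
    fix v :: real assume v: "v \<ge> 1"
    have "J \<gamma> \<Phi> v \<le> (\<integral>\<^sup>+ \<omega>. ennreal (K * v powr (- \<gamma> - 1)) * ennreal (W \<omega> ^ 2) \<partial>M)"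
      unfolding J_def
    proof (rule nn_integral_mono_AE, use W_pos in eventually_elim)
      case (elim \<omega>)
      have "W \<omega> powr (1 - \<gamma>) * \<Phi> (v / W \<omega>) \<le> W \<omega> powr (1 - \<gamma>) * (K * (v / W \<omega>) powr (- \<gamma> - 1))"
        using elim v by (intro mult_left_mono bd) simp_all
      also have "\<dots> = K * v powr (- \<gamma> - 1) * W \<omega> powr (1 - \<gamma> - (- \<gamma> - 1))"
        unfolding powr_diff[of "W \<omega>" "1 - \<gamma>"] using elim v by (simp add: powr_divide)
      also have "\<dots> = K * v powr (- \<gamma> - 1) * W \<omega> ^ 2" using elim by (simp add: powr_numeral)
      finally show ?case using K by (simp add: ennreal_mult[symmetric] ennreal_leI)
    qed
    also have "\<dots> = ennreal (K * v powr (- \<gamma> - 1)) * ennreal m"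
      by (simp add: nn_integral_cmult m)
    also have "\<dots> \<le> ennreal (K * (m + 1) * v powr (- \<gamma> - 1))"
      using K m by (simp add: ennreal_mult[symmetric] ennreal_leI algebra_simps)
    finally show "J \<gamma> \<Phi> v \<le> ennreal (K * (m + 1) * v powr (- \<gamma> - 1))" .
  qed
qed

text \<open>On \<open>W \<ge> 1\<close> the argument of \<open>\<Phi>\<close> is at most
  \<open>v\<close>; what remains is a positive constant, the tail bound at level 1.\<close>

lemma J_far_lower_polynomial:
  assumes \<gamma>: "\<gamma> > 0"
    and k: "k > 0" and bd: "\<And>z v. 0 \<le> z \<Longrightarrow> z \<le> v \<Longrightarrow> 1 \<le> v \<Longrightarrow> k * v powr (- \<gamma> - 1) \<le> \<Phi> z"
  shows "\<exists>c>0. \<forall>v\<ge>1. ennreal (c * v powr (- \<gamma> - 1)) \<le> J \<gamma> \<Phi> v"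
proof -
  obtain c where c: "c > 0" and tail: "\<And>v. 0 < v \<Longrightarrow> v \<le> 1 \<Longrightarrow> ennreal c * near_profile \<gamma> v \<le>
    (\<integral>\<^sup>+ \<omega>. ennreal (W \<omega> powr (1 - \<gamma>)) * indicator {v..} (W \<omega>) \<partial>M)"
    using W_powr_tail_lower[OF \<gamma>] by blast
  have np: "ennreal (ln 2) \<le> near_profile \<gamma> 1"
    using near_profile_ge(2)[of 1 \<gamma>] ln_2_less_1 by (cases "\<gamma> < 2") (simp_all add: near_profile_def)
  show ?thesis
  proof (intro exI conjI allI impI)
    show "k * (c * ln 2) > 0" using k c by simp
    fix v :: real assume v: "v \<ge> 1"
    have "ennreal (k * (c * ln 2) * v powr (- \<gamma> - 1)) = ennreal (k * v powr (- \<gamma> - 1)) * (ennreal c * ennreal (ln 2))"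
      using k c by (simp add: ennreal_mult[symmetric] ac_simps)
    also have "\<dots> \<le> ennreal (k * v powr (- \<gamma> - 1)) * (ennreal c * near_profile \<gamma> 1)"
      by (intro mult_left_mono np) simp_all
    also have "\<dots> \<le> ennreal (k * v powr (- \<gamma> - 1)) * (\<integral>\<^sup>+ \<omega>. ennreal (W \<omega> powr (1 - \<gamma>)) * indicator {1..} (W \<omega>) \<partial>M)"
      by (intro mult_left_mono tail) simp_all
    also have "\<dots> \<le> J \<gamma> \<Phi> v"
      using v k by (intro J_ge_tail bd) simp_all
    finally show "ennreal (k * (c * ln 2) * v powr (- \<gamma> - 1)) \<le> J \<gamma> \<Phi> v" .
  qed
qed

end

section \<open>Bounds for \<open>v \<ge> 1\<close> with an exponential profile\<close>

text \<open>For \<open>z > 1\<close> use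
  \<open>exp y \<ge> (1 + y / N) ^ N \<ge> (y / N) ^ N\<close> at \<open>y = c * z powr b\<close>,
  with \<open>N\<close> so large that \<open>b * N \<ge> g\<close>. For \<open>z \<le> 1\<close> the
  power is at least 1, and the added 1 in \<open>K\<close> suffices.\<close>

lemma exp_minus_powr_le:
  fixes c b g :: real
  assumes c: "c > 0" and b: "b > 0" and g: "g > 0"
  shows "\<exists>K>0. \<forall>z>0. exp (- c * z powr b) \<le> K * z powr (- g)"
proof -
  define N where "N = nat \<lceil>g / b\<rceil> + 1"
  have N: "g / b \<le> real N" "N > 0" by (simp_all add: N_def) linarith
  define K where "K = (real N / c) ^ N + 1"
  have K: "K > 0" using c by (simp add: K_def add_nonneg_pos)
  have "exp (- c * z powr b) \<le> K * z powr (- g)" if z: "z > 0" for z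
  proof (cases "z \<le> 1")
    case True
    have "exp (- c * z powr b) \<le> 1 * 1" using c by simp
    also have "\<dots> \<le> K * z powr (- g)"
      using powr_mono2'[of "- g" z 1] True z g c by (intro mult_mono) (simp_all add: K_def)
    finally show ?thesis .
  next
    case False
    have cz: "c * z powr b > 0" using c z by simp
    have "(c * z powr b / real N) ^ N \<le> (1 + c * z powr b / real N) ^ N"
      using cz by (intro power_mono) simp_all
    also have "\<dots> \<le> exp (c * z powr b)"
      using cz N by (intro exp_ge_one_plus_x_over_n_power_n) simp_all
    finally have "exp (- c * z powr b) \<le> 1 / (c * z powr b / real N) ^ N"
      using cz N by (simp add: exp_minus inverse_eq_divide del: power_divide power_mult_distrib) (intro divide_left_mono; simp)
    also have "\<dots> = (real N / c) ^ N * (z powr b) powr (- real N)"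
      using c z by (simp add: powr_minus powr_realpow power_mult_distrib power_divide field_simps)
    also have "\<dots> \<le> (real N / c) ^ N * z powr (- g)"
      unfolding powr_powr using False N b c
      by (intro mult_left_mono powr_mono) (simp_all add: field_simps)
    also have "\<dots> \<le> K * z powr (- g)" by (intro mult_right_mono) (simp_all add: K_def)
    finally show ?thesis .
  qed
  then show ?thesis using K by blast
qed

context stable_variable
begin

text \<open>The two exponents \<open>(v / w) powr (1 / (a - 1))\<close> and \<open>w powr p\<close> balance at \<open>w = V powr (1 - \<beta>)\<close>,
  \<open>V = v powr (1 / (a - \<beta>))\<close>, where both equal \<open>V\<close>.\<close>

lemma balance:
  assumes a: "a > 1" and v: "v > 0"
  defines "V \<equiv> v powr (1 / (a - \<beta>))"
  shows "(v / V powr (1 - \<beta>)) powr (1 / (a - 1)) = V" "(V powr (1 - \<beta>)) powr p = V"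
proof -
  have V: "V > 0" using v by (simp add: V_def)
  have "v = V powr (a - \<beta>)" using v a \<beta>_less_1 by (simp add: V_def powr_powr)
  then have "v / V powr (1 - \<beta>) = V powr ((a - \<beta>) - (1 - \<beta>))" by (simp only: powr_diff)
  then show "(v / V powr (1 - \<beta>)) powr (1 / (a - 1)) = V" using V a by (simp add: powr_powr)
  show "(V powr (1 - \<beta>)) powr p = V" using V \<beta>_less_1 by (simp add: powr_powr p_def)
qed

text \<open>The split is at \<open>w0 = V powr (1 - \<beta>)\<close>. Below it half of the exponent
  of \<open>\<Phi>\<close> yields \<open>exp (- h * V)\<close>, and the other half pays for
  \<open>W powr (1 - \<gamma>)\<close>, which may blow up near \<open>W = 0\<close>. Above it
  \<open>V \<le> W powr p\<close>, and the exponential moment at rate \<open>s\<close> absorbs both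
  that factor and \<open>exp (h * V)\<close>.\<close>

lemma J_far_upper_exponential:
  assumes \<gamma>: "\<gamma> > 0" and a: "a > 1" and l: "l > 0"
  defines "\<Phi> \<equiv> \<lambda>z. exp (- l * z powr (1 / (a - 1)))"
  shows "\<exists>C>0. \<exists>h>0. \<forall>v\<ge>1. J \<gamma> \<Phi> v \<le> ennreal (C * exp (- h * v powr (1 / (a - \<beta>))))"
proof -
  obtain K where K: "K > 0" and poly: "\<And>z. z > 0 \<Longrightarrow> exp (- (l / 2) * z powr (1 / (a - 1))) \<le> K * z powr (- (\<gamma> + 1))"
    using exp_minus_powr_le[of "l / 2" "1 / (a - 1)" "\<gamma> + 1"] l a \<gamma> by auto
  obtain m where m: "m \<ge> 0" "(\<integral>\<^sup>+ \<omega>. ennreal (W \<omega> ^ 2) \<partial>M) = ennreal m"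
    using W_square_finite by (cases "\<integral>\<^sup>+ \<omega>. ennreal (W \<omega> ^ 2) \<partial>M") auto
  obtain s where s: "s > 0" and fin: "(\<integral>\<^sup>+ \<omega>. ennreal (exp (s * W \<omega> powr p)) \<partial>M) < \<infinity>"
    using exponential_moment_W by blast
  obtain B where B: "B \<ge> 0" "(\<integral>\<^sup>+ \<omega>. ennreal (exp (s * W \<omega> powr p)) \<partial>M) = ennreal B"
    using fin by (cases "\<integral>\<^sup>+ \<omega>. ennreal (exp (s * W \<omega> powr p)) \<partial>M") auto
  obtain D where D: "D > 0" and sq: "\<And>w. w \<ge> 0 \<Longrightarrow> w ^ 2 \<le> D * exp (s / 2 * w powr p)"
    using square_le_exponential[of "s / 2"] s by auto
  \<comment> \<open>Half rates, because on either side of \<open>w0\<close> the other half is spent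
    on the factor \<open>W powr (1 - \<gamma>)\<close>.\<close>
  define h where "h = min (l / 2) (s / 2)"
  have h: "h > 0" "h \<le> l / 2" "h \<le> s / 2" using l s by (simp_all add: h_def)
  show ?thesis
  proof (intro exI conjI allI impI)
    show "K * m + D * B + 1 > 0" using K m D B by (simp add: add_nonneg_pos)
    show "h > 0" by fact
    fix v :: real assume v: "v \<ge> 1"
    define V where "V = v powr (1 / (a - \<beta>))"
    define w0 where "w0 = V powr (1 - \<beta>)"
    have V: "V \<ge> 1" using v a \<beta>_less_1 by (simp add: V_def ge_one_powr_ge_zero)
    have w0: "w0 \<ge> 1" using V \<beta>_less_1 by (simp add: w0_def ge_one_powr_ge_zero)
    have bal: "(v / w0) powr (1 / (a - 1)) = V" "w0 powr p = V"
      using balance[OF a, of v] v by (simp_all add: V_def w0_def)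
    have "J \<gamma> \<Phi> v \<le> (\<integral>\<^sup>+ \<omega>. ennreal (exp (- h * V)) * (ennreal K * ennreal (W \<omega> ^ 2) + ennreal D * ennreal (exp (s * W \<omega> powr p))) \<partial>M)"
      unfolding J_def
    proof (rule nn_integral_mono_AE, use W_pos in eventually_elim)
      case (elim \<omega>)
      let ?w = "W \<omega>"
      have "?w powr (1 - \<gamma>) * \<Phi> (v / ?w) \<le> exp (- h * V) * (K * ?w ^ 2 + D * exp (s * ?w powr p))"
      proof (cases "?w \<le> w0")
        case True
        let ?z = "v / ?w"
        have z: "?z > 0" using elim v by simp
        have "v / w0 \<le> ?z" using True elim v w0 by (intro divide_left_mono) simp_all
        then have "(v / w0) powr (1 / (a - 1)) \<le> ?z powr (1 / (a - 1))"
          using v w0 a by (intro powr_mono2) simp_all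
        then have "V \<le> ?z powr (1 / (a - 1))" by (simp only: bal)
        then have "h * V \<le> l / 2 * ?z powr (1 / (a - 1))"
          using h V by (intro mult_mono) simp_all
        then have E: "exp (- (l / 2) * ?z powr (1 / (a - 1))) \<le> exp (- h * V)" by simp
        have "\<Phi> ?z = exp (- (l / 2) * ?z powr (1 / (a - 1))) * exp (- (l / 2) * ?z powr (1 / (a - 1)))"
          unfolding \<Phi>_def exp_add[symmetric] by simp
        also have "\<dots> \<le> exp (- h * V) * (K * ?z powr (- (\<gamma> + 1)))"
          by (intro mult_mono E poly z) simp_all
        finally have "?w powr (1 - \<gamma>) * \<Phi> ?z \<le> ?w powr (1 - \<gamma>) * (exp (- h * V) * (K * ?z powr (- (\<gamma> + 1))))"
          by (intro mult_left_mono) simp_all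
        also have "\<dots> = exp (- h * V) * (K * (v powr (- (\<gamma> + 1)) * ?w powr (1 - \<gamma> - - (\<gamma> + 1))))"
          unfolding powr_diff[of ?w "1 - \<gamma>"] using elim v by (simp add: powr_divide)
        also have "\<dots> \<le> exp (- h * V) * (K * (1 * ?w powr (1 - \<gamma> - - (\<gamma> + 1))))"
          using K v \<gamma> powr_mono2'[of "- (\<gamma> + 1)" 1 v] by (intro mult_left_mono mult_right_mono) simp_all
        also have "\<dots> = exp (- h * V) * (K * ?w ^ 2)" using elim by (simp add: powr_numeral)
        also have "\<dots> \<le> exp (- h * V) * (K * ?w ^ 2 + D * exp (s * ?w powr p))"
          using D by (intro mult_left_mono) simp_all
        finally show ?thesis .
      next
        case False
        then have w: "?w > 1" using w0 by linarith
        have "w0 powr p \<le> ?w powr p" using False w0 p_pos by (intro powr_mono2) simp_all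
        then have "V \<le> ?w powr p" by (simp only: bal)
        then have "h * V \<le> s / 2 * ?w powr p"
          using h V s by (intro mult_mono) simp_all
        then have E: "s / 2 * ?w powr p \<le> - h * V + s * ?w powr p" by simp
        have "?w powr (1 - \<gamma>) * \<Phi> (v / ?w) \<le> ?w powr 2 * 1"
          using w \<gamma> l by (intro mult_mono powr_mono) (simp_all add: \<Phi>_def)
        also have "\<dots> = ?w ^ 2" using elim by (simp add: powr_numeral)
        also have "\<dots> \<le> D * exp (s / 2 * ?w powr p)" using sq elim by simp
        also have "\<dots> \<le> D * exp (- h * V + s * ?w powr p)"
          using D E by (intro mult_left_mono) simp_all
        also have "\<dots> = exp (- h * V) * (D * exp (s * ?w powr p))" by (simp add: exp_add exp_diff exp_minus field_simps)
        also have "\<dots> \<le> exp (- h * V) * (K * ?w ^ 2 + D * exp (s * ?w powr p))"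
          using K by (intro mult_left_mono) simp_all
        finally show ?thesis .
      qed
      then have "ennreal (?w powr (1 - \<gamma>) * \<Phi> (v / ?w)) \<le> ennreal (exp (- h * V) * (K * ?w ^ 2 + D * exp (s * ?w powr p)))"
        by (rule ennreal_leI)
      then show ?case using K D by (simp add: ennreal_mult)
    qed
    also have "\<dots> = ennreal (exp (- h * V)) * (ennreal K * ennreal m + ennreal D * ennreal B)"
      by (simp add: nn_integral_cmult nn_integral_add m B)
    also have "\<dots> = ennreal (exp (- h * V) * (K * m + D * B))"
      using K D B m by (simp add: ennreal_mult)
    also have "\<dots> \<le> ennreal ((K * m + D * B + 1) * exp (- h * V))"
      by (intro ennreal_leI) (simp add: algebra_simps)
    finally show "J \<gamma> \<Phi> v \<le> ennreal ((K * m + D * B + 1) * exp (- h * v powr (1 / (a - \<beta>))))"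
      by (simp only: V_def)
  qed
qed

text \<open>One window at \<open>w0\<close> suffices: the bound \<open>exp (- l * V)\<close> holds
  for \<open>\<Phi>\<close> on \<open>W \<ge> w0\<close>, and the window has mass at least
  \<open>e * exp (- A * V)\<close>. The factor \<open>w0 powr (1 - \<gamma>)\<close>, a power of
  \<open>V\<close>, is at least \<open>exp (- \<gamma> * V)\<close>; hence the rate
  \<open>l + \<gamma> + A\<close>.\<close>

lemma J_far_lower_exponential:
  assumes \<gamma>: "\<gamma> > 0" and a: "a > 1" and l: "l > 0"
  defines "\<Phi> \<equiv> \<lambda>z. exp (- l * z powr (1 / (a - 1)))"
  shows "\<exists>C>0. \<exists>h>0. \<forall>v\<ge>1. ennreal (C * exp (- h * v powr (1 / (a - \<beta>)))) \<le> J \<gamma> \<Phi> v"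
proof -
  obtain K e A where K: "K > 1" and e: "e > 0" and A: "A > 0" and window:
    "\<And>u. u \<ge> 1 \<Longrightarrow> e * exp (- A * u powr p) \<le> prob {\<omega> \<in> space M. u \<le> W \<omega> \<and> W \<omega> \<le> K * u}"
    using prob_window_large by blast
  show ?thesis
  proof (intro exI conjI allI impI)
    show "K powr - \<gamma> * e > 0" "l + \<gamma> + A > 0" using K e l \<gamma> A by simp_all
    fix v :: real assume v: "v \<ge> 1"
    define V where "V = v powr (1 / (a - \<beta>))"
    define w0 where "w0 = V powr (1 - \<beta>)"
    have V: "V \<ge> 1" using v a \<beta>_less_1 by (simp add: V_def ge_one_powr_ge_zero)
    have w0: "w0 \<ge> 1" using V \<beta>_less_1 by (simp add: w0_def ge_one_powr_ge_zero)
    have bal: "(v / w0) powr (1 / (a - 1)) = V" "w0 powr p = V"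
      using balance[OF a, of v] v by (simp_all add: V_def w0_def)
    have "exp (- \<gamma> * V) \<le> w0 powr (1 - \<gamma>)"
    proof -
      have "ln V \<le> V" using ln_bound[of V] V by simp
      then have "(1 - \<beta>) * ln V \<le> 1 * V"
        using V \<beta>_pos \<beta>_less_1 by (intro mult_mono) simp_all
      then have "\<gamma> * ln w0 \<le> \<gamma> * V"
        using \<gamma> V by (simp add: w0_def ln_powr)
      then have "exp (- \<gamma> * V) \<le> w0 powr (- \<gamma>)" using w0 by (simp add: powr_def)
      also have "\<dots> \<le> w0 powr (1 - \<gamma>)" using w0 by (intro powr_mono) simp_all
      finally show ?thesis .
    qed
    then have "K powr - \<gamma> * exp (- \<gamma> * V) * (e * exp (- A * V)) \<le>
        K powr - \<gamma> * w0 powr (1 - \<gamma>) * prob {\<omega> \<in> space M. w0 \<le> W \<omega> \<and> W \<omega> \<le> K * w0}"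
      using window[OF w0] e bal(2) by (intro mult_mono mult_left_mono) simp_all
    then have le: "ennreal (K powr - \<gamma> * exp (- \<gamma> * V) * (e * exp (- A * V))) \<le>
        (\<integral>\<^sup>+ \<omega>. ennreal (W \<omega> powr (1 - \<gamma>)) * indicator {w0..} (W \<omega>) \<partial>M)"
      by (rule order_trans[OF ennreal_leI W_powr_window]) (use w0 K \<gamma> in linarith)+
    have "K powr - \<gamma> * e * exp (- (l + \<gamma> + A) * V) = exp (- l * V) * (K powr - \<gamma> * exp (- \<gamma> * V) * (e * exp (- A * V)))"
    proof -
      have "exp (- (l + \<gamma> + A) * V) = exp (- l * V) * (exp (- \<gamma> * V) * exp (- A * V))"
        unfolding exp_add[symmetric] by (simp add: algebra_simps)
      then show ?thesis by (simp only: ac_simps)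
    qed
    then have "ennreal (K powr - \<gamma> * e * exp (- (l + \<gamma> + A) * V)) =
        ennreal (exp (- l * V)) * ennreal (K powr - \<gamma> * exp (- \<gamma> * V) * (e * exp (- A * V)))"
      using e by (simp add: ennreal_mult[symmetric])
    also have "\<dots> \<le> ennreal (exp (- l * V)) * (\<integral>\<^sup>+ \<omega>. ennreal (W \<omega> powr (1 - \<gamma>)) * indicator {w0..} (W \<omega>) \<partial>M)"
      by (intro mult_left_mono le) simp
    also have "\<dots> \<le> J \<gamma> \<Phi> v"
    proof (rule J_ge_tail)
      fix z assume z: "0 \<le> z" "z \<le> v / w0"
      have "z powr (1 / (a - 1)) \<le> (v / w0) powr (1 / (a - 1))" using z a by (intro powr_mono2) simp_all
      then have "z powr (1 / (a - 1)) \<le> V" by (simp only: bal)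
      then show "exp (- l * V) \<le> \<Phi> z" using l by (simp add: \<Phi>_def)
    qed (use v w0 in simp_all)
    finally show "ennreal (K powr - \<gamma> * e * exp (- (l + \<gamma> + A) * v powr (1 / (a - \<beta>)))) \<le> J \<gamma> \<Phi> v"
      by (simp only: V_def)
  qed
qed

end

section \<open>The fundamental solution\<close>

lemma stable_variable_time_one:
  assumes "0 < \<beta>" "\<beta> < 1" and S: "stable_subordinator \<beta> M S" and p: "continuous_density M S pbar"
  shows "\<exists>c. stable_variable M (S 1) \<beta> c"
proof -
  have sub: "subordinator M S" using S by (simp add: stable_subordinator_def)
  interpret prob_space M using sub by (simp add: subordinator_def)
  obtain c where "c > 0"
    "\<And>t l. t \<ge> 0 \<Longrightarrow> l > 0 \<Longrightarrow> (\<integral>\<omega>. exp (- l * S t \<omega>) \<partial>M) = exp (- c * t * l powr \<beta>)"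
    using S by (auto simp: stable_subordinator_def)
  then have "stable_variable M (S 1) \<beta> c"
    using sub assms stable_subordinator_pos_AE[OF S p zero_less_one]
    by unfold_locales (auto simp: subordinator_def)
  then show ?thesis ..
qed

section \<open>Scaling of the estimating functions\<close>

lemma powr_quotient:
  fixes r t :: real
  assumes "t > 0" "r \<ge> 0"
  shows "(r powr a / t powr b) powr e = t powr (- b * e) * r powr (a * e)"
  using assms by (simp add: powr_divide powr_powr powr_minus_divide)

text \<open>With \<open>\<gamma> = d / \<alpha>\<close> the exponents of \<open>t\<close> add up to
  \<open>\<beta> - 1 - \<beta> * \<gamma> - \<beta> * (2 - \<gamma>) = - 1 - \<beta>\<close>; for
  \<open>\<gamma> = 2\<close> this is the exponent of the prefactor itself.\<close>

lemma H_le1_scaling: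
  assumes t: "t > 0" and r: "r \<ge> 0" and \<alpha>: "\<alpha> > 0" and d: "d > 0"
  shows "H_le1 d \<alpha> \<beta> t r =
    ennreal (t powr (\<beta> - 1 - \<beta> * d / \<alpha>)) * near_profile (d / \<alpha>) (r powr \<alpha> / t powr \<beta>)"
proof -
  consider "d < 2 * \<alpha>" | "d \<ge> 2 * \<alpha>" "r = 0" | "d = 2 * \<alpha>" "r > 0" | "d > 2 * \<alpha>" "r > 0" using r by linarith
  then show ?thesis
  proof cases
    case 1
    then have "d / \<alpha> < 2" using \<alpha> by (simp add: divide_less_eq)
    then show ?thesis using 1 by (simp add: H_le1_def near_profile_def)
  next
    case 2
    then have "\<not> d / \<alpha> < 2" using \<alpha> by (simp add: divide_less_eq)
    then show ?thesis using 2 t by (simp add: H_le1_def near_profile_def ennreal_mult_top)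
  next
    case 3
    then have "\<beta> - 1 - \<beta> * d / \<alpha> = - 1 - \<beta>" using \<alpha> by (simp add: field_simps)
    then have ex: "t powr (\<beta> - 1 - \<beta> * d / \<alpha>) = t powr (- 1 - \<beta>)" by (simp only:)
    show ?thesis using 3 t \<alpha> unfolding ex
      by (simp add: H_le1_def near_profile_def ennreal_mult')
  next
    case 4
    then have *: "\<not> d / \<alpha> < 2" "d / \<alpha> \<noteq> 2" using \<alpha> by (simp_all add: divide_less_eq nonzero_divide_eq_eq)
    have "t powr (\<beta> - 1 - \<beta> * d / \<alpha>) * (r powr \<alpha> / t powr \<beta>) powr (2 - d / \<alpha>)
      = (t powr (\<beta> - 1 - \<beta> * d / \<alpha>) * t powr (- \<beta> * (2 - d / \<alpha>))) * r powr (\<alpha> * (2 - d / \<alpha>))"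
      using powr_quotient[OF t r] by (simp only: mult.assoc)
    moreover have "t powr (\<beta> - 1 - \<beta> * d / \<alpha>) * t powr (- \<beta> * (2 - d / \<alpha>)) = t powr (- 1 - \<beta>)"
      by (simp add: powr_add[symmetric] algebra_simps)
    moreover have "r powr (\<alpha> * (2 - d / \<alpha>)) = 1 / r powr (d - 2 * \<alpha>)"
      using \<alpha> by (simp add: powr_minus_divide[symmetric] algebra_simps)
    ultimately have "t powr (- 1 - \<beta>) / r powr (d - 2 * \<alpha>) =
      t powr (\<beta> - 1 - \<beta> * d / \<alpha>) * (r powr \<alpha> / t powr \<beta>) powr (2 - d / \<alpha>)" by simp
    then show ?thesis using 4 t *
      by (simp add: H_le1_def near_profile_def ennreal_mult')
  qed
qed

lemma H_ge1_j_scaling: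
  assumes t: "t > 0" and r: "r > 0" and \<alpha>: "\<alpha> > 0"
  shows "H_ge1_j d \<alpha> \<beta> t r =
    ennreal (t powr (\<beta> - 1 - \<beta> * d / \<alpha>) * (r powr \<alpha> / t powr \<beta>) powr (- (d / \<alpha>) - 1))"
proof -
  have "t powr (\<beta> - 1 - \<beta> * d / \<alpha>) * (r powr \<alpha> / t powr \<beta>) powr (- (d / \<alpha>) - 1)
    = (t powr (\<beta> - 1 - \<beta> * d / \<alpha>) * t powr (- \<beta> * (- (d / \<alpha>) - 1))) * r powr (\<alpha> * (- (d / \<alpha>) - 1))"
    using powr_quotient[OF t less_imp_le[OF r]] by (simp only: mult.assoc)
  moreover have "t powr (\<beta> - 1 - \<beta> * d / \<alpha>) * t powr (- \<beta> * (- (d / \<alpha>) - 1)) = t powr (2 * \<beta> - 1)"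
    by (simp add: powr_add[symmetric] algebra_simps)
  moreover have "r powr (\<alpha> * (- (d / \<alpha>) - 1)) = 1 / r powr (d + \<alpha>)"
  proof -
    have "\<alpha> * (- (d / \<alpha>) - 1) = - (d + \<alpha>)" using \<alpha> by (simp add: field_simps)
    then show ?thesis by (simp only: powr_minus_divide)
  qed
  ultimately show ?thesis by (simp add: H_ge1_j_def)
qed

section \<open>From kernel bounds to bounds of \<open>q\<close>\<close>

text \<open>At \<open>s = t powr \<beta> * W\<close> the factor
  \<open>s powr (- d / \<alpha>)\<close> joins the \<open>W\<close> produced by the substitution to
  give \<open>W powr (1 - d / \<alpha>)\<close>, and the powers of \<open>t\<close> leave the
  integral.\<close>

lemma nn_integral_kernel_profile:
  fixes \<Phi> :: "real \<Rightarrow> real"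
  assumes V: "stable_variable M (S 1) \<beta> c" and S: "stable_subordinator \<beta> M S"
    and p: "continuous_density M S pbar"
    and t: "t > 0" and r: "r \<ge> 0" and \<alpha>: "\<alpha> > 0" and C: "C > 0"
    and \<Phi>[measurable]: "\<Phi> \<in> borel_measurable borel" and \<Phi>0: "\<And>z. 0 \<le> \<Phi> z"
  shows "(\<integral>\<^sup>+ s\<in>{0<..}. ennreal (C * s powr (- d / \<alpha>) * \<Phi> (r powr \<alpha> / s) * pbar s t) \<partial>lborel) =
    ennreal (C * \<beta> * t powr (\<beta> - 1 - \<beta> * d / \<alpha>)) *
      stable_variable.J M (S 1) \<beta> (d / \<alpha>) \<Phi> (r powr \<alpha> / t powr \<beta>)"
proof -
  interpret stable_variable M "S 1" \<beta> c by fact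
  let ?v = "r powr \<alpha> / t powr \<beta>" and ?k = "C * \<beta> * t powr (\<beta> - 1 - \<beta> * d / \<alpha>)"
  have "(\<integral>\<^sup>+ s\<in>{0<..}. ennreal (C * s powr (- d / \<alpha>) * \<Phi> (r powr \<alpha> / s) * pbar s t) \<partial>lborel) =
    (\<integral>\<^sup>+ \<omega>. ennreal (\<beta> * t powr (\<beta> - 1) * (W \<omega> * (C * (t powr \<beta> * W \<omega>) powr (- d / \<alpha>) * \<Phi> (r powr \<alpha> / (t powr \<beta> * W \<omega>))))) \<partial>M)"
    unfolding W_def
    by (rule nn_integral_stable_density[OF \<beta>_pos S p t]) (use C \<Phi>0 in simp_all)
  also have "\<dots> = (\<integral>\<^sup>+ \<omega>. ennreal ?k * ennreal (W \<omega> powr (1 - d / \<alpha>) * \<Phi> (?v / W \<omega>)) \<partial>M)"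
  proof (rule nn_integral_cong_AE, use W_pos in eventually_elim)
    case (elim \<omega>)
    let ?z = "\<Phi> (?v / W \<omega>)"
    have 1: "W \<omega> * (t powr \<beta> * W \<omega>) powr (- d / \<alpha>) = t powr (\<beta> * (- d / \<alpha>)) * W \<omega> powr (1 - d / \<alpha>)"
      using elim t powr_add[of "W \<omega>" 1 "- d / \<alpha>"] by (simp add: powr_mult powr_powr)
    have 2: "t powr (\<beta> - 1) * t powr (\<beta> * (- d / \<alpha>)) = t powr (\<beta> - 1 - \<beta> * d / \<alpha>)"
      by (simp add: powr_add[symmetric])
    have 3: "r powr \<alpha> / (t powr \<beta> * W \<omega>) = ?v / W \<omega>" by simp
    have "\<beta> * t powr (\<beta> - 1) * (W \<omega> * (C * (t powr \<beta> * W \<omega>) powr (- d / \<alpha>) * \<Phi> (r powr \<alpha> / (t powr \<beta> * W \<omega>))))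
      = C * \<beta> * t powr (\<beta> - 1) * (W \<omega> * (t powr \<beta> * W \<omega>) powr (- d / \<alpha>)) * ?z"
      unfolding 3 by (simp only: ac_simps)
    also have "\<dots> = C * \<beta> * (t powr (\<beta> - 1) * t powr (\<beta> * (- d / \<alpha>))) * (W \<omega> powr (1 - d / \<alpha>) * ?z)"
      unfolding 1 by (simp only: ac_simps)
    also have "\<dots> = ?k * (W \<omega> powr (1 - d / \<alpha>) * ?z)" unfolding 2 ..
    finally have eq: "\<beta> * t powr (\<beta> - 1) * (W \<omega> * (C * (t powr \<beta> * W \<omega>) powr (- d / \<alpha>) * \<Phi> (r powr \<alpha> / (t powr \<beta> * W \<omega>))))
      = ?k * (W \<omega> powr (1 - d / \<alpha>) * ?z)" .
    show ?case
      unfolding eq using C \<beta>_pos \<Phi>0 by (intro ennreal_mult) simp_all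
  qed
  also have "\<dots> = ennreal ?k * J (d / \<alpha>) \<Phi> ?v"
    unfolding J_def by (rule nn_integral_cmult) measurable
  finally show ?thesis .
qed

text \<open>Pointwise kernel bounds integrate against \<open>pbar \<ge> 0\<close>. The inner
  constants \<open>c1\<close> and \<open>c2\<close> may differ, so the two sides involve
  \<open>J\<close> for two profiles.\<close>

lemma poisson_fundamental_bounds:
  fixes F :: "real \<Rightarrow> real"
  assumes V: "stable_variable M (S 1) \<beta> k" and S: "stable_subordinator \<beta> M S"
    and p: "continuous_density M S pbar"
    and t: "t > 0" and \<alpha>: "\<alpha> > 0" and C: "C1 > 0" "C2 > 0" and c: "c1 > 0" "c2 > 0"
    and F[measurable]: "F \<in> borel_measurable borel" and F0: "\<And>z. 0 \<le> F z"
    and bd: "\<And>s. s > 0 \<Longrightarrow>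
      C1 * s powr (- d / \<alpha>) * F (c1 * dist x y / s powr (1 / \<alpha>)) \<le> p0 s x y \<and>
      p0 s x y \<le> C2 * s powr (- d / \<alpha>) * F (c2 * dist x y / s powr (1 / \<alpha>))"
  shows "ennreal (C1 * \<beta> * t powr (\<beta> - 1 - \<beta> * d / \<alpha>)) *
      stable_variable.J M (S 1) \<beta> (d / \<alpha>) (\<lambda>z. F (c1 * z powr (1 / \<alpha>))) (dist x y powr \<alpha> / t powr \<beta>)
      \<le> poisson_fundamental p0 pbar t x y"
    and "poisson_fundamental p0 pbar t x y \<le> ennreal (C2 * \<beta> * t powr (\<beta> - 1 - \<beta> * d / \<alpha>)) *
      stable_variable.J M (S 1) \<beta> (d / \<alpha>) (\<lambda>z. F (c2 * z powr (1 / \<alpha>))) (dist x y powr \<alpha> / t powr \<beta>)"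
proof -
  have pb: "0 \<le> pbar s t" if "s > 0" for s
    using p that by (simp add: continuous_density_def)
  have arg: "(dist x y powr \<alpha> / s) powr (1 / \<alpha>) = dist x y / s powr (1 / \<alpha>)" if "s > 0" for s
    using that \<alpha> by (simp add: powr_divide powr_powr)
  have rep: "ennreal (C * \<beta> * t powr (\<beta> - 1 - \<beta> * d / \<alpha>)) *
      stable_variable.J M (S 1) \<beta> (d / \<alpha>) (\<lambda>z. F (c * z powr (1 / \<alpha>))) (dist x y powr \<alpha> / t powr \<beta>)
    = (\<integral>\<^sup>+ s\<in>{0<..}. ennreal (C * s powr (- d / \<alpha>) * F (c * (dist x y powr \<alpha> / s) powr (1 / \<alpha>)) * pbar s t) \<partial>lborel)"
    if "C > 0" for C c
    by (rule nn_integral_kernel_profile[OF V S p t _ \<alpha> that, symmetric]) (use F0 in simp_all)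
  show "ennreal (C1 * \<beta> * t powr (\<beta> - 1 - \<beta> * d / \<alpha>)) *
      stable_variable.J M (S 1) \<beta> (d / \<alpha>) (\<lambda>z. F (c1 * z powr (1 / \<alpha>))) (dist x y powr \<alpha> / t powr \<beta>)
      \<le> poisson_fundamental p0 pbar t x y"
    unfolding rep[OF C(1)] poisson_fundamental_def
    using bd pb arg
    by (intro nn_integral_mono) (auto simp: indicator_def intro!: ennreal_leI mult_right_mono)
  show "poisson_fundamental p0 pbar t x y \<le> ennreal (C2 * \<beta> * t powr (\<beta> - 1 - \<beta> * d / \<alpha>)) *
      stable_variable.J M (S 1) \<beta> (d / \<alpha>) (\<lambda>z. F (c2 * z powr (1 / \<alpha>))) (dist x y powr \<alpha> / t powr \<beta>)"
    unfolding rep[OF C(2)] poisson_fundamental_def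
    using bd pb arg
    by (intro nn_integral_mono) (auto simp: indicator_def intro!: ennreal_leI mult_right_mono)
qed

context stable_variable
begin

text \<open>\<open>W\<close> is a value of \<open>powr\<close>, hence nonnegative, so
  \<open>\<Phi>\<close> is evaluated only on the nonnegative half-line.\<close>

lemma J_cong:
  assumes "\<And>z. z \<ge> 0 \<Longrightarrow> \<Phi> z = \<Psi> z" "v \<ge> 0"
  shows "J \<gamma> \<Phi> v = J \<gamma> \<Psi> v"
  unfolding J_def using assms by (intro nn_integral_cong) (simp add: W_def)

end

lemma powr_quotient_le_1:
  fixes r t :: real
  assumes "t > 0" "\<alpha> > 0" "0 \<le> r" "r \<le> t powr (\<beta> / \<alpha>)"
  shows "r powr \<alpha> / t powr \<beta> \<le> 1"
proof -
  have "r powr \<alpha> \<le> (t powr (\<beta> / \<alpha>)) powr \<alpha>" using assms by (intro powr_mono2) simp_all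
  then show ?thesis using assms by (simp add: powr_powr)
qed

lemma powr_quotient_ge_1:
  fixes r t :: real
  assumes "t > 0" "\<alpha> > 0" "t powr (\<beta> / \<alpha>) \<le> r"
  shows "1 \<le> r powr \<alpha> / t powr \<beta>"
proof -
  have "(t powr (\<beta> / \<alpha>)) powr \<alpha> \<le> r powr \<alpha>" using assms by (intro powr_mono2) simp_all
  then show ?thesis using assms by (simp add: powr_powr)
qed

lemma comparable_on_scaled:
  fixes \<tau> :: "'i \<Rightarrow> real"
  assumes pos: "a > 0" "b > 0" "c' > 0" "c'' > 0" and \<tau>: "\<And>z. 0 \<le> \<tau> z"
    and H: "\<And>z. z \<in> Z \<Longrightarrow> H z = ennreal (\<tau> z) * N z"
    and q: "\<And>z. z \<in> Z \<Longrightarrow> ennreal (a * \<tau> z) * J1 z \<le> q z" "\<And>z. z \<in> Z \<Longrightarrow> q z \<le> ennreal (b * \<tau> z) * J2 z"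
    and J: "\<And>z. z \<in> Z \<Longrightarrow> ennreal c' * N z \<le> J1 z" "\<And>z. z \<in> Z \<Longrightarrow> J2 z \<le> ennreal c'' * N z"
  shows "comparable_on Z q H"
  unfolding comparable_on_def
proof (intro exI conjI ballI)
  show "a * c' > 0" "b * c'' > 0" using pos by simp_all
  fix z assume z: "z \<in> Z"
  have "ennreal (a * c') * H z = ennreal (a * \<tau> z) * (ennreal c' * N z)"
    using pos \<tau>[of z] by (simp add: H[OF z] ennreal_mult ac_simps)
  also have "\<dots> \<le> ennreal (a * \<tau> z) * J1 z" by (intro mult_left_mono J z) simp
  also have "\<dots> \<le> q z" by (rule q[OF z])
  finally show "ennreal (a * c') * H z \<le> q z" .
  have "q z \<le> ennreal (b * \<tau> z) * J2 z" by (rule q[OF z])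
  also have "\<dots> \<le> ennreal (b * \<tau> z) * (ennreal c'' * N z)" by (intro mult_left_mono J z) simp
  also have "\<dots> = ennreal (b * c'') * H z"
    using pos \<tau>[of z] by (simp add: H[OF z] ennreal_mult ac_simps)
  finally show "q z \<le> ennreal (b * c'') * H z" .
qed

section \<open>The two profiles and the final estimates\<close>

text \<open>The first bound drops the power of \<open>z\<close>, the second drops the summand 1, and
  one constant serves both. The third rests on \<open>1 + c * z powr (1 / \<alpha>) \<le> (1 + c) *
  v powr (1 / \<alpha>)\<close>, true because \<open>z \<le> v\<close> and
  \<open>v \<ge> 1\<close>.\<close>

lemma polynomial_profile_bounds:
  fixes d \<alpha> c :: real
  assumes d: "d > 0" and \<alpha>: "\<alpha> > 0" and c: "c > 0"
  defines "\<Phi> \<equiv> \<lambda>z. (1 + \<bar>c * z powr (1 / \<alpha>)\<bar>) powr (- d - \<alpha>)"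
  shows "\<And>z. \<Phi> z \<le> 1 + c powr (- d - \<alpha>)"
    and "\<And>z. z > 0 \<Longrightarrow> \<Phi> z \<le> (1 + c powr (- d - \<alpha>)) * z powr (- (d / \<alpha>) - 1)"
    and "\<And>z v. 0 \<le> z \<Longrightarrow> z \<le> v \<Longrightarrow> 1 \<le> v \<Longrightarrow> (1 + c) powr (- d - \<alpha>) * v powr (- (d / \<alpha>) - 1) \<le> \<Phi> z"
proof -
  have e: "1 / \<alpha> * (- d - \<alpha>) = - (d / \<alpha>) - 1" using \<alpha> by (simp add: field_simps)
  show "\<Phi> z \<le> 1 + c powr (- d - \<alpha>)" for z
  proof -
    have "\<Phi> z \<le> 1 powr (- d - \<alpha>)" unfolding \<Phi>_def using d \<alpha> by (intro powr_mono2') simp_all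
    then show ?thesis by (simp add: add_increasing2)
  qed
  show "\<Phi> z \<le> (1 + c powr (- d - \<alpha>)) * z powr (- (d / \<alpha>) - 1)" if "z > 0" for z
  proof -
    have "\<Phi> z \<le> (c * z powr (1 / \<alpha>)) powr (- d - \<alpha>)"
      unfolding \<Phi>_def using d \<alpha> c that by (intro powr_mono2') simp_all
    also have "\<dots> = c powr (- d - \<alpha>) * z powr (- (d / \<alpha>) - 1)"
      using c e by (simp only: powr_mult powr_powr less_imp_le powr_ge_zero)
    also have "\<dots> \<le> (1 + c powr (- d - \<alpha>)) * z powr (- (d / \<alpha>) - 1)"
      by (intro mult_right_mono) simp_all
    finally show ?thesis .
  qed
  show "(1 + c) powr (- d - \<alpha>) * v powr (- (d / \<alpha>) - 1) \<le> \<Phi> z" if z: "0 \<le> z" "z \<le> v" "1 \<le> v" for z v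
  proof -
    have "1 \<le> v powr (1 / \<alpha>)" using z \<alpha> by (simp add: ge_one_powr_ge_zero)
    moreover have "z powr (1 / \<alpha>) \<le> v powr (1 / \<alpha>)" using z \<alpha> by (intro powr_mono2) simp_all
    then have "c * z powr (1 / \<alpha>) \<le> c * v powr (1 / \<alpha>)" using c by (intro mult_left_mono) simp_all
    moreover have "\<bar>c * z powr (1 / \<alpha>)\<bar> = c * z powr (1 / \<alpha>)" using c by simp
    ultimately have le: "1 + \<bar>c * z powr (1 / \<alpha>)\<bar> \<le> (1 + c) * v powr (1 / \<alpha>)"
      unfolding distrib_right by linarith
    have "(1 + c) powr (- d - \<alpha>) * v powr (- (d / \<alpha>) - 1) = ((1 + c) * v powr (1 / \<alpha>)) powr (- d - \<alpha>)"
      unfolding e[symmetric] using c by (simp add: powr_mult powr_powr)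
    also have "\<dots> \<le> \<Phi> z" unfolding \<Phi>_def using le d \<alpha> by (intro powr_mono2') simp_all
    finally show ?thesis .
  qed
qed

lemma exponential_profile_eq:
  fixes \<alpha> c z :: real
  assumes "\<alpha> \<ge> 2" "c > 0" "z \<ge> 0"
  shows "exp (- ((c * z powr (1 / \<alpha>)) powr (\<alpha> / (\<alpha> - 1)))) = exp (- (c powr (\<alpha> / (\<alpha> - 1))) * z powr (1 / (\<alpha> - 1)))"
  using assms by (simp add: powr_mult powr_powr)

theorem theorem1p4:
  fixes \<mu> :: "'a::metric_space measure"
    and \<Omega> :: "'w measure" and \<F> :: "real \<Rightarrow> 'w measure"
    and P :: "'a \<Rightarrow> 'w measure" and X :: "real \<Rightarrow> 'w \<Rightarrow> 'a option"
    and L :: "(('a \<Rightarrow> real) \<times> ('a \<Rightarrow> real)) set"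
    and p0 :: "real \<Rightarrow> 'a \<Rightarrow> 'a \<Rightarrow> real"
    and F :: "real \<Rightarrow> real"
    and d \<alpha> \<beta> C1 c1 C2 c2 :: real
    and M :: "'v measure" and S :: "real \<Rightarrow> 'v \<Rightarrow> real"
    and pbar :: "real \<Rightarrow> real \<Rightarrow> real"
    and q :: "real \<Rightarrow> 'a \<Rightarrow> 'a \<Rightarrow> ennreal"
  assumes "locally_compact_space (euclidean :: 'a topology)"
    and "separable_space (euclidean :: 'a topology)"
    and "radon_measure \<mu>" and "full_support \<mu>"
    and "markov_process \<Omega> \<F> P X" and "L = generator P X"
    and "transition_density \<mu> \<Omega> P X p0"
    and "d > 0" and "\<alpha> > 0" and "C1 > 0" and "c1 > 0" and "C2 > 0" and "c2 > 0"
    and "\<And>t x y. t > 0 \<Longrightarrow>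
           C1 * t powr (- d / \<alpha>) * F (c1 * dist x y / t powr (1 / \<alpha>)) \<le> p0 t x y \<and>
           p0 t x y \<le> C2 * t powr (- d / \<alpha>) * F (c2 * dist x y / t powr (1 / \<alpha>))"
    and "0 < \<beta>" and "\<beta> < 1"
    and "stable_subordinator \<beta> M S"
    and "continuous_density M S pbar"
    and "\<And>t x y. t > 0 \<Longrightarrow> q t x y = poisson_fundamental p0 pbar t x y"
  shows "((\<forall>r\<ge>0. F r = (1 + r) powr (- d - \<alpha>)) \<longrightarrow>
            comparable_on {(t, x, y). t > 0 \<and> dist x y \<le> t powr (\<beta> / \<alpha>)}
              (\<lambda>(t, x, y). q t x y) (\<lambda>(t, x, y). H_le1 d \<alpha> \<beta> t (dist x y)) \<and>
            comparable_on {(t, x, y). t > 0 \<and> dist x y \<ge> t powr (\<beta> / \<alpha>)}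
              (\<lambda>(t, x, y). q t x y) (\<lambda>(t, x, y). H_ge1_j d \<alpha> \<beta> t (dist x y)))
       \<and> (\<alpha> \<ge> 2 \<and> (\<forall>r\<ge>0. F r = exp (- (r powr (\<alpha> / (\<alpha> - 1))))) \<longrightarrow>
            comparable_on {(t, x, y). t > 0 \<and> dist x y \<le> t powr (\<beta> / \<alpha>)}
              (\<lambda>(t, x, y). q t x y) (\<lambda>(t, x, y). H_le1 d \<alpha> \<beta> t (dist x y)) \<and>
            (\<exists>C3 c3 C4 c4 :: real. C3 > 0 \<and> c3 > 0 \<and> C4 > 0 \<and> c4 > 0 \<and>
              (\<forall>t x y. t > 0 \<and> dist x y \<ge> t powr (\<beta> / \<alpha>) \<longrightarrow>
                 ennreal (C3 * t powr (\<beta> - 1 - \<beta> * d / \<alpha>) *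
                   exp (- c3 * (dist x y powr \<alpha> / t powr \<beta>) powr (1 / (\<alpha> - \<beta>)))) \<le> q t x y \<and>
                 q t x y \<le> ennreal (C4 * t powr (\<beta> - 1 - \<beta> * d / \<alpha>) *
                   exp (- c4 * (dist x y powr \<alpha> / t powr \<beta>) powr (1 / (\<alpha> - \<beta>)))))))"
proof -
  note p0 = assms(14) and q = assms(19)
  define \<gamma> where "\<gamma> = d / \<alpha>"
  have \<gamma>: "\<gamma> > 0" using assms by (simp add: \<gamma>_def)
  obtain k where V: "stable_variable M (S 1) \<beta> k"
    using stable_variable_time_one[of \<beta> M S pbar] assms by blast
  then interpret stable_variable M "S 1" \<beta> k .
  define v where "v = (\<lambda>(t, x :: 'a, y). dist x y powr \<alpha> / t powr \<beta>)"
  define \<tau> where "\<tau> = (\<lambda>(t, x :: 'a, y :: 'a). t powr (\<beta> - 1 - \<beta> * d / \<alpha>))"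
  let ?near = "{(t, x :: 'a, y). t > 0 \<and> dist x y \<le> t powr (\<beta> / \<alpha>)}"
  let ?far = "{(t, x :: 'a, y). t > 0 \<and> dist x y \<ge> t powr (\<beta> / \<alpha>)}"
  let ?q = "\<lambda>(t, x, y). q t x y"
  have \<tau>: "0 \<le> \<tau> z" for z by (simp add: \<tau>_def split: prod.split)
  have v0: "0 \<le> v z" for z by (simp add: v_def split: prod.split)
  have v1: "v z \<le> 1" if "z \<in> ?near" for z
    using that powr_quotient_le_1[OF _ \<open>\<alpha> > 0\<close>] by (auto simp: v_def)
  have v2: "1 \<le> v z" if "z \<in> ?far" for z
    using that powr_quotient_ge_1[OF _ \<open>\<alpha> > 0\<close>] by (auto simp: v_def)
  \<comment> \<open>\<open>F\<close> is prescribed on the nonnegative half-line only and may fail to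
    be measurable elsewhere, so the bounds are stated for a nonnegative Borel function
    \<open>G\<close> that agrees with it there.\<close>
  have qbd: "ennreal (C1 * \<beta> * \<tau> z) * J \<gamma> (\<lambda>z. G (c1 * z powr (1 / \<alpha>))) (v z) \<le> ?q z"
    "?q z \<le> ennreal (C2 * \<beta> * \<tau> z) * J \<gamma> (\<lambda>z. G (c2 * z powr (1 / \<alpha>))) (v z)"
    if G: "G \<in> borel_measurable borel" "\<And>r. 0 \<le> G r" "\<And>r. r \<ge> 0 \<Longrightarrow> F r = G r" and z: "z \<in> ?near \<union> ?far" for z G
  proof -
    obtain t x y where txy: "z = (t, x, y)" "t > 0" using z by auto
    have bd: "C1 * s powr (- d / \<alpha>) * G (c1 * dist x y / s powr (1 / \<alpha>)) \<le> p0 s x y \<and>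
        p0 s x y \<le> C2 * s powr (- d / \<alpha>) * G (c2 * dist x y / s powr (1 / \<alpha>))" if "s > 0" for s
      using p0[OF that, of x y] G(3)[of "c1 * dist x y / s powr (1 / \<alpha>)"]
        G(3)[of "c2 * dist x y / s powr (1 / \<alpha>)"] \<open>c1 > 0\<close> \<open>c2 > 0\<close> by simp
    note * = poisson_fundamental_bounds[where F = G and S = S and d = d and x = x and y = y and ?p0.0 = p0, OF V \<open>stable_subordinator \<beta> M S\<close> \<open>continuous_density M S pbar\<close>
        txy(2) \<open>\<alpha> > 0\<close> \<open>C1 > 0\<close> \<open>C2 > 0\<close> \<open>c1 > 0\<close> \<open>c2 > 0\<close> G(1,2) bd]
    show "ennreal (C1 * \<beta> * \<tau> z) * J \<gamma> (\<lambda>z. G (c1 * z powr (1 / \<alpha>))) (v z) \<le> ?q z"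
      using *(1) txy by (simp add: q \<tau>_def v_def \<gamma>_def)
    show "?q z \<le> ennreal (C2 * \<beta> * \<tau> z) * J \<gamma> (\<lambda>z. G (c2 * z powr (1 / \<alpha>))) (v z)"
      using *(2) txy by (simp add: q \<tau>_def v_def \<gamma>_def)
  qed
  have H_near: "(\<lambda>(t, x, y). H_le1 d \<alpha> \<beta> t (dist x y)) z = ennreal (\<tau> z) * near_profile \<gamma> (v z)" if "z \<in> ?near" for z
    using that assms(8,9) by (auto simp: H_le1_scaling \<tau>_def v_def \<gamma>_def)
  have H_far: "(\<lambda>(t, x, y). H_ge1_j d \<alpha> \<beta> t (dist x y)) z = ennreal (\<tau> z) * ennreal (v z powr (- \<gamma> - 1))" if z: "z \<in> ?far" for z
  proof -
    obtain t x y where txy: "z = (t, x, y)" "t > 0" "t powr (\<beta> / \<alpha>) \<le> dist x y" using z by auto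
    then have "dist x y > 0" by (metis powr_gt_zero less_le_trans less_irrefl)
    then show ?thesis using txy \<open>\<alpha> > 0\<close>
      by (simp add: H_ge1_j_scaling \<tau>_def v_def \<gamma>_def ennreal_mult)
  qed
  \<comment> \<open>Shared by both profiles: for \<open>v \<le> 1\<close> only boundedness, decay
    with exponent \<open>- \<gamma> - 1\<close> and a positive lower bound on \<open>{0..1}\<close>
    matter.\<close>
  have near: "comparable_on ?near ?q (\<lambda>(t, x, y). H_le1 d \<alpha> \<beta> t (dist x y))"
    if G: "G \<in> borel_measurable borel" "\<And>r. 0 \<le> G r" "\<And>r. r \<ge> 0 \<Longrightarrow> F r = G r"
      and K: "K > 0" "\<And>z. z \<ge> 0 \<Longrightarrow> G (c2 * z powr (1 / \<alpha>)) \<le> K"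
        "\<And>z. z > 0 \<Longrightarrow> G (c2 * z powr (1 / \<alpha>)) \<le> K * z powr (- \<gamma> - 1)"
      and l: "l > 0" "\<And>z. 0 \<le> z \<Longrightarrow> z \<le> 1 \<Longrightarrow> l \<le> G (c1 * z powr (1 / \<alpha>))" for G K l
  proof -
    obtain c' where c': "c' > 0"
      "\<And>v. 0 \<le> v \<Longrightarrow> v \<le> 1 \<Longrightarrow> ennreal c' * near_profile \<gamma> v \<le> J \<gamma> (\<lambda>z. G (c1 * z powr (1 / \<alpha>))) v"
      using J_near_lower[where \<Phi> = "\<lambda>z. G (c1 * z powr (1 / \<alpha>))", OF \<gamma> l] by blast
    obtain c'' where c'': "c'' > 0"
      "\<And>v. 0 \<le> v \<Longrightarrow> v \<le> 1 \<Longrightarrow> J \<gamma> (\<lambda>z. G (c2 * z powr (1 / \<alpha>))) v \<le> ennreal c'' * near_profile \<gamma> v"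
      using J_near_upper[where \<Phi> = "\<lambda>z. G (c2 * z powr (1 / \<alpha>))", OF \<gamma> K] by blast
    show ?thesis
    proof (rule comparable_on_scaled[OF _ _ c'(1) c''(1) \<tau> H_near])
      show "C1 * \<beta> > 0" "C2 * \<beta> > 0" using assms by simp_all
      fix z assume z: "z \<in> ?near"
      then have z': "z \<in> ?near \<union> ?far" by (rule UnI1)
      show "ennreal (C1 * \<beta> * \<tau> z) * J \<gamma> (\<lambda>z. G (c1 * z powr (1 / \<alpha>))) (v z) \<le> ?q z"
        by (rule qbd(1)[OF G z'])
      show "?q z \<le> ennreal (C2 * \<beta> * \<tau> z) * J \<gamma> (\<lambda>z. G (c2 * z powr (1 / \<alpha>))) (v z)"
        by (rule qbd(2)[OF G z'])
      show "ennreal c' * near_profile \<gamma> (v z) \<le> J \<gamma> (\<lambda>z. G (c1 * z powr (1 / \<alpha>))) (v z)"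
        by (rule c'(2)[OF v0 v1[OF z]])
      show "J \<gamma> (\<lambda>z. G (c2 * z powr (1 / \<alpha>))) (v z) \<le> ennreal c'' * near_profile \<gamma> (v z)"
        by (rule c''(2)[OF v0 v1[OF z]])
    qed
  qed
  show ?thesis
  proof (intro conjI impI)
    assume "\<forall>r\<ge>0. F r = (1 + r) powr (- d - \<alpha>)"
    define G where "G = (\<lambda>r::real. (1 + \<bar>r\<bar>) powr (- d - \<alpha>))"
    have G: "G \<in> borel_measurable borel" "\<And>r. 0 \<le> G r" "\<And>r. r \<ge> 0 \<Longrightarrow> F r = G r"
      using \<open>\<forall>r\<ge>0. F r = (1 + r) powr (- d - \<alpha>)\<close> by (simp_all add: G_def)
    let ?K = "1 + c2 powr (- d - \<alpha>)" and ?l = "(1 + c1) powr (- d - \<alpha>)"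
    have K: "?K > 0" "\<And>z. z \<ge> 0 \<Longrightarrow> G (c2 * z powr (1 / \<alpha>)) \<le> ?K"
        "\<And>z. z > 0 \<Longrightarrow> G (c2 * z powr (1 / \<alpha>)) \<le> ?K * z powr (- \<gamma> - 1)"
      using polynomial_profile_bounds(1,2)[OF \<open>d > 0\<close> \<open>\<alpha> > 0\<close> \<open>c2 > 0\<close>]
      unfolding G_def \<gamma>_def by (auto intro: add_pos_nonneg)
    have l: "?l > 0" "\<And>z v. 0 \<le> z \<Longrightarrow> z \<le> v \<Longrightarrow> 1 \<le> v \<Longrightarrow> ?l * v powr (- \<gamma> - 1) \<le> G (c1 * z powr (1 / \<alpha>))"
      using polynomial_profile_bounds(3)[OF \<open>d > 0\<close> \<open>\<alpha> > 0\<close> \<open>c1 > 0\<close>] \<open>c1 > 0\<close>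
      unfolding G_def \<gamma>_def by auto
    \<comment> \<open>The lower bound \<open>l(2)\<close> taken at \<open>v = 1\<close> is the
      constant lower bound on \<open>{0..1}\<close>.\<close>
    show "comparable_on ?near ?q (\<lambda>(t, x, y). H_le1 d \<alpha> \<beta> t (dist x y))"
      by (rule near[OF G K l(1)]) (use l(2)[of _ 1] in simp_all)
    obtain c' where c': "c' > 0" "\<And>v. v \<ge> 1 \<Longrightarrow> ennreal (c' * v powr (- \<gamma> - 1)) \<le> J \<gamma> (\<lambda>z. G (c1 * z powr (1 / \<alpha>))) v"
      using J_far_lower_polynomial[where \<Phi> = "\<lambda>z. G (c1 * z powr (1 / \<alpha>))", OF \<gamma> l] by blast
    obtain c'' where c'': "c'' > 0" "\<And>v. v \<ge> 1 \<Longrightarrow> J \<gamma> (\<lambda>z. G (c2 * z powr (1 / \<alpha>))) v \<le> ennreal (c'' * v powr (- \<gamma> - 1))"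
      using J_far_upper_polynomial[where \<Phi> = "\<lambda>z. G (c2 * z powr (1 / \<alpha>))", OF K(1,3)] by blast
    show "comparable_on ?far ?q (\<lambda>(t, x, y). H_ge1_j d \<alpha> \<beta> t (dist x y))"
    proof (rule comparable_on_scaled[OF _ _ c'(1) c''(1) \<tau> H_far])
      show "C1 * \<beta> > 0" "C2 * \<beta> > 0" using assms by simp_all
      fix z assume z: "z \<in> ?far"
      then have z': "z \<in> ?near \<union> ?far" by (rule UnI2)
      show "ennreal (C1 * \<beta> * \<tau> z) * J \<gamma> (\<lambda>z. G (c1 * z powr (1 / \<alpha>))) (v z) \<le> ?q z"
        by (rule qbd(1)[OF G z'])
      show "?q z \<le> ennreal (C2 * \<beta> * \<tau> z) * J \<gamma> (\<lambda>z. G (c2 * z powr (1 / \<alpha>))) (v z)"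
        by (rule qbd(2)[OF G z'])
      show "ennreal c' * ennreal (v z powr (- \<gamma> - 1)) \<le> J \<gamma> (\<lambda>z. G (c1 * z powr (1 / \<alpha>))) (v z)"
        using c'(2)[OF v2[OF z]] c'(1) by (simp add: ennreal_mult)
      show "J \<gamma> (\<lambda>z. G (c2 * z powr (1 / \<alpha>))) (v z) \<le> ennreal c'' * ennreal (v z powr (- \<gamma> - 1))"
        using c''(2)[OF v2[OF z]] c''(1) by (simp add: ennreal_mult)
    qed
  next
    assume "\<alpha> \<ge> 2 \<and> (\<forall>r\<ge>0. F r = exp (- (r powr (\<alpha> / (\<alpha> - 1)))))"
    then have \<alpha>2: "\<alpha> \<ge> 2" "\<alpha> > 1" and F: "\<And>r. r \<ge> 0 \<Longrightarrow> F r = exp (- (r powr (\<alpha> / (\<alpha> - 1))))" by auto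
    define G where "G = (\<lambda>r::real. exp (- (r powr (\<alpha> / (\<alpha> - 1)))))"
    have G: "G \<in> borel_measurable borel" "\<And>r. 0 \<le> G r" "\<And>r. r \<ge> 0 \<Longrightarrow> F r = G r"
      using F by (simp_all add: G_def)
    define l1 l2 where "l1 = c1 powr (\<alpha> / (\<alpha> - 1))" and "l2 = c2 powr (\<alpha> / (\<alpha> - 1))"
    have l12: "l1 > 0" "l2 > 0" using assms by (simp_all add: l1_def l2_def)
    have G1: "G (c1 * z powr (1 / \<alpha>)) = exp (- l1 * z powr (1 / (\<alpha> - 1)))"
      and G2: "G (c2 * z powr (1 / \<alpha>)) = exp (- l2 * z powr (1 / (\<alpha> - 1)))" if "z \<ge> 0" for z
      using exponential_profile_eq[OF \<alpha>2(1) _ that] assms(11,13) by (simp_all add: G_def l1_def l2_def)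
    obtain K where K: "K > 0" "\<And>z. z > 0 \<Longrightarrow> exp (- l2 * z powr (1 / (\<alpha> - 1))) \<le> K * z powr (- (\<gamma> + 1))"
      using exp_minus_powr_le[of l2 "1 / (\<alpha> - 1)" "\<gamma> + 1"] l12 \<alpha>2 \<gamma> by auto
    show "comparable_on ?near ?q (\<lambda>(t, x, y). H_le1 d \<alpha> \<beta> t (dist x y))"
    proof (rule near[OF G])
      \<comment> \<open>\<open>K\<close> serves the decay and 1 bounds \<open>G\<close> itself; the
        sum is one constant for both. \<open>exp (- l1)\<close> is the value of the lower profile at
        \<open>z = 1\<close>, its minimum on \<open>{0..1}\<close>.\<close>
      show "K + 1 > 0" "exp (- l1) > 0" using K by simp_all
      show "G (c2 * z powr (1 / \<alpha>)) \<le> K + 1" if "z \<ge> 0" for z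
      proof -
        have "G (c2 * z powr (1 / \<alpha>)) \<le> 1" by (simp add: G_def)
        then show ?thesis using K(1) by linarith
      qed
      show "G (c2 * z powr (1 / \<alpha>)) \<le> (K + 1) * z powr (- \<gamma> - 1)" if "z > 0" for z
        using K(2)[OF that] G2[of z] that by (simp add: distrib_right add_increasing2)
      show "exp (- l1) \<le> G (c1 * z powr (1 / \<alpha>))" if "0 \<le> z" "z \<le> 1" for z
      proof -
        have "z powr (1 / (\<alpha> - 1)) \<le> 1" using that \<alpha>2 by (intro powr_le1) simp_all
        then have "l1 * z powr (1 / (\<alpha> - 1)) \<le> l1" using l12 by (simp add: mult_left_le)
        then show ?thesis using G1[OF that(1)] by simp
      qed
    qed
    obtain B1 h1 where B1: "B1 > 0" "h1 > 0" "\<And>v. v \<ge> 1 \<Longrightarrow> ennreal (B1 * exp (- h1 * v powr (1 / (\<alpha> - \<beta>))))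
        \<le> J \<gamma> (\<lambda>z. exp (- l1 * z powr (1 / (\<alpha> - 1)))) v"
      using J_far_lower_exponential[OF \<gamma> \<alpha>2(2) l12(1)] by blast
    obtain B2 h2 where B2: "B2 > 0" "h2 > 0" "\<And>v. v \<ge> 1 \<Longrightarrow> J \<gamma> (\<lambda>z. exp (- l2 * z powr (1 / (\<alpha> - 1)))) v
        \<le> ennreal (B2 * exp (- h2 * v powr (1 / (\<alpha> - \<beta>))))"
      using J_far_upper_exponential[OF \<gamma> \<alpha>2(2) l12(2)] by blast
    have J1: "J \<gamma> (\<lambda>z. G (c1 * z powr (1 / \<alpha>))) (v z) = J \<gamma> (\<lambda>z. exp (- l1 * z powr (1 / (\<alpha> - 1)))) (v z)"
      and J2: "J \<gamma> (\<lambda>z. G (c2 * z powr (1 / \<alpha>))) (v z) = J \<gamma> (\<lambda>z. exp (- l2 * z powr (1 / (\<alpha> - 1)))) (v z)" for z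
      by (rule J_cong[OF _ v0]; rule G1 G2; assumption)+
    show "\<exists>C3 c3 C4 c4 :: real. C3 > 0 \<and> c3 > 0 \<and> C4 > 0 \<and> c4 > 0 \<and>
              (\<forall>t x y. t > 0 \<and> dist x y \<ge> t powr (\<beta> / \<alpha>) \<longrightarrow>
                 ennreal (C3 * t powr (\<beta> - 1 - \<beta> * d / \<alpha>) *
                   exp (- c3 * (dist x y powr \<alpha> / t powr \<beta>) powr (1 / (\<alpha> - \<beta>)))) \<le> q t x y \<and>
                 q t x y \<le> ennreal (C4 * t powr (\<beta> - 1 - \<beta> * d / \<alpha>) *
                   exp (- c4 * (dist x y powr \<alpha> / t powr \<beta>) powr (1 / (\<alpha> - \<beta>)))))"
    proof (intro exI conjI allI impI)
      show "C1 * \<beta> * B1 > 0" "h1 > 0" "C2 * \<beta> * B2 > 0" "h2 > 0" using assms B1 B2 by simp_all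
      fix t :: real and x y :: 'a
      assume txy: "t > 0 \<and> dist x y \<ge> t powr (\<beta> / \<alpha>)"
      let ?z = "(t, x, y)"
      have z: "?z \<in> ?far" using txy by simp
      then have z': "?z \<in> ?near \<union> ?far" by (rule UnI2)
      have "ennreal (C1 * \<beta> * B1 * \<tau> ?z * exp (- h1 * v ?z powr (1 / (\<alpha> - \<beta>)))) =
          ennreal (C1 * \<beta> * \<tau> ?z) * ennreal (B1 * exp (- h1 * v ?z powr (1 / (\<alpha> - \<beta>))))"
        using assms(10,15) B1(1) \<tau>[of ?z] by (subst ennreal_mult[symmetric]) (simp_all add: ac_simps)
      also have "\<dots> \<le> ennreal (C1 * \<beta> * \<tau> ?z) * J \<gamma> (\<lambda>z. G (c1 * z powr (1 / \<alpha>))) (v ?z)"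
        unfolding J1 by (intro mult_left_mono B1(3) v2[OF z]) simp
      also have "\<dots> \<le> q t x y" using qbd(1)[OF G z'] by simp
      finally show "ennreal (C1 * \<beta> * B1 * t powr (\<beta> - 1 - \<beta> * d / \<alpha>) *
          exp (- h1 * (dist x y powr \<alpha> / t powr \<beta>) powr (1 / (\<alpha> - \<beta>)))) \<le> q t x y"
        by (simp add: \<tau>_def v_def)
      have "q t x y \<le> ennreal (C2 * \<beta> * \<tau> ?z) * J \<gamma> (\<lambda>z. G (c2 * z powr (1 / \<alpha>))) (v ?z)"
        using qbd(2)[OF G z'] by simp
      also have "\<dots> \<le> ennreal (C2 * \<beta> * \<tau> ?z) * ennreal (B2 * exp (- h2 * v ?z powr (1 / (\<alpha> - \<beta>))))"
        unfolding J2 by (intro mult_left_mono B2(3) v2[OF z]) simp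
      also have "\<dots> = ennreal (C2 * \<beta> * B2 * \<tau> ?z * exp (- h2 * v ?z powr (1 / (\<alpha> - \<beta>))))"
        using assms(12,15) B2(1) \<tau>[of ?z] by (subst ennreal_mult[symmetric]) (simp_all add: ac_simps)
      finally show "q t x y \<le> ennreal (C2 * \<beta> * B2 * t powr (\<beta> - 1 - \<beta> * d / \<alpha>) *
          exp (- h2 * (dist x y powr \<alpha> / t powr \<beta>) powr (1 / (\<alpha> - \<beta>))))"
        by (simp add: \<tau>_def v_def)
    qed
  qed
qed

end
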